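(* Let $G$ be a finite reflection group on $\mathbb{R}^d$ with positive root system $R_+$ and nonnegative multiplicity function $\kappa$, let $\mu\ge0$, and let $W_{\kappa,\mu}(x)=h_\kappa^2(x)(1-\|x\|^2)^{\mu-1/2}$ on the unit ball $\mathbb{B}^d$ of $\mathbb{R}^d$. Let $f\in W_2^1(\mathbb{B}^d,W_{\kappa,\mu})$ be invariant under the reflection group $G$ and assume $\int_{\mathbb{B}^d}f(x)W_{\kappa,\mu}(x)\,dx=0$ and $\|f\|_{L^2(\mathbb{B}^d,W_{\kappa,\mu})}=1$. Then $$\min_{1\le i\le d}\ b_{\kappa,\mu}\int_{\mathbb{B}^d}(1-x_i)|f(x)|^2W_{\kappa,\mu}(x)\,dx\ \cdot\ |||\nabla f|||^2\ \ge\ C_{\kappa,\mu},$$ where $$|||\nabla f|||^2:=\|\nabla f\|_{L^2(\mathbb{B}^d,W_{\kappa,\mu+1})}^2+\|\nabla_Df\|_{L^2(\mathbb{B}^d,W_{\kappa,\mu})}^2$$ and, with $\lambda_{\kappa,\mu}:=\gamma_\kappa+\mu+\frac{d-1}{2}$, $$C_{\kappa,\mu}=2\lambda_{\kappa,\mu}\left(1-\frac{\sqrt{2\lambda_{\kappa,\mu}}}{\sqrt{(\lambda_{\kappa,\mu}+\frac12)^2+2\lambda_{\kappa,\mu}}}\right).$$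
   Context: For nonzero $v\in\mathbb{R}^d$ the reflection along $v$ is $x\sigma_v:=x-2\langle x,v\rangle v/\|v\|^2$. $G$ is the finite subgroup of the orthogonal group generated by $\{\sigma_v:v\in R_+\}$, where $R_+$ is a fixed positive root system. The multiplicity function $v\mapsto\kappa_v\ge0$ on $R_+$ satisfies $\kappa_u=\kappa_v$ whenever $\sigma_u$ is conjugate to $\sigma_v$ in $G$. $h_\kappa(x)=\prod_{v\in R_+}|\langle x,v\rangle|^{\kappa_v}$ and $\gamma_\kappa=\sum_{v\in R_+}\kappa_v$. "Invariant under $G$" means $f(x\sigma_v)=f(x)$ for all $v\in R_+$. For each $\mu\ge0$, $b_{\kappa,\mu}=\left(\int_{\mathbb{B}^d}W_{\kappa,\mu}(x)\,dx\right)^{-1}$, and $L^2(\mathbb{B}^d,W_{\kappa,\mu})$ is the space of measurable functions for which $\|f\|_{L^2(\mathbb{B}^d,W_{\kappa,\mu})}=\left(b_{\kappa,\mu}\int_{\mathbb{B}^d}|f(x)|^2W_{\kappa,\mu}(x)\,dx\right)^{1/2}$ is finite; for vector-valued functions $|\cdot|$ is the Euclidean norm. $W_2^1(\mathbb{B}^d,W_{\kappa,\mu})$ is the subspace of $L^2(\mathbb{B}^d,W_{\kappa,\mu})$ for which all first order derivatives of its elements are in $L^2(\mathbb{B}^d,W_{\kappa,\mu})$. $\nabla=(\partial_1,\dots,\partial_d)$, $D_{i,j}=x_i\partial_j-x_j\partial_i$ for $i\ne j$, and $\nabla_D$ is the notation satisfying $|\nabla_Df(x)|^2:=\sum_{1\le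 i<j\le d}|D_{i,j}f(x)|^2$. *)

theory Defs
  imports "HOL-Analysis.Analysis"
begin

section \<open>Reflections, positive roots and multiplicity functions\<close>

definition reflection :: "real ^ 'd \<Rightarrow> real ^ 'd \<Rightarrow> real ^ 'd" where
  "reflection v x = x - (2 * (x \<bullet> v) / (norm v)\<^sup>2) *\<^sub>R v"

text \<open>The root system is not required to be reduced.\<close>

definition root_system :: "(real ^ 'd) set \<Rightarrow> bool" where
  "root_system R \<longleftrightarrow> finite R \<and> 0 \<notin> R \<and> (\<forall>u\<in>R. \<forall>v\<in>R. reflection v u \<in> R)"

definition positive_root_system :: "(real ^ 'd) set \<Rightarrow> bool" where
  "positive_root_system Rp \<longleftrightarrow>
     (\<exists>R u0. root_system R \<and> (\<forall>v\<in>R. v \<bullet> u0 \<noteq> 0) \<and> Rp = {v \<in> R. v \<bullet> u0 > 0})"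

text \<open>
  Reflections along nonzero vectors are involutions, so closing the identity under composition
  with them already gives the group they generate. This group is finite because it acts faithfully
  on the span of the finite root system.
\<close>

inductive_set reflection_group :: "(real ^ 'd) set \<Rightarrow> (real ^ 'd \<Rightarrow> real ^ 'd) set"
  for Rp :: "(real ^ 'd) set" where
  one: "id \<in> reflection_group Rp"
| step: "w \<in> reflection_group Rp \<Longrightarrow> v \<in> Rp \<Longrightarrow> w \<circ> reflection v \<in> reflection_group Rp"

definition multiplicity_function :: "(real ^ 'd) set \<Rightarrow> (real ^ 'd \<Rightarrow> real) \<Rightarrow> bool" where
  "multiplicity_function Rp \<kappa> \<longleftrightarrow>
     (\<forall>v\<in>Rp. 0 \<le> \<kappa> v) \<and>
     (\<forall>u\<in>Rp. \<forall>v\<in>Rp.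
        (\<exists>w\<in>reflection_group Rp. reflection u = w \<circ> reflection v \<circ> inv w) \<longrightarrow> \<kappa> u = \<kappa> v)"

section \<open>Weights and weighted \<open>L\<^sup>2\<close> spaces on the ball\<close>

text \<open>
  Since \<open>0 powr a = 0\<close> for every \<open>a\<close>, the two functions below may have unusual values on the
  reflecting hyperplanes and on the unit sphere. These are Lebesgue null sets, and the weights are
  only used under integrals.
\<close>

definition h_weight :: "(real ^ 'd) set \<Rightarrow> (real ^ 'd \<Rightarrow> real) \<Rightarrow> real ^ 'd \<Rightarrow> real" where
  "h_weight Rp \<kappa> x = (\<Prod>v\<in>Rp. \<bar>x \<bullet> v\<bar> powr \<kappa> v)"

definition W_weight ::
    "(real ^ 'd) set \<Rightarrow> (real ^ 'd \<Rightarrow> real) \<Rightarrow> real \<Rightarrow> real ^ 'd \<Rightarrow> real" where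
  "W_weight Rp \<kappa> \<mu> x = (h_weight Rp \<kappa> x)\<^sup>2 * (1 - (norm x)\<^sup>2) powr (\<mu> - 1/2)"

abbreviation unit_ball :: "(real ^ 'd) measure" where
  "unit_ball \<equiv> lebesgue_on (cball 0 1)"

definition b_const :: "(real ^ 'd) set \<Rightarrow> (real ^ 'd \<Rightarrow> real) \<Rightarrow> real \<Rightarrow> real" where
  "b_const Rp \<kappa> \<mu> = inverse (LINT x|unit_ball. W_weight Rp \<kappa> \<mu> x)"

definition L2_space ::
    "(real ^ 'd) set \<Rightarrow> (real ^ 'd \<Rightarrow> real) \<Rightarrow> real \<Rightarrow> (real ^ 'd \<Rightarrow> 'b::euclidean_space) set" where
  "L2_space Rp \<kappa> \<mu> =
     {f \<in> borel_measurable unit_ball.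
        integrable unit_ball (\<lambda>x. (norm (f x))\<^sup>2 * W_weight Rp \<kappa> \<mu> x)}"

definition L2_norm ::
    "(real ^ 'd) set \<Rightarrow> (real ^ 'd \<Rightarrow> real) \<Rightarrow> real \<Rightarrow> (real ^ 'd \<Rightarrow> 'b::euclidean_space) \<Rightarrow> real" where
  "L2_norm Rp \<kappa> \<mu> f =
     sqrt (b_const Rp \<kappa> \<mu> * (LINT x|unit_ball. (norm (f x))\<^sup>2 * W_weight Rp \<kappa> \<mu> x))"

section \<open>Weak gradients and the Sobolev space\<close>

definition locally_integrable_on :: "(real ^ 'd) set \<Rightarrow> (real ^ 'd \<Rightarrow> 'b::euclidean_space) \<Rightarrow> bool" where
  "locally_integrable_on \<Omega> f \<longleftrightarrow> (\<forall>K. compact K \<and> K \<subseteq> \<Omega> \<longrightarrow> integrable (lebesgue_on K) f)"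

text \<open>
  Weak differentiability, tested against the compactly supported \<open>C\<^sup>1\<close> functions \<open>\<phi>\<close> (with gradient
  \<open>\<phi>'\<close>) as in Gilbarg and Trudinger; component \<open>j\<close> of \<open>g\<close> is the weak derivative \<open>\<partial>\<^sub>j f\<close>.
\<close>

definition has_weak_gradient_on ::
    "(real ^ 'd) set \<Rightarrow> (real ^ 'd \<Rightarrow> 'b::euclidean_space) \<Rightarrow> (real ^ 'd \<Rightarrow> 'b ^ 'd) \<Rightarrow> bool" where
  "has_weak_gradient_on \<Omega> f g \<longleftrightarrow>
     locally_integrable_on \<Omega> f \<and> locally_integrable_on \<Omega> g \<and>
     (\<forall>\<phi> \<phi>' K. compact K \<and> K \<subseteq> \<Omega> \<and> (\<forall>x. x \<notin> K \<longrightarrow> \<phi> x = 0) \<and>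
        (\<forall>x. GDERIV \<phi> x :> \<phi>' x) \<and> continuous_on UNIV \<phi>' \<longrightarrow>
        (\<forall>j. (LINT x|lebesgue_on \<Omega>. (\<phi>' x $ j) *\<^sub>R f x) =
             - (LINT x|lebesgue_on \<Omega>. \<phi> x *\<^sub>R (g x $ j))))"

text \<open>
  A function in \<open>L\<^sup>2(W)\<close> has distributional derivatives only where it is locally integrable with
  respect to Lebesgue measure. By the Cauchy-Schwarz inequality this holds for every such function
  on the open subset of the ball where \<open>1/W\<close> is locally integrable, and, following Kufner and Opic,
  this is where the derivatives of the weighted Sobolev space are taken. If \<open>\<kappa>\<^sub>v < 1/2\<close>, generic
  points of the hyperplane orthogonal to \<open>v\<close> belong to this set; for \<open>\<kappa> = 0\<close> it is the whole open
  ball. Its complement in the ball is always a null set.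
\<close>

definition regular_set ::
    "(real ^ 'd) set \<Rightarrow> (real ^ 'd \<Rightarrow> real) \<Rightarrow> real \<Rightarrow> (real ^ 'd) set" where
  "regular_set Rp \<kappa> \<mu> =
     {x. \<exists>\<epsilon>>0. ball x \<epsilon> \<subseteq> ball 0 1 \<and>
           integrable (lebesgue_on (ball x \<epsilon>)) (\<lambda>y. 1 / W_weight Rp \<kappa> \<mu> y)}"

text \<open>The weak gradient is unique up to null sets; the choice below does not affect any integral.\<close>

definition nabla :: "(real ^ 'd) set \<Rightarrow> (real ^ 'd \<Rightarrow> real) \<Rightarrow> real \<Rightarrow>
    (real ^ 'd \<Rightarrow> 'b::euclidean_space) \<Rightarrow> real ^ 'd \<Rightarrow> 'b ^ 'd" where
  "nabla Rp \<kappa> \<mu> f = (SOME g. has_weak_gradient_on (regular_set Rp \<kappa> \<mu>) f g)"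

definition W21_space ::
    "(real ^ 'd) set \<Rightarrow> (real ^ 'd \<Rightarrow> real) \<Rightarrow> real \<Rightarrow> (real ^ 'd \<Rightarrow> 'b::euclidean_space) set" where
  "W21_space Rp \<kappa> \<mu> =
     {f \<in> L2_space Rp \<kappa> \<mu>.
        (\<exists>g. has_weak_gradient_on (regular_set Rp \<kappa> \<mu>) f g) \<and> nabla Rp \<kappa> \<mu> f \<in> L2_space Rp \<kappa> \<mu>}"

text \<open>
  The vector with the entries \<open>D\<^bsub>i,j\<^esub>f = x\<^sub>i \<partial>\<^sub>j f - x\<^sub>j \<partial>\<^sub>i f\<close> for \<open>i < j\<close>, padded with zeros, so that its
  squared norm is the sum of the \<open>|D\<^bsub>i,j\<^esub>f|\<^sup>2\<close> over \<open>i < j\<close>.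
\<close>

definition nabla_D ::
    "(real ^ 'd::{finite,linorder}) set \<Rightarrow> (real ^ 'd::{finite,linorder} \<Rightarrow> real) \<Rightarrow> real \<Rightarrow>
     (real ^ 'd::{finite,linorder} \<Rightarrow> 'b::euclidean_space) \<Rightarrow>
     real ^ 'd::{finite,linorder} \<Rightarrow> 'b ^ ('d::{finite,linorder} \<times> 'd::{finite,linorder})" where
  "nabla_D Rp \<kappa> \<mu> f x =
     (\<chi> p. case p of (i, j) \<Rightarrow>
        if i < j then (x $ i) *\<^sub>R (nabla Rp \<kappa> \<mu> f x $ j) - (x $ j) *\<^sub>R (nabla Rp \<kappa> \<mu> f x $ i) else 0)"

text \<open>
  As in \<open>L2_norm\<close>, the first norm is normalised by \<open>b_const Rp \<kappa> (\<mu> + 1)\<close> and the second one by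
  \<open>b_const Rp \<kappa> \<mu>\<close>.
\<close>

definition energy ::
    "(real ^ 'd::{finite,linorder}) set \<Rightarrow> (real ^ 'd::{finite,linorder} \<Rightarrow> real) \<Rightarrow> real \<Rightarrow>
     (real ^ 'd::{finite,linorder} \<Rightarrow> 'b::euclidean_space) \<Rightarrow> real" where
  "energy Rp \<kappa> \<mu> f =
     (L2_norm Rp \<kappa> (\<mu> + 1) (nabla Rp \<kappa> \<mu> f))\<^sup>2 + (L2_norm Rp \<kappa> \<mu> (nabla_D Rp \<kappa> \<mu> f))\<^sup>2"

text \<open>
  Elements of \<open>L\<^sup>2(W)\<close> are functions up to null sets, so invariance is required almost everywhere;
  invariance at every point of the ball is a special case.
\<close>

definition group_invariant :: "(real ^ 'd) set \<Rightarrow> (real ^ 'd \<Rightarrow> 'b) \<Rightarrow> bool" where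
  "group_invariant Rp f \<longleftrightarrow> (\<forall>v\<in>Rp. AE x in unit_ball. f (reflection v x) = f x)"

section \<open>The constants\<close>

definition lambda_const :: "(real ^ 'd) set \<Rightarrow> (real ^ 'd \<Rightarrow> real) \<Rightarrow> real \<Rightarrow> real" where
  "lambda_const Rp \<kappa> \<mu> = (\<Sum>v\<in>Rp. \<kappa> v) + \<mu> + (real CARD('d) - 1) / 2"

definition C_const :: "(real ^ 'd) set \<Rightarrow> (real ^ 'd \<Rightarrow> real) \<Rightarrow> real \<Rightarrow> real" where
  "C_const Rp \<kappa> \<mu> =
     (let l = lambda_const Rp \<kappa> \<mu>
      in 2 * l * (1 - sqrt (2 * l) / sqrt ((l + 1/2)\<^sup>2 + 2 * l)))"

end

theory Submission
  imports Defs
begin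

text \<open>
  Let \<open>\<nu>\<close> be the weighted measure on the ball and \<open>\<Gamma>\<close> the carre du champ of the energy. For a Sobolev
  function \<open>u\<close> and a \<open>G\<close>-invariant polynomial \<open>p\<close> one has \<open>\<integral> \<Gamma>(p, u) d\<nu> = - \<integral> u (L p) d\<nu>\<close>, where \<open>L\<close> is the
  second order differential-difference operator of the weight: the field \<open>\<nabla>p - \<langle>x, \<nabla>p\<rangle> x\<close> is tangential to the
  sphere and to the reflecting hyperplanes, so cutoffs near these sets leave no boundary terms. On polynomials of
  degree \<open>n\<close> the operator is \<open>- n (n + 2 \<lambda>)\<close> modulo lower degree, and invariant polynomials are dense, so
  orthogonal projection gives the Poincare inequality with constant \<open>1 + 2 \<lambda>\<close>.

  Let \<open>M\<close> be the mean of \<open>x\<^sub>i |f|\<^sup>2\<close>. By invariance \<open>x\<^sub>i\<close> may be replaced by an invariant linear function, for which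
  integration by parts against \<open>u\<^sup>2\<close> and Cauchy-Schwarz give \<open>(\<lambda> + 1/2)\<^sup>2 M\<^sup>2 \<le> (1 - M\<^sup>2) E\<close>, \<open>E\<close> being the energy.
  Together with \<open>E \<ge> 2 \<lambda>\<close> this bounds \<open>(1 - M) E\<close> from below; the worst case is where both bounds for \<open>E\<close>
  coincide. Normalising the gradient term by \<open>b\<close> for \<open>\<mu> + 1\<close> only increases \<open>E\<close>.
\<close>

text \<open>Weak derivatives are controlled only off the reflecting hyperplanes, where a Sobolev
  function may jump, so mollifying \<open>f\<close> is not an option. Instead \<open>f\<close> is
  always paired with smooth fields adapted to the walls, and the approximants are its L2 projections
  onto invariant polynomials of bounded degree. Since \<open>L\<close> does not raise degrees, these
  projections are orthogonal for the energy as well and have at most the energy of \<open>f\<close>.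
  Invariance of \<open>f\<close> is what ties the chambers together: for
  \<open>\<kappa> v \<ge> 1/2\<close> a function that is constant on each chamber has zero energy
  whatever its values, so mean zero alone gives no Poincare inequality. The bound on
  \<open>M\<close> involves the square of \<open>f\<close>, whose gradient need not be square
  integrable. It is therefore proved for polynomials, with Cauchy-Schwarz replaced by Young's
  inequality with a free parameter \<open>c\<close>. For fixed \<open>c\<close> the inequality is
  quadratic in the function, so it survives limits and summation over the components of
  \<open>f\<close>; only then is \<open>c\<close> chosen.\<close>

section \<open>Polynomials and reflections\<close>

text \<open>Polynomials of degree strictly below \<open>n\<close>, so that \<open>n = 0\<close> leaves only the zero function.\<close>

inductive poly_below :: "nat \<Rightarrow> (real ^ 'd \<Rightarrow> real) \<Rightarrow> bool" where
  zero: "poly_below n (\<lambda>x. 0)"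
| const: "poly_below (Suc n) (\<lambda>x. c)"
| coord: "poly_below n p \<Longrightarrow> poly_below (Suc n) (\<lambda>x. x $ i * p x)"
| add: "poly_below n p \<Longrightarrow> poly_below n q \<Longrightarrow> poly_below n (\<lambda>x. p x + q x)"

lemma poly_below_0D: "poly_below 0 p \<Longrightarrow> p x = 0"
proof (induction "0::nat" p rule: poly_below.induct)
qed auto

lemma poly_below_Suc: "poly_below n p \<Longrightarrow> poly_below (Suc n) p"
  by (induction rule: poly_below.induct) (auto intro: poly_below.intros)

lemma poly_below_mono: "m \<le> n \<Longrightarrow> poly_below m p \<Longrightarrow> poly_below n p"
  by (induction n rule: dec_induct) (auto intro: poly_below_Suc)

lemma poly_below_cmult: "poly_below n p \<Longrightarrow> poly_below n (\<lambda>x. c * p x)"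
proof (induction rule: poly_below.induct)
  case (coord n p i)
  have "poly_below (Suc n) (\<lambda>x. x $ i * (c * p x))" by (intro poly_below.coord coord)
  then show ?case by (simp add: mult.left_commute)
qed (auto intro: poly_below.intros simp: distrib_left)

lemma poly_below_diff: "poly_below n p \<Longrightarrow> poly_below n q \<Longrightarrow> poly_below n (\<lambda>x. p x - q x)"
  using poly_below.add[OF _ poly_below_cmult[of n q "-1"]] by simp

lemma poly_below_sum:
  "(\<And>i. i \<in> I \<Longrightarrow> poly_below n (p i)) \<Longrightarrow> poly_below n (\<lambda>x. \<Sum>i\<in>I. p i x)"
  by (induction I rule: infinite_finite_induct) (auto intro: poly_below.intros)

lemma poly_below_coord1: "poly_below (Suc (Suc n)) (\<lambda>x. x $ i)"
  using poly_below.coord[OF poly_below.const[of n 1], of i] by simp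

lemma poly_below_inner: "poly_below (Suc (Suc n)) (\<lambda>x. x \<bullet> v)"
proof -
  have "poly_below (Suc (Suc n)) (\<lambda>x. \<Sum>i\<in>UNIV. v $ i * x $ i)"
    by (intro poly_below_sum poly_below_cmult poly_below_coord1)
  then show ?thesis by (simp add: inner_vec_def mult.commute)
qed

lemma poly_below_mult_linear:
  assumes "poly_below n p" shows "poly_below (Suc n) (\<lambda>x. (x \<bullet> v) * p x)"
proof -
  have "poly_below (Suc n) (\<lambda>x. \<Sum>i\<in>UNIV. v $ i * (x $ i * p x))"
    by (intro poly_below_sum poly_below_cmult poly_below.coord assms)
  then show ?thesis by (simp add: inner_vec_def sum_distrib_right mult.left_commute mult.assoc)
qed

lemma poly_below_mult: "poly_below m p \<Longrightarrow> poly_below n q \<Longrightarrow> poly_below (m + n) (\<lambda>x. p x * q x)"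
proof (induction rule: poly_below.induct)
  case (zero m) then show ?case by (simp add: poly_below.zero)
next
  case (const m c)
  then show ?case by (intro poly_below_cmult) (auto elim: poly_below_mono[rotated])
next
  case (coord m p i)
  then show ?case using poly_below.coord[of "m + n" "\<lambda>x. p x * q x" i] by (simp add: mult.assoc)
next
  case (add m p p')
  then show ?case using poly_below.add by (auto simp: distrib_right)
qed

lemma poly_below_continuous: "poly_below n p \<Longrightarrow> continuous_on A p"
  by (induction rule: poly_below.induct) (auto intro!: continuous_intros)

lemma poly_below_real_polynomial_function:
  fixes p :: "real ^ 'd \<Rightarrow> real"
  assumes "real_polynomial_function p" shows "\<exists>n. poly_below n p"
  using assms
proof (induction rule: real_polynomial_function.induct)
  case (linear f)
  then have l: "linear f" by (rule bounded_linear.linear)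
  have "f x = x \<bullet> (\<chi> i. f (axis i 1))" for x
  proof -
    have "f x = f (\<Sum>i\<in>UNIV. x $ i *\<^sub>R axis i 1)"
      using basis_expansion[of x] by (simp add: scalar_mult_eq_scaleR)
    also have "\<dots> = x \<bullet> (\<chi> i. f (axis i 1))"
      by (simp add: linear_sum[OF l] linear_cmul[OF l] inner_vec_def)
    finally show ?thesis .
  qed
  then have "f = (\<lambda>x. x \<bullet> (\<chi> i. f (axis i 1)))" by blast
  then show ?case using poly_below_inner by metis
next
  case (add f g)
  then obtain m n where "poly_below m f" "poly_below n g" by auto
  then have "poly_below (max m n) (\<lambda>x. f x + g x)"
    by (intro poly_below.add) (auto elim: poly_below_mono[rotated])
  then show ?case by blast
next
  case (mult f g)
  then show ?case using poly_below_mult by blast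
qed (auto intro: poly_below.const)

text \<open>As \<open>poly_below n\<close> means degree at most \<open>n - 1\<close>, the factor
  \<open>real n - 1\<close> is the one in Euler's identity for the top homogeneous part, and only
  lower degree survives in the last clause. For \<open>n = 0\<close> the polynomial vanishes and the
  truncated \<open>n - 1\<close> does no harm.\<close>

lemma poly_below_gradient:
  fixes p :: "real ^ 'd \<Rightarrow> real"
  assumes "poly_below n p"
  shows "\<exists>G. (\<forall>x. GDERIV p x :> G x) \<and> (\<forall>j. poly_below (n - 1) (\<lambda>x. G x $ j)) \<and>
    poly_below (n - 1) (\<lambda>x. x \<bullet> G x - (real n - 1) * p x)"
  using assms
proof (induction rule: poly_below.induct)
  case (zero n)
  show ?case by (rule exI[of _ "\<lambda>x. 0"]) (auto simp: GDERIV_const intro: poly_below.zero)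
next
  case (const n c)
  have "poly_below n (\<lambda>x. - (real n * c))"
    by (cases n) (auto intro: poly_below.zero poly_below.const)
  then show ?case by (intro exI[of _ "\<lambda>x. 0"]) (auto simp: GDERIV_const intro: poly_below.zero)
next
  case (coord n p i)
  then obtain G where G: "\<And>x. GDERIV p x :> G x" "\<And>j. poly_below (n - 1) (\<lambda>x. G x $ j)"
    "poly_below (n - 1) (\<lambda>x. x \<bullet> G x - (real n - 1) * p x)" by auto
  show ?case
  proof (cases n)
    case 0
    then have "p x = 0" for x using coord poly_below_0D by auto
    then show ?thesis by (intro exI[of _ "\<lambda>x. 0"]) (auto simp: GDERIV_const intro: poly_below.zero)
  next
    case (Suc m)
    define G' where "G' x = p x *\<^sub>R axis i 1 + x $ i *\<^sub>R G x" for x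
    have "GDERIV (\<lambda>x. x $ i) x :> axis i (1::real)" for x :: "real^'d"
      unfolding gderiv_def
      by (rule has_derivative_eq_rhs[OF bounded_linear_imp_has_derivative[OF bounded_linear_vec_nth]])
        (simp add: inner_axis' inner_axis fun_eq_iff)
    from GDERIV_mult[OF this G(1)] have 1: "GDERIV (\<lambda>x. x $ i * p x) x :> G' x" for x
      by (simp add: G'_def add.commute)
    have 2: "poly_below n (\<lambda>x. G' x $ j)" for j
    proof -
      have "poly_below n (\<lambda>x. (axis i 1 $ j) * p x)" using coord by (intro poly_below_cmult)
      moreover have "poly_below n (\<lambda>x. x $ i * G x $ j)" using G(2)[of j] Suc poly_below.coord[of m] by simp
      ultimately have "poly_below n (\<lambda>x. (axis i 1 $ j) * p x + x $ i * G x $ j)" by (rule poly_below.add)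
      then show ?thesis by (simp add: G'_def mult.commute)
    qed
    \<comment> \<open>Multiplication by \<open>x $ i\<close> raises the degree and the Euler factor
      together, so the remainder is just multiplied by \<open>x $ i\<close>.\<close>
    have "poly_below n (\<lambda>x. x $ i * (x \<bullet> G x - (real n - 1) * p x))"
      using G(3) Suc poly_below.coord[of m] by simp
    moreover have "x $ i * (x \<bullet> G x - (real n - 1) * p x) = x \<bullet> G' x - (real (Suc n) - 1) * (x $ i * p x)" for x
      by (simp add: G'_def inner_add_right inner_axis algebra_simps)
    ultimately show ?thesis using 1 2 by (intro exI[of _ G']) auto
  qed
next
  case (add n p q)
  from add.IH(1) obtain G where G: "\<forall>x. GDERIV p x :> G x" "\<forall>j. poly_below (n - 1) (\<lambda>x. G x $ j)"
    "poly_below (n - 1) (\<lambda>x. x \<bullet> G x - (real n - 1) * p x)" by blast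
  from add.IH(2) obtain H where H: "\<forall>x. GDERIV q x :> H x" "\<forall>j. poly_below (n - 1) (\<lambda>x. H x $ j)"
    "poly_below (n - 1) (\<lambda>x. x \<bullet> H x - (real n - 1) * q x)" by blast
  have "poly_below (n - 1) (\<lambda>x. x \<bullet> (G x + H x) - (real n - 1) * (p x + q x))"
    using poly_below.add[OF G(3) H(3)] by (simp add: inner_add_right algebra_simps)
  moreover have "\<forall>x. GDERIV (\<lambda>x. p x + q x) x :> G x + H x"
    using G(1) H(1) by (blast intro: GDERIV_add)
  moreover have "poly_below (n - 1) (\<lambda>x. (G x + H x) $ j)" for j
    using poly_below.add[of "n - 1" "\<lambda>x. G x $ j" "\<lambda>x. H x $ j"] G(2) H(2) by simp
  ultimately show ?case by (intro exI[of _ "\<lambda>x. G x + H x"] conjI allI) auto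
qed

lemma GDERIV_unique: "GDERIV f x :> a \<Longrightarrow> GDERIV f x :> b \<Longrightarrow> a = b"
  unfolding gderiv_def
  by (metis has_derivative_unique inner_eq_zero_iff inner_diff_right right_minus_eq fun_cong)

lemma poly_below_derivatives:
  assumes "poly_below n p" "\<And>x. GDERIV p x :> G x"
  shows poly_below_gradient_nth: "poly_below (n - 1) (\<lambda>x. G x $ j)"
    and poly_below_euler: "poly_below (n - 1) (\<lambda>x. x \<bullet> G x - (real n - 1) * p x)"
proof -
  obtain H where H: "\<forall>x. GDERIV p x :> H x" "\<forall>j. poly_below (n - 1) (\<lambda>x. H x $ j)"
    "poly_below (n - 1) (\<lambda>x. x \<bullet> H x - (real n - 1) * p x)"
    using poly_below_gradient[OF assms(1)] by blast
  then have "H = G" using assms(2) GDERIV_unique by blast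
  then show "poly_below (n - 1) (\<lambda>x. G x $ j)"
    "poly_below (n - 1) (\<lambda>x. x \<bullet> G x - (real n - 1) * p x)" using H by auto
qed

section \<open>Reflections and their action on polynomials\<close>

lemma linear_reflection: "linear (reflection v)"
  by (rule linearI) (simp_all add: reflection_def inner_add_left algebra_simps add_divide_distrib)

lemma inner_reflection_self: "reflection v x \<bullet> v = - (x \<bullet> v)"
  by (cases "v = 0") (simp_all add: reflection_def inner_diff_left dot_square_norm)

lemma reflection_reflection [simp]: "reflection v (reflection v x) = x"
  unfolding reflection_def[of v "reflection v x"] inner_reflection_self by (simp add: reflection_def)

lemma inner_reflection: "reflection v x \<bullet> reflection v y = x \<bullet> y"
proof (cases "v = 0")
  case False
  then show ?thesis
    by (simp add: reflection_def inner_diff_left inner_diff_right power2_norm_eq_inner inner_commute algebra_simps)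
qed (simp add: reflection_def)

lemma inner_reflection_left: "reflection v x \<bullet> y = x \<bullet> reflection v y"
  using inner_reflection[of v x "reflection v y"] by simp

lemma norm_reflection [simp]: "norm (reflection v x) = norm x"
  by (simp add: norm_eq inner_reflection)

text \<open>Self-adjointness makes a coordinate of the reflected point a linear form in
  \<open>x\<close>, the shape that \<open>poly_below_mult_linear\<close> accepts.\<close>

lemma reflection_nth: "reflection v x $ i = x \<bullet> reflection v (axis i 1)"
  by (metis inner_axis inner_reflection_left mult.right_neutral inner_real_def)

lemma poly_below_reflection: "poly_below n p \<Longrightarrow> poly_below n (\<lambda>x. p (reflection v x))"
proof (induction rule: poly_below.induct)
  case (coord n p i)
  then show ?case unfolding reflection_nth by (intro poly_below_mult_linear)
qed (auto intro: poly_below.intros)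

text \<open>The quotient is the difference part of a Dunkl operator. Divisibility rests on
  \<open>x - reflection v x\<close> being \<open>x \<bullet> v\<close> times a fixed vector.\<close>

lemma poly_below_divided_difference:
  "poly_below n p \<Longrightarrow>
    \<exists>q. poly_below (n - 1) q \<and> (\<forall>x. p x - p (reflection v x) = (x \<bullet> v) * q x)"
proof (induction rule: poly_below.induct)
  case (coord n p i)
  show ?case
  proof (cases n)
    case 0
    then have "p x = 0" for x using coord poly_below_0D by auto
    then show ?thesis by (auto intro: poly_below.zero)
  next
    case (Suc m)
    obtain q where q: "poly_below m q" "\<And>x. p x - p (reflection v x) = (x \<bullet> v) * q x"
      using coord Suc by auto
    \<comment> \<open>Twisted Leibniz rule: the first summand comes from the difference of the
      coordinates, the second from the difference of the values of \<open>p\<close>, with the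
      coordinate taken at the reflected point.\<close>
    define q' where "q' x = (2 * v $ i / (norm v)\<^sup>2) * p x + reflection v x $ i * q x" for x
    have "x $ i * p x - reflection v x $ i * p (reflection v x) = (x \<bullet> v) * q' x" for x
    proof -
      have "x $ i - reflection v x $ i = (x \<bullet> v) * (2 * v $ i / (norm v)\<^sup>2)"
        by (simp add: reflection_def)
      then show ?thesis using q(2)[of x] unfolding q'_def by algebra
    qed
    moreover have "poly_below n q'"
      unfolding q'_def reflection_nth
      by (intro poly_below.add poly_below_cmult) (auto simp: Suc coord[unfolded Suc] intro: poly_below_mult_linear q)
    ultimately show ?thesis by auto
  qed
next
  case (add n p q)
  then obtain p' q' where *: "poly_below (n - 1) p'" "\<And>x. p x - p (reflection v x) = (x \<bullet> v) * p' x"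
    "poly_below (n - 1) q'" "\<And>x. q x - q (reflection v x) = (x \<bullet> v) * q' x" by blast
  have "p x + q x - (p (reflection v x) + q (reflection v x)) = (x \<bullet> v) * (p' x + q' x)" for x
    using *(2,4)[of x] by (simp add: distrib_left)
  then show ?case using poly_below.add[OF *(1,3)] by blast
qed (auto intro: poly_below.zero)

text \<open>The normal derivative of a reflection invariant function is odd, so divisible by the linear form.\<close>

lemma poly_below_normal_derivative:
  assumes p: "poly_below n p" "\<And>x. GDERIV p x :> G x" and inv: "\<And>x. p (reflection v x) = p x"
  shows "\<exists>q. poly_below (n - 2) q \<and> (\<forall>x. G x \<bullet> v = (x \<bullet> v) * q x)"
proof -
  have odd: "G (reflection v x) \<bullet> v = - (G x \<bullet> v)" for x
  proof -
    have "((\<lambda>y. p (reflection v y)) has_derivative (\<lambda>h. reflection v h \<bullet> G (reflection v x))) (at x)"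
      using has_derivative_compose[OF linear_imp_has_derivative[OF linear_reflection]
          p(2)[of "reflection v x", unfolded gderiv_def]] .
    \<comment> \<open>By invariance the chain rule computes the gradient of \<open>p\<close> itself;
      self-adjointness moves the reflection from \<open>h\<close> to the gradient.\<close>
    then have "GDERIV p x :> reflection v (G (reflection v x))"
      by (simp add: gderiv_def inv inner_reflection_left)
    then have "G x = reflection v (G (reflection v x))" using p(2) GDERIV_unique by blast
    then show ?thesis by (metis inner_reflection_self minus_minus)
  qed
  have "poly_below (n - 1) (\<lambda>x. G x \<bullet> v)"
  proof -
    have "poly_below (n - 1) (\<lambda>x. \<Sum>i\<in>UNIV. v $ i * G x $ i)"
      by (intro poly_below_sum poly_below_cmult poly_below_gradient_nth[OF p])
    then show ?thesis by (simp add: inner_vec_def mult.commute)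
  qed
  from poly_below_divided_difference[OF this, of v] obtain q where q: "poly_below (n - 1 - 1) q"
    "\<And>x. G x \<bullet> v - G (reflection v x) \<bullet> v = (x \<bullet> v) * q x" by blast
  have n: "n - 1 - 1 = n - 2" by simp
  \<comment> \<open>By oddness the divided difference of the normal derivative is twice the quotient
    wanted.\<close>
  have "G x \<bullet> v = (x \<bullet> v) * ((1/2) * q x)" for x
    using q(2)[of x] odd[of x] by simp
  then show ?thesis using poly_below_cmult[OF q(1), of "1/2", unfolded n] by blast
qed

section \<open>Weak gradients and integration by parts\<close>

lemma lborel_integral_translation:
  fixes f :: "'a::euclidean_space \<Rightarrow> real"
  assumes "f \<in> borel_measurable borel"
  shows "(LINT x|lborel. f (x + c)) = (LINT x|lborel. f x)"
proof -
  have "(LINT x|lborel. f x) = (LINT x|distr lborel borel ((+) c). f x)"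
    by (simp add: lborel_distr_plus)
  also have "\<dots> = (LINT x|lborel. f (c + x))"
    by (rule integral_distr) (use assms in auto)
  finally show ?thesis by (simp add: add.commute)
qed

lemma GDERIV_zero_outside:
  fixes f :: "'a::real_inner \<Rightarrow> real"
  assumes "GDERIV f x :> D" "closed K" "\<And>y. y \<notin> K \<Longrightarrow> f y = 0" "x \<notin> K"
  shows "D = 0"
proof -
  have "(f has_derivative (\<lambda>_. 0)) (at x)"
    by (rule has_derivative_transform_within_open[of "\<lambda>_. 0" _ x UNIV "- K"])
       (use assms in \<open>auto simp: open_Compl\<close>)
  then have "GDERIV f x :> 0"
    by (simp add: gderiv_def)
  with assms(1) show ?thesis by (blast intro: GDERIV_unique)
qed

lemma GDERIV_directional:
  assumes "GDERIV f (x + t *\<^sub>R e) :> D"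
  shows "((\<lambda>s. f (x + s *\<^sub>R e)) has_real_derivative (e \<bullet> D)) (at t)"
proof -
  have "((\<lambda>s. x + s *\<^sub>R e) has_derivative (\<lambda>h. h *\<^sub>R e)) (at t)"
    by (auto intro!: derivative_eq_intros)
  from has_derivative_compose[OF this assms[unfolded gderiv_def]]
  show ?thesis by (simp add: has_field_derivative_def mult_commute_abs)
qed

text \<open>Difference quotients integrate to zero by translation invariance of Lebesgue measure,
  and dominated convergence carries this over to the derivative.\<close>

lemma integral_gradient_compact_support:
  fixes f :: "real ^ 'd \<Rightarrow> real"
  assumes f: "\<And>x. GDERIV f x :> f' x" and cont: "continuous_on UNIV f'"
    and K: "compact K" "\<And>x. x \<notin> K \<Longrightarrow> f x = 0"
  shows "(LINT x|lebesgue. f' x $ j) = 0"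
proof -
  define e :: "real ^ 'd" where "e = axis j 1"
  have ne: "norm e = 1" and ein: "e \<bullet> v = v $ j" for v
    by (simp_all add: e_def inner_axis')
  have f'0: "f' x = 0" if "x \<notin> K" for x
    using GDERIV_zero_outside[OF f compact_imp_closed[OF K(1)] K(2) that] .
  have contf: "continuous_on UNIV f"
    by (meson f gderiv_def has_derivative_continuous continuous_at_imp_continuous_on)
  have "bounded (f' ` K)"
    by (intro compact_imp_bounded compact_continuous_image continuous_on_subset[OF cont]) (auto simp: K)
  then obtain B where "B > 0" and "\<And>x. x \<in> K \<Longrightarrow> norm (f' x) \<le> B"
    unfolding bounded_pos by auto
  then have B: "norm (f' x) \<le> B" for x using f'0 by (cases "x \<in> K") auto
  obtain R where R: "\<And>x. x \<in> K \<Longrightarrow> norm x \<le> R"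
    using compact_imp_bounded[OF K(1)] unfolding bounded_iff by auto
  define h where "h n = inverse (real (Suc n))" for n
  have h: "0 < h n" "h n \<le> 1" for n by (auto simp: h_def inverse_le_1_iff)
  define D where "D n x = (f (x + h n *\<^sub>R e) - f x) / h n" for n x
  have Dint: "(LINT x|lborel. D n x) = 0" for n
  proof -
    have m: "f \<in> borel_measurable borel" using contf by (rule borel_measurable_continuous_onI)
    have i: "integrable lborel f"
    proof -
      have "integrable lborel (\<lambda>x. indicator K x *\<^sub>R f x)"
        by (rule borel_integrable_compact) (auto intro: K continuous_on_subset[OF contf])
      moreover have "(\<lambda>x. indicator K x *\<^sub>R f x) = f" using K(2) by (auto simp: fun_eq_iff indicator_def)
      ultimately show ?thesis by simp
    qed
    have "integrable (distr lborel borel ((+) (h n *\<^sub>R e))) f" using i by (simp add: lborel_distr_plus)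
    then have i2: "integrable lborel (\<lambda>x. f (x + h n *\<^sub>R e))"
      by (subst (asm) integrable_distr_eq) (auto simp: m add.commute)
    show ?thesis unfolding D_def using i i2 lborel_integral_translation[OF m, of "h n *\<^sub>R e"] by simp
  qed
  \<comment> \<open>The mean value theorem bounds each quotient by \<open>B\<close>; as the
    increments are at most 1, its support stays within distance 1 of \<open>K\<close>, whence the
    radius \<open>R + 1\<close>.\<close>
  have lim: "(\<lambda>n. LINT x|lborel. D n x) \<longlonglongrightarrow> (LINT x|lborel. f' x $ j)"
  proof (rule integral_dominated_convergence[where w = "\<lambda>x. B * indicator (cball 0 (R + 1)) x"])
    show "integrable lborel (\<lambda>x. B * indicator (cball 0 (R + 1)) x :: real)"
      using emeasure_lborel_cball_finite[of 0 "R + 1"]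
      by (intro integrable_mult_right integrable_real_indicator) (auto simp: top.not_eq_extremum)
    have "f \<in> borel_measurable borel" using contf by (rule borel_measurable_continuous_onI)
    then show "D n \<in> borel_measurable lborel" for n unfolding D_def by measurable
    have "(\<lambda>x. f' x $ j) \<in> borel_measurable borel"
      by (intro borel_measurable_continuous_onI continuous_intros cont)
    then show "(\<lambda>x. f' x $ j) \<in> borel_measurable lborel" by simp
    show "AE x in lborel. (\<lambda>n. D n x) \<longlonglongrightarrow> f' x $ j"
    proof (rule AE_I2)
      fix x
      have "((\<lambda>s. f (x + s *\<^sub>R e)) has_real_derivative (f' x $ j)) (at 0)"
        using GDERIV_directional[of f x 0 e "f' x"] f by (simp add: ein)
      then have "((\<lambda>s. (f (x + s *\<^sub>R e) - f x) / s) \<longlongrightarrow> f' x $ j) (at 0)"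
        by (simp add: DERIV_def)
      moreover have "filterlim h (at 0) sequentially"
        unfolding filterlim_at
      proof
        show "\<forall>\<^sub>F n in sequentially. h n \<in> UNIV \<and> h n \<noteq> 0"
          using h(1) by (intro always_eventually) (metis UNIV_I less_irrefl)
        show "h \<longlonglongrightarrow> 0" unfolding h_def by (rule LIMSEQ_inverse_real_of_nat)
      qed
      ultimately show "(\<lambda>n. D n x) \<longlonglongrightarrow> f' x $ j"
        unfolding D_def by (rule filterlim_compose)
    qed
    show "AE x in lborel. norm (D n x) \<le> B * indicator (cball 0 (R + 1)) x" for n
    proof (rule AE_I2)
      fix x
      obtain z where z: "f (x + h n *\<^sub>R e) - f x = (h n - 0) * (f' (x + z *\<^sub>R e) $ j)"
        using MVT2[of 0 "h n" "\<lambda>s. f (x + s *\<^sub>R e)" "\<lambda>s. f' (x + s *\<^sub>R e) $ j"]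
          GDERIV_directional[of f x _ e] f h(1)[of n] by (auto simp: ein)
      show "norm (D n x) \<le> B * indicator (cball 0 (R + 1)) x"
      proof (cases "x \<in> cball 0 (R + 1)")
        case True
        have "D n x = f' (x + z *\<^sub>R e) $ j" unfolding D_def z using h(1)[of n] by simp
        then show ?thesis using B[of "x + z *\<^sub>R e"] component_le_norm_cart[of "f' (x + z *\<^sub>R e)" j] True by simp
      next
        case False
        then have "norm x > R + 1" by simp
        moreover have "norm x \<le> norm (x + h n *\<^sub>R e) + norm (h n *\<^sub>R e)"
          using norm_triangle_ineq4[of "x + h n *\<^sub>R e" "h n *\<^sub>R e"] by simp
        ultimately have "x \<notin> K" "x + h n *\<^sub>R e \<notin> K" using R[of x] R[of "x + h n *\<^sub>R e"] h[of n] ne by auto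
        then show ?thesis using \<open>B > 0\<close> by (simp add: D_def K(2))
      qed
    qed
  qed
  have "(LINT x|lborel. f' x $ j) = 0"
    using lim unfolding Dint by (simp add: LIMSEQ_const_iff)
  moreover have "(\<lambda>x. f' x $ j) \<in> borel_measurable lborel"
    by (simp, intro borel_measurable_continuous_onI continuous_intros cont)
  ultimately show ?thesis by (subst integral_completion)
qed

text \<open>A C1 substitute for \<open>t powr a\<close> that vanishes for
  \<open>t \<le> \<epsilon>\<close>. As \<open>a\<close> may be negative or below 1, the power
  itself is not smooth enough for a test function. The square makes the truncation differentiable at
  \<open>\<epsilon>\<close>, and \<open>t powr (a - 2)\<close> restores the growth of
  \<open>t powr a\<close>.\<close>

definition cutoff :: "real \<Rightarrow> real \<Rightarrow> real \<Rightarrow> real" where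
  "cutoff \<epsilon> a t = (max 0 (t - \<epsilon>))\<^sup>2 * t powr (a - 2)"

definition cutoff_deriv :: "real \<Rightarrow> real \<Rightarrow> real \<Rightarrow> real" where
  "cutoff_deriv \<epsilon> a t = 2 * max 0 (t - \<epsilon>) * t powr (a - 2) + (max 0 (t - \<epsilon>))\<^sup>2 * ((a - 2) * t powr (a - 3))"

lemma DERIV_max_square: "((\<lambda>t::real. (max 0 (t - c))\<^sup>2) has_real_derivative 2 * max 0 (t - c)) (at t)"
proof -
  consider "t > c" | "t < c" | "t = c" by linarith
  then show ?thesis
  proof cases
    case 1
    have "eventually (\<lambda>s. (s - c)\<^sup>2 = (max 0 (s - c))\<^sup>2) (nhds t)"
      using eventually_nhds_in_open[of "{c<..}" t] 1 by (auto elim!: eventually_mono)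
    moreover have "((\<lambda>t. (t - c)\<^sup>2) has_real_derivative 2 * max 0 (t - c)) (at t)"
      using 1 by (auto intro!: derivative_eq_intros)
    ultimately show ?thesis by (subst (asm) DERIV_cong_ev) auto
  next
    case 2
    have "eventually (\<lambda>s. 0 = (max 0 (s - c))\<^sup>2) (nhds t)"
      using eventually_nhds_in_open[of "{..<c}" t] 2 by (auto elim!: eventually_mono)
    moreover have "((\<lambda>t. 0) has_real_derivative 2 * max 0 (t - c)) (at t)"
      using 2 by auto
    ultimately show ?thesis by (subst (asm) DERIV_cong_ev) auto
  next
    case 3
    have "((\<lambda>h. (max 0 h)\<^sup>2 / h) \<longlongrightarrow> 0) (at (0::real))"
    proof (rule Lim_null_comparison[where g = "\<lambda>h. \<bar>h\<bar>"])
      show "\<forall>\<^sub>F x in at 0. norm ((max 0 x)\<^sup>2 / x) \<le> \<bar>x :: real\<bar>"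
        by (intro always_eventually) (auto simp: max_def power2_eq_square)
      show "((\<lambda>h::real. \<bar>h\<bar>) \<longlongrightarrow> 0) (at 0)" by (auto intro!: tendsto_eq_intros)
    qed
    then show ?thesis using 3 by (simp add: DERIV_def)
  qed
qed

lemma cutoff_eq_0: "t \<le> \<epsilon> \<Longrightarrow> cutoff \<epsilon> a t = 0"
  by (simp add: cutoff_def)

lemma DERIV_cutoff:
  assumes "\<epsilon> > 0" shows "(cutoff \<epsilon> a has_real_derivative cutoff_deriv \<epsilon> a t) (at t)"
proof (cases "t > 0")
  case True
  then have "((\<lambda>t. t powr (a - 2)) has_real_derivative (a - 2) * t powr (a - 3)) (at t)"
    by (auto intro!: derivative_eq_intros)
  from DERIV_mult[OF DERIV_max_square[of \<epsilon>] this] show ?thesis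
    by (simp add: cutoff_def[abs_def] cutoff_deriv_def algebra_simps)
next
  case False
  have "eventually (\<lambda>s. 0 = cutoff \<epsilon> a s) (nhds t)"
    using eventually_nhds_in_open[of "{..<\<epsilon>}" t] False assms
    by (auto simp: cutoff_def elim!: eventually_mono)
  moreover have "((\<lambda>t. 0) has_real_derivative cutoff_deriv \<epsilon> a t) (at t)"
    using False assms by (auto simp: cutoff_deriv_def)
  ultimately show ?thesis by (subst (asm) DERIV_cong_ev) auto
qed

lemma continuous_cutoff_deriv:
  assumes "\<epsilon> > 0" shows "continuous_on UNIV (cutoff_deriv \<epsilon> a)"
proof -
  have "isCont (cutoff_deriv \<epsilon> a) t" for t
  proof (cases "t > 0")
    case True
    then show ?thesis unfolding cutoff_deriv_def by (intro continuous_intros) auto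
  next
    case False
    have "eventually (\<lambda>s. cutoff_deriv \<epsilon> a s = 0) (nhds t)"
      using eventually_nhds_in_open[of "{..<\<epsilon>}" t] False assms
      by (auto simp: cutoff_deriv_def elim!: eventually_mono)
    then show ?thesis by (subst isCont_cong) auto
  qed
  then show ?thesis by (simp add: continuous_on_eq_continuous_at)
qed

definition cutoff_ratio :: "real \<Rightarrow> real \<Rightarrow> real" where
  "cutoff_ratio \<epsilon> t = max 0 (t - \<epsilon>) / t"

lemma cutoff_ratio_bounds:
  assumes "\<epsilon> > 0" shows "0 \<le> cutoff_ratio \<epsilon> t" "cutoff_ratio \<epsilon> t \<le> 1"
  using assms by (cases "t \<le> \<epsilon>"; simp add: cutoff_ratio_def max_def field_simps)+

lemma cutoff_ratio_tendsto:
  assumes "t > 0" shows "((\<lambda>\<epsilon>. cutoff_ratio \<epsilon> t) \<longlongrightarrow> 1) (at_right 0)"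
proof -
  have "((\<lambda>\<epsilon>. max 0 (t - \<epsilon>) / t) \<longlongrightarrow> max 0 (t - 0) / t) (at_right 0)"
    by (intro tendsto_intros) (use assms in auto)
  then show ?thesis using assms by (simp add: cutoff_ratio_def)
qed

text \<open>This isolates \<open>t powr a\<close> from factors that are bounded uniformly in
  \<open>\<epsilon>\<close>. The term with \<open>1 - cutoff_ratio\<close> stems from
  differentiating the truncation; it tends to 0 for each fixed \<open>t > 0\<close>.\<close>

lemma cutoff_conv_ratio:
  assumes "\<epsilon> > 0"
  shows "cutoff \<epsilon> a t = t powr a * (cutoff_ratio \<epsilon> t)\<^sup>2"
    and "t * cutoff_deriv \<epsilon> a t =
      t powr a * (a * (cutoff_ratio \<epsilon> t)\<^sup>2 + 2 * cutoff_ratio \<epsilon> t * (1 - cutoff_ratio \<epsilon> t))"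
proof -
  have "cutoff \<epsilon> a t = t powr a * (cutoff_ratio \<epsilon> t)\<^sup>2 \<and> t * cutoff_deriv \<epsilon> a t =
      t powr a * (a * (cutoff_ratio \<epsilon> t)\<^sup>2 + 2 * cutoff_ratio \<epsilon> t * (1 - cutoff_ratio \<epsilon> t))"
  proof (cases "t > \<epsilon>")
    case True
    then have t: "t > 0" using assms by simp
    have p: "t powr (a - 2) = t powr a / t ^ 2" "t powr (a - 3) = t powr a / t ^ 3"
      using t by (simp_all add: powr_diff)
    define P where "P = t powr a"
    show ?thesis unfolding cutoff_def cutoff_deriv_def cutoff_ratio_def p P_def[symmetric]
      using True t by (simp add: max_def field_simps power2_eq_square power3_eq_cube)
  next
    case False
    then show ?thesis by (simp add: cutoff_def cutoff_deriv_def cutoff_ratio_def)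
  qed
  then show "cutoff \<epsilon> a t = t powr a * (cutoff_ratio \<epsilon> t)\<^sup>2" "t * cutoff_deriv \<epsilon> a t =
      t powr a * (a * (cutoff_ratio \<epsilon> t)\<^sup>2 + 2 * cutoff_ratio \<epsilon> t * (1 - cutoff_ratio \<epsilon> t))" by auto
qed

text \<open>Scalar version of \<open>has_weak_gradient_on\<close>. Both integrals run over the ball,
  where the weighted measure lives; for \<open>\<Omega>\<close> inside the ball this changes
  nothing, because the test functions vanish off \<open>K\<close>.\<close>

definition weak_gradient ::
    "(real ^ 'd) set \<Rightarrow> (real ^ 'd \<Rightarrow> real) \<Rightarrow> (real ^ 'd \<Rightarrow> real ^ 'd) \<Rightarrow> bool" where
  "weak_gradient \<Omega> u g \<longleftrightarrow>
     (\<forall>K. compact K \<and> K \<subseteq> \<Omega> \<longrightarrow> integrable (lebesgue_on K) u \<and> (\<forall>j. integrable (lebesgue_on K) (\<lambda>x. g x $ j))) \<and>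
     (\<forall>\<phi> \<phi>' K j. compact K \<and> K \<subseteq> \<Omega> \<and> (\<forall>x. x \<notin> K \<longrightarrow> \<phi> x = 0) \<and>
        (\<forall>x. GDERIV \<phi> x :> \<phi>' x) \<and> continuous_on UNIV \<phi>' \<longrightarrow>
        (LINT x|unit_ball. \<phi>' x $ j * u x) = - (LINT x|unit_ball. \<phi> x * g x $ j))"

lemma borel_measurable_unit_ball:
  fixes f :: "real ^ 'd \<Rightarrow> 'b::topological_space"
  shows "f \<in> borel_measurable borel \<Longrightarrow> f \<in> borel_measurable unit_ball"
  by (intro measurable_restrict_space1 measurable_completion) simp

lemma continuous_bounded_cball:
  fixes f :: "real ^ 'd \<Rightarrow> real"
  assumes "continuous_on UNIV f"
  obtains B where "B > 0" "\<And>x. x \<in> cball 0 1 \<Longrightarrow> \<bar>f x\<bar> \<le> B"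
proof -
  have "bounded (f ` cball 0 1)"
    by (intro compact_imp_bounded compact_continuous_image continuous_on_subset[OF assms]) auto
  then show ?thesis using that unfolding bounded_pos real_norm_def by blast
qed

lemma lebesgue_on_zero_outside:
  fixes h :: "'a::euclidean_space \<Rightarrow> 'b::{banach, second_countable_topology}"
  assumes "A \<in> sets lebesgue" "B \<in> sets lebesgue" "\<And>x. x \<in> A \<Longrightarrow> x \<notin> B \<Longrightarrow> h x = 0" "B \<subseteq> A"
  shows "integrable (lebesgue_on A) h \<longleftrightarrow> integrable (lebesgue_on B) h"
    and "(LINT x|lebesgue_on A. h x) = (LINT x|lebesgue_on B. h x)"
proof -
  have *: "(\<lambda>x. indicator A x *\<^sub>R h x) = (\<lambda>x. indicator B x *\<^sub>R h x)"
    using assms(3,4) by (auto simp: indicator_def fun_eq_iff)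
  show "integrable (lebesgue_on A) h \<longleftrightarrow> integrable (lebesgue_on B) h"
    "(LINT x|lebesgue_on A. h x) = (LINT x|lebesgue_on B. h x)"
    using assms(1,2) by (simp_all add: integrable_restrict_space integral_restrict_space *)
qed

lemma integrable_compact_support_scaleR:
  fixes \<psi> :: "'a::euclidean_space \<Rightarrow> real" and u :: "'a \<Rightarrow> 'b::{banach, second_countable_topology}"
  assumes K: "compact K" "K \<subseteq> S" and S: "S \<in> sets lebesgue" and u: "integrable (lebesgue_on K) u"
    and \<psi>: "continuous_on UNIV \<psi>" "\<And>x. x \<notin> K \<Longrightarrow> \<psi> x = 0"
  shows "integrable (lebesgue_on S) (\<lambda>x. \<psi> x *\<^sub>R u x)"
proof -
  have "bounded (\<psi> ` K)"
    by (intro compact_imp_bounded compact_continuous_image continuous_on_subset[OF \<psi>(1)]) (auto simp: K)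
  then obtain B where B: "\<And>x. x \<in> K \<Longrightarrow> \<bar>\<psi> x\<bar> \<le> B"
    unfolding bounded_iff by auto
  have Kl: "K \<in> sets lebesgue" using K(1) by (simp add: compact_imp_closed)
  have "integrable (lebesgue_on K) (\<lambda>x. \<psi> x *\<^sub>R u x)"
  proof (rule Bochner_Integration.integrable_bound[where f = "\<lambda>x. B *\<^sub>R u x"])
    show "integrable (lebesgue_on K) (\<lambda>x. B *\<^sub>R u x)" using u by simp
    have "\<psi> \<in> borel_measurable (lebesgue_on K)"
      by (intro continuous_imp_measurable_on_sets_lebesgue continuous_on_subset[OF \<psi>(1)]) (auto simp: Kl)
    then show "(\<lambda>x. \<psi> x *\<^sub>R u x) \<in> borel_measurable (lebesgue_on K)"
      using borel_measurable_integrable[OF u] by simp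
    show "AE x in lebesgue_on K. norm (\<psi> x *\<^sub>R u x) \<le> norm (B *\<^sub>R u x)"
    proof (rule AE_I2)
      fix x assume "x \<in> space (lebesgue_on K)"
      then have "\<bar>\<psi> x\<bar> \<le> \<bar>B\<bar>" using B[of x] by auto
      then show "norm (\<psi> x *\<^sub>R u x) \<le> norm (B *\<^sub>R u x)" by (simp add: mult_right_mono)
    qed
  qed
  then show ?thesis
    using lebesgue_on_zero_outside(1)[OF S Kl, of "\<lambda>x. \<psi> x *\<^sub>R u x"] K(2) \<psi>(2) by simp
qed

lemma integrable_compact_support_mult:
  fixes \<psi> u :: "'a::euclidean_space \<Rightarrow> real"
  assumes "compact K" "K \<subseteq> S" "S \<in> sets lebesgue" "integrable (lebesgue_on K) u"
    and "continuous_on UNIV \<psi>" "\<And>x. x \<notin> K \<Longrightarrow> \<psi> x = 0"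
  shows "integrable (lebesgue_on S) (\<lambda>x. \<psi> x * u x)"
  using integrable_compact_support_scaleR[OF assms] by simp

lemma integrable_continuous_compact_lebesgue:
  fixes f :: "'a::euclidean_space \<Rightarrow> real"
  assumes "compact K" "continuous_on K f"
  shows "integrable (lebesgue_on K) f"
proof -
  have "set_integrable lborel K f"
    using borel_integrable_compact[OF assms] by (simp add: set_integrable_def)
  then have "integrable lebesgue (\<lambda>x. indicator K x *\<^sub>R f x)"
    unfolding set_integrable_def by (subst integrable_completion) auto
  then show ?thesis
    using assms(1) by (subst integrable_restrict_space) (auto simp: compact_imp_closed)
qed

lemma GDERIV_continuous_on: "(\<And>x. GDERIV f x :> f' x) \<Longrightarrow> continuous_on A f"
  by (meson gderiv_def has_derivative_continuous continuous_at_imp_continuous_on)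

text \<open>The gradient of the compactly supported product of \<open>\<phi>\<close> and
  \<open>q\<close> integrates to zero; the product rule splits that integral into the two
  sides.\<close>

lemma weak_gradient_classical:
  fixes q :: "real ^ 'd \<Rightarrow> real"
  assumes q: "\<And>x. GDERIV q x :> G x" "continuous_on UNIV G" and \<Omega>: "\<Omega> \<subseteq> cball 0 1"
  shows "weak_gradient \<Omega> q G"
  unfolding weak_gradient_def
proof (intro conjI allI impI)
  have contq: "continuous_on A q" for A
    by (rule GDERIV_continuous_on[OF q(1)])
  fix K :: "(real ^ 'd) set" assume K: "compact K \<and> K \<subseteq> \<Omega>"
  then show "integrable (lebesgue_on K) q" "integrable (lebesgue_on K) (\<lambda>x. G x $ j)" for j
    by (auto intro!: integrable_continuous_compact_lebesgue contq continuous_intros continuous_on_subset[OF q(2)])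
next
  have contq: "continuous_on A q" for A
    by (rule GDERIV_continuous_on[OF q(1)])
  fix \<phi> \<phi>' K j
  assume A: "compact K \<and> K \<subseteq> \<Omega> \<and> (\<forall>x. x \<notin> K \<longrightarrow> \<phi> x = 0) \<and>
        (\<forall>x. GDERIV \<phi> x :> \<phi>' x) \<and> continuous_on UNIV \<phi>'"
  have K: "compact K" "K \<subseteq> cball 0 1" "closed K" and \<phi>: "\<And>x. x \<notin> K \<Longrightarrow> \<phi> x = 0"
    "\<And>x. GDERIV \<phi> x :> \<phi>' x" "continuous_on UNIV \<phi>'" using A \<Omega> compact_imp_closed by auto
  have \<phi>'0: "\<phi>' x = 0" if "x \<notin> K" for x
    using GDERIV_zero_outside[OF \<phi>(2) K(3) \<phi>(1) that] .
  have cont\<phi>: "continuous_on UNIV \<phi>"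
    by (rule GDERIV_continuous_on[OF \<phi>(2)])
  define F where "F x = \<phi> x *\<^sub>R G x + q x *\<^sub>R \<phi>' x" for x
  have "(LINT x|lebesgue. F x $ j) = 0"
  proof (rule integral_gradient_compact_support[OF _ _ K(1)])
    show "GDERIV (\<lambda>x. \<phi> x * q x) x :> F x" for x
      unfolding F_def using GDERIV_mult[OF \<phi>(2) q(1)] by simp
    show "continuous_on UNIV F" unfolding F_def by (intro continuous_intros cont\<phi> contq \<phi>(3) q(2))
    show "\<phi> x * q x = 0" if "x \<notin> K" for x using \<phi>(1) that by simp
  qed
  moreover have "(LINT x|lebesgue. F x $ j) = (LINT x|unit_ball. F x $ j)"
  proof -
    have "F x $ j = 0" if "x \<notin> cball 0 1" for x
    proof -
      have "x \<notin> K" using K(2) that by blast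
      then show ?thesis by (simp add: F_def \<phi>(1) \<phi>'0)
    qed
    then show ?thesis
      using lebesgue_on_zero_outside(2)[of UNIV "cball 0 1" "\<lambda>x. F x $ j"] by (simp add: lebesgue_on_UNIV_eq)
  qed
  moreover have "(LINT x|unit_ball. F x $ j) = (LINT x|unit_ball. \<phi>' x $ j * q x) + (LINT x|unit_ball. \<phi> x * G x $ j)"
  proof -
    have "integrable unit_ball (\<lambda>x. \<phi>' x $ j * q x)"
      by (rule integrable_compact_support_mult[OF K(1,2)])
         (auto intro!: integrable_continuous_compact_lebesgue contq continuous_intros \<phi>(3) K simp: \<phi>'0)
    moreover have "integrable unit_ball (\<lambda>x. \<phi> x * G x $ j)"
      by (rule integrable_compact_support_mult[OF K(1,2)])
         (auto intro!: integrable_continuous_compact_lebesgue continuous_on_subset[OF q(2)] continuous_intros cont\<phi> K simp: \<phi>)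
    ultimately show ?thesis by (simp add: F_def algebra_simps)
  qed
  ultimately show "(LINT x|unit_ball. \<phi>' x $ j * q x) = - (LINT x|unit_ball. \<phi> x * G x $ j)" by simp
qed

lemma GDERIV_prod_compose:
  assumes "\<And>i. i \<in> I \<Longrightarrow> GDERIV (t i) x :> dt i" "\<And>i. i \<in> I \<Longrightarrow> (c i has_real_derivative c' i) (at (t i x))"
  shows "GDERIV (\<lambda>x. \<Prod>i\<in>I. c i (t i x)) x :> (\<Sum>i\<in>I. (c' i * (\<Prod>j\<in>I - {i}. c j (t j x))) *\<^sub>R dt i)"
proof -
  have "((\<lambda>x. c i (t i x)) has_derivative (\<lambda>h. h \<bullet> c' i *\<^sub>R dt i)) (at x)" if "i \<in> I" for i
    using GDERIV_DERIV_compose[OF assms(1)[OF that] assms(2)[OF that]] unfolding gderiv_def .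
  from has_derivative_prod[of I "\<lambda>i x. c i (t i x)", OF this]
  show ?thesis by (simp add: gderiv_def inner_sum_right mult.commute mult.left_commute mult.assoc)
qed

text \<open>Testing against the field \<open>Z\<close> multiplied by the weight \<open>\<Prod>i. t\<^sub>i powr a\<^sub>i\<close>, where both \<open>Z\<close>
  and the cutoff are adapted to the zero sets of the \<open>t\<^sub>i\<close>: the derivative of \<open>t\<^sub>i\<close> along \<open>Z\<close>
  is divisible by \<open>t\<^sub>i\<close>.\<close>

locale adapted_field =
  fixes I :: "'i set" and t :: "'i \<Rightarrow> real ^ 'd \<Rightarrow> real" and dt :: "'i \<Rightarrow> real ^ 'd \<Rightarrow> real ^ 'd"
    and a :: "'i \<Rightarrow> real" and s :: "'i \<Rightarrow> real ^ 'd \<Rightarrow> real"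
    and Z :: "real ^ 'd \<Rightarrow> real ^ 'd" and dZ :: "'d \<Rightarrow> real ^ 'd \<Rightarrow> real ^ 'd"
  assumes fin: "finite I"
    and t: "\<And>i x. i \<in> I \<Longrightarrow> GDERIV (t i) x :> dt i x" "\<And>i. i \<in> I \<Longrightarrow> continuous_on UNIV (dt i)"
    and Z: "\<And>j x. GDERIV (\<lambda>x. Z x $ j) x :> dZ j x" "\<And>j. continuous_on UNIV (dZ j)"
    and s: "\<And>i x. i \<in> I \<Longrightarrow> Z x \<bullet> dt i x = t i x * s i x" "\<And>i. i \<in> I \<Longrightarrow> continuous_on UNIV (s i)"
    and ball: "{x. \<forall>i\<in>I. 0 < t i x} \<subseteq> cball 0 1"
begin

definition weight where "weight x = (\<Prod>i\<in>I. t i x powr a i)"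

definition divergence where "divergence x = (\<Sum>j\<in>UNIV. dZ j x $ j)"

definition cut where "cut \<epsilon> x = (\<Prod>i\<in>I. (cutoff_ratio \<epsilon> (t i x))\<^sup>2)"

text \<open>\<open>weight * cut_div \<epsilon>\<close> is the divergence of \<open>Z\<close>
  multiplied by \<open>weight * cut \<epsilon>\<close>. Differentiating a power of
  \<open>t i\<close> would leave a factor \<open>1 / t i\<close>, but the derivative of
  \<open>t i\<close> along \<open>Z\<close> is \<open>t i * s i\<close>, so only \<open>s i\<close>
  remains.\<close>

definition cut_div where
  "cut_div \<epsilon> x = divergence x * cut \<epsilon> x + (\<Sum>i\<in>I. s i x *
     (a i * (cutoff_ratio \<epsilon> (t i x))\<^sup>2 + 2 * cutoff_ratio \<epsilon> (t i x) * (1 - cutoff_ratio \<epsilon> (t i x))) *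
     (\<Prod>j\<in>I - {i}. (cutoff_ratio \<epsilon> (t j x))\<^sup>2))"

lemma continuous_t: "i \<in> I \<Longrightarrow> continuous_on A (t i)"
  by (rule GDERIV_continuous_on[OF t(1)])

lemma continuous_Z: "continuous_on A (\<lambda>x. Z x $ j)"
  by (rule GDERIV_continuous_on[OF Z(1)])

lemma weak_gradient_cutoff:
  assumes \<epsilon>: "\<epsilon> > 0" and w: "weak_gradient {x. \<forall>i\<in>I. 0 < t i x} u g"
  shows "(LINT x|unit_ball. (weight x * cut_div \<epsilon> x) * u x) = - (LINT x|unit_ball. (weight x * cut \<epsilon> x) * (Z x \<bullet> g x))"
proof -
  \<comment> \<open>Intersecting with the ball makes \<open>K\<close> compact; by the locale
    assumption \<open>ball\<close> it still contains the support of the cutoff.\<close>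
  define K where "K = cball 0 1 \<inter> (\<Inter>i\<in>I. {x. \<epsilon> \<le> t i x})"
  have clos: "closed (\<Inter>i\<in>I. {x. \<epsilon> \<le> t i x})"
    by (intro closed_INT ballI closed_Collect_le continuous_t continuous_intros)
  then have K: "compact K" "K \<subseteq> {x. \<forall>i\<in>I. 0 < t i x}" "K \<subseteq> cball 0 1"
    using \<epsilon> by (auto simp: K_def intro!: compact_Int_closed dest!: bspec)
  define \<Phi> where "\<Phi> x = (\<Prod>i\<in>I. cutoff \<epsilon> (a i) (t i x))" for x
  define d\<Phi> where "d\<Phi> x = (\<Sum>i\<in>I. (cutoff_deriv \<epsilon> (a i) (t i x) *
      (\<Prod>j\<in>I - {i}. cutoff \<epsilon> (a j) (t j x))) *\<^sub>R dt i x)" for x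
  have \<Phi>: "GDERIV \<Phi> x :> d\<Phi> x" for x
    unfolding \<Phi>_def[abs_def] d\<Phi>_def by (intro GDERIV_prod_compose t DERIV_cutoff \<epsilon>)
  have cont_cut: "continuous_on UNIV (cutoff \<epsilon> b)" for b
    using DERIV_cutoff[OF \<epsilon>] by (meson DERIV_isCont continuous_at_imp_continuous_on)
  have cont_cutt: "continuous_on UNIV (\<lambda>x. cutoff \<epsilon> (a i) (t i x))" if "i \<in> I" for i
    by (rule continuous_on_compose2[OF cont_cut continuous_t]) (auto simp: that)
  have cont_cutt': "continuous_on UNIV (\<lambda>x. cutoff_deriv \<epsilon> (a i) (t i x))" if "i \<in> I" for i
    by (rule continuous_on_compose2[OF continuous_cutoff_deriv[OF \<epsilon>] continuous_t]) (auto simp: that)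
  have cont\<Phi>: "continuous_on UNIV \<Phi>"
    unfolding \<Phi>_def by (intro continuous_intros cont_cutt)
  have contd\<Phi>: "continuous_on UNIV d\<Phi>"
    unfolding d\<Phi>_def by (intro continuous_intros cont_cutt cont_cutt' t) auto
  have \<Phi>0: "\<Phi> x = 0" if "x \<notin> K" for x
  proof -
    have "\<exists>i\<in>I. t i x < \<epsilon>" using that ball \<epsilon> unfolding K_def by force
    then show ?thesis unfolding \<Phi>_def using fin by (auto intro!: prod_zero cutoff_eq_0 less_imp_le)
  qed
  have d\<Phi>0: "d\<Phi> x = 0" if "x \<notin> K" for x
    using GDERIV_zero_outside[OF \<Phi> compact_imp_closed[OF K(1)] \<Phi>0 that] .
  have wu: "integrable (lebesgue_on K) u" and wg: "\<And>j. integrable (lebesgue_on K) (\<lambda>x. g x $ j)"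
    using w K(1,2) unfolding weak_gradient_def by blast+
  \<comment> \<open>Weak gradients are tested one partial derivative at a time, so the field is
    split into the test functions \<open>Z x $ j * \<Phi> x\<close>, whose \<open>j\<close>-th
    derivatives add up to its divergence.\<close>
  define \<phi>' where "\<phi>' j x = Z x $ j *\<^sub>R d\<Phi> x + \<Phi> x *\<^sub>R dZ j x" for j x
  have eq: "(LINT x|unit_ball. \<phi>' j x $ j * u x) = - (LINT x|unit_ball. (Z x $ j * \<Phi> x) * g x $ j)" for j
  proof -
    have "GDERIV (\<lambda>x. Z x $ j * \<Phi> x) x :> \<phi>' j x" for x
      unfolding \<phi>'_def by (rule GDERIV_mult[OF Z(1) \<Phi>])
    moreover have "continuous_on UNIV (\<phi>' j)"
      unfolding \<phi>'_def by (intro continuous_intros continuous_Z contd\<Phi> cont\<Phi> Z(2))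
    ultimately show ?thesis
      using w K \<Phi>0 unfolding weak_gradient_def
      by (elim conjE allE[of _ "\<lambda>x. Z x $ j * \<Phi> x"] allE[of _ "\<phi>' j"] allE[of _ K] allE[of _ j]) auto
  qed
  have int1: "integrable unit_ball (\<lambda>x. \<phi>' j x $ j * u x)" for j
    by (rule integrable_compact_support_mult[OF K(1,3) _ wu])
       (auto simp: \<phi>'_def \<Phi>0 d\<Phi>0 intro!: continuous_intros continuous_Z contd\<Phi> cont\<Phi> Z(2))
  have int2: "integrable unit_ball (\<lambda>x. (Z x $ j * \<Phi> x) * g x $ j)" for j
    by (rule integrable_compact_support_mult[OF K(1,3) _ wg])
       (auto simp: \<Phi>0 intro!: continuous_intros continuous_Z cont\<Phi>)
  have \<Phi>w: "\<Phi> x = weight x * cut \<epsilon> x" for x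
    by (simp add: \<Phi>_def weight_def cut_def cutoff_conv_ratio(1)[OF \<epsilon>] prod.distrib)
  have Zd\<Phi>: "Z x \<bullet> d\<Phi> x = (\<Sum>i\<in>I. weight x * (s i x *
     (a i * (cutoff_ratio \<epsilon> (t i x))\<^sup>2 + 2 * cutoff_ratio \<epsilon> (t i x) * (1 - cutoff_ratio \<epsilon> (t i x))) *
     (\<Prod>j\<in>I - {i}. (cutoff_ratio \<epsilon> (t j x))\<^sup>2)))" for x
    unfolding d\<Phi>_def inner_sum_right
  proof (rule sum.cong[OF refl])
    fix i assume i: "i \<in> I"
    let ?\<rho> = "\<lambda>i. cutoff_ratio \<epsilon> (t i x)"
    have w: "weight x = t i x powr a i * (\<Prod>j\<in>I - {i}. t j x powr a j)"
      unfolding weight_def using fin i by (rule prod.remove)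
    have "Z x \<bullet> (cutoff_deriv \<epsilon> (a i) (t i x) * (\<Prod>j\<in>I - {i}. cutoff \<epsilon> (a j) (t j x))) *\<^sub>R dt i x
       = (t i x * cutoff_deriv \<epsilon> (a i) (t i x)) * s i x * (\<Prod>j\<in>I - {i}. cutoff \<epsilon> (a j) (t j x))"
      using s(1)[OF i, of x] by simp
    also have "\<dots> = t i x powr a i * (a i * (?\<rho> i)\<^sup>2 + 2 * ?\<rho> i * (1 - ?\<rho> i)) * s i x *
        ((\<Prod>j\<in>I - {i}. t j x powr a j) * (\<Prod>j\<in>I - {i}. (?\<rho> j)\<^sup>2))"
      unfolding cutoff_conv_ratio(2)[OF \<epsilon>] unfolding cutoff_conv_ratio(1)[OF \<epsilon>] prod.distrib ..
    finally show "Z x \<bullet> (cutoff_deriv \<epsilon> (a i) (t i x) * (\<Prod>j\<in>I - {i}. cutoff \<epsilon> (a j) (t j x))) *\<^sub>R dt i x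
       = weight x * (s i x * (a i * (?\<rho> i)\<^sup>2 + 2 * ?\<rho> i * (1 - ?\<rho> i)) * (\<Prod>j\<in>I - {i}. (?\<rho> j)\<^sup>2))"
      unfolding w by (simp only: ac_simps)
  qed
  have "(\<Sum>j\<in>UNIV. \<phi>' j x $ j) = weight x * cut_div \<epsilon> x" for x
  proof -
    have "(\<Sum>j\<in>UNIV. \<phi>' j x $ j) = Z x \<bullet> d\<Phi> x + \<Phi> x * divergence x"
      by (simp add: \<phi>'_def sum.distrib inner_vec_def divergence_def sum_distrib_left)
    then show ?thesis unfolding Zd\<Phi> \<Phi>w cut_div_def
      by (simp add: sum_distrib_left distrib_left mult.commute mult.left_commute)
  qed
  then have "(LINT x|unit_ball. (weight x * cut_div \<epsilon> x) * u x) = (LINT x|unit_ball. (\<Sum>j\<in>UNIV. \<phi>' j x $ j * u x))"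
    by (simp flip: sum_distrib_right)
  also have "\<dots> = (\<Sum>j\<in>UNIV. LINT x|unit_ball. \<phi>' j x $ j * u x)"
    by (rule Bochner_Integration.integral_sum) (rule int1)
  also have "\<dots> = - (\<Sum>j\<in>UNIV. LINT x|unit_ball. (Z x $ j * \<Phi> x) * g x $ j)"
    by (simp add: eq sum_negf)
  also have "(\<Sum>j\<in>UNIV. LINT x|unit_ball. (Z x $ j * \<Phi> x) * g x $ j) = (LINT x|unit_ball. (\<Sum>j\<in>UNIV. (Z x $ j * \<Phi> x) * g x $ j))"
    by (rule Bochner_Integration.integral_sum[symmetric]) (rule int2)
  also have "(\<lambda>x. \<Sum>j\<in>UNIV. (Z x $ j * \<Phi> x) * g x $ j) = (\<lambda>x. (weight x * cut \<epsilon> x) * (Z x \<bullet> g x))"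
    by (simp add: inner_vec_def \<Phi>w sum_distrib_left mult.commute mult.left_commute mult.assoc)
  finally show ?thesis .
qed

lemma cut_tendsto:
  assumes "\<And>i. i \<in> I \<Longrightarrow> 0 < t i x" "filterlim e (at_right 0) sequentially"
  shows "(\<lambda>n. cut (e n) x) \<longlonglongrightarrow> 1" "(\<lambda>n. cut_div (e n) x) \<longlonglongrightarrow> divergence x + (\<Sum>i\<in>I. a i * s i x)"
proof -
  have r: "(\<lambda>n. cutoff_ratio (e n) (t i x)) \<longlonglongrightarrow> 1" if "i \<in> I" for i
    by (rule filterlim_compose[OF cutoff_ratio_tendsto assms(2)]) (use assms that in auto)
  have "(\<lambda>n. cut (e n) x) \<longlonglongrightarrow> (\<Prod>i\<in>I. 1\<^sup>2)"
    unfolding cut_def by (intro tendsto_intros r)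
  then show c: "(\<lambda>n. cut (e n) x) \<longlonglongrightarrow> 1" by simp
  have "(\<lambda>n. cut_div (e n) x) \<longlonglongrightarrow> divergence x * 1 + (\<Sum>i\<in>I. s i x * (a i * 1\<^sup>2 + 2 * 1 * (1 - 1)) * (\<Prod>j\<in>I - {i}. 1\<^sup>2))"
    unfolding cut_div_def by (intro tendsto_intros r c) auto
  then show "(\<lambda>n. cut_div (e n) x) \<longlonglongrightarrow> divergence x + (\<Sum>i\<in>I. a i * s i x)"
    by (simp add: mult.commute)
qed

lemma cut_bounds: "\<epsilon> > 0 \<Longrightarrow> 0 \<le> cut \<epsilon> x" "\<epsilon> > 0 \<Longrightarrow> cut \<epsilon> x \<le> 1"
  unfolding cut_def using cutoff_ratio_bounds
  by (auto intro!: prod_nonneg prod_le_1 power_le_one)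

lemma continuous_divergence: "continuous_on A divergence"
  unfolding divergence_def by (intro continuous_intros continuous_on_subset[OF Z(2)]) auto

text \<open>Uniformity in \<open>\<epsilon>\<close> is what dominated convergence needs. The cutoff
  ratio has slope of order \<open>1 / \<epsilon>\<close> near a wall, but it enters only after
  multiplication by \<open>t i\<close>.\<close>

lemma cut_div_bounded: "\<exists>B. \<forall>\<epsilon>>0. \<forall>x\<in>cball 0 1. \<bar>cut_div \<epsilon> x\<bar> \<le> B"
proof -
  have bd: "\<exists>B. \<forall>x\<in>cball 0 1. \<bar>f x\<bar> \<le> B" if "continuous_on UNIV f" for f :: "real ^ 'd \<Rightarrow> real"
    using continuous_bounded_cball[OF that] by metis
  obtain D where D: "\<And>x. x \<in> cball 0 1 \<Longrightarrow> \<bar>divergence x\<bar> \<le> D" using bd[OF continuous_divergence] by blast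
  have "\<forall>i. \<exists>B. i \<in> I \<longrightarrow> (\<forall>x\<in>cball 0 1. \<bar>s i x\<bar> \<le> B)" using bd[OF s(2)] by blast
  then obtain S where S: "\<And>i x. i \<in> I \<Longrightarrow> x \<in> cball 0 1 \<Longrightarrow> \<bar>s i x\<bar> \<le> S i" by metis
  have "\<bar>cut_div \<epsilon> x\<bar> \<le> D + (\<Sum>i\<in>I. S i * (\<bar>a i\<bar> + 2))" if e: "\<epsilon> > 0" and x: "x \<in> cball 0 1" for \<epsilon> x
  proof -
    have "\<bar>divergence x * cut \<epsilon> x\<bar> \<le> D * 1"
      unfolding abs_mult by (rule mult_mono) (use D[OF x] cut_bounds[OF e, of x] in auto)
    moreover have "\<bar>s i x * (a i * (cutoff_ratio \<epsilon> (t i x))\<^sup>2 + 2 * cutoff_ratio \<epsilon> (t i x) * (1 - cutoff_ratio \<epsilon> (t i x))) *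
     (\<Prod>j\<in>I - {i}. (cutoff_ratio \<epsilon> (t j x))\<^sup>2)\<bar> \<le> (S i * (\<bar>a i\<bar> + 2)) * 1" if i: "i \<in> I" for i
      unfolding abs_mult
    proof (intro mult_mono)
      define r where "r = cutoff_ratio \<epsilon> (t i x)"
      have r: "0 \<le> r" "r \<le> 1" using cutoff_ratio_bounds[OF e] by (auto simp: r_def)
      have "\<bar>a i * r\<^sup>2\<bar> \<le> \<bar>a i\<bar> * 1" unfolding abs_mult
        by (intro mult_mono) (use r in \<open>auto intro: power_le_one\<close>)
      moreover have "\<bar>2 * r * (1 - r)\<bar> \<le> 2 * 1 * 1" unfolding abs_mult
        by (intro mult_mono) (use r in auto)
      ultimately have "\<bar>a i * r\<^sup>2 + 2 * r * (1 - r)\<bar> \<le> \<bar>a i\<bar> + 2" by linarith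
      then show "\<bar>a i * (cutoff_ratio \<epsilon> (t i x))\<^sup>2 + 2 * cutoff_ratio \<epsilon> (t i x) * (1 - cutoff_ratio \<epsilon> (t i x))\<bar> \<le> \<bar>a i\<bar> + 2"
        by (simp add: r_def)
      show "\<bar>\<Prod>j\<in>I - {i}. (cutoff_ratio \<epsilon> (t j x))\<^sup>2\<bar> \<le> 1"
        unfolding abs_prod using cutoff_ratio_bounds[OF e] by (intro prod_le_1) (auto intro!: power_le_one)
      show "\<bar>s i x\<bar> \<le> S i" "0 \<le> S i" using S[OF i x] by auto
      then show "0 \<le> S i * (\<bar>a i\<bar> + 2)" by simp
    qed auto
    then have "\<bar>\<Sum>i\<in>I. s i x * (a i * (cutoff_ratio \<epsilon> (t i x))\<^sup>2 + 2 * cutoff_ratio \<epsilon> (t i x) * (1 - cutoff_ratio \<epsilon> (t i x))) *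
     (\<Prod>j\<in>I - {i}. (cutoff_ratio \<epsilon> (t j x))\<^sup>2)\<bar> \<le> (\<Sum>i\<in>I. S i * (\<bar>a i\<bar> + 2))"
      by (intro order_trans[OF sum_abs] sum_mono) auto
    ultimately show ?thesis unfolding cut_div_def by linarith
  qed
  then show ?thesis by blast
qed

lemma measurable_t [measurable]: "i \<in> I \<Longrightarrow> t i \<in> borel_measurable borel"
  by (intro borel_measurable_continuous_onI continuous_t)

lemma weight_measurable [measurable]: "weight \<in> borel_measurable unit_ball"
  by (rule borel_measurable_unit_ball) (unfold weight_def, measurable)

text \<open>Limit of \<open>weak_gradient_cutoff\<close> for vanishing \<open>\<epsilon>\<close>:
  \<open>cut\<close> tends to 1 and \<open>cut_div\<close> to the bracket on the left, both
  boundedly, so the walls contribute nothing.\<close>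

lemma weak_gradient_divergence:
  assumes w: "weak_gradient {x. \<forall>i\<in>I. 0 < t i x} u g"
    and [measurable]: "u \<in> borel_measurable unit_ball" "g \<in> borel_measurable unit_ball"
    and u: "integrable unit_ball (\<lambda>x. weight x * u x)"
    and g: "integrable unit_ball (\<lambda>x. weight x * norm (g x))"
    and pos: "AE x in unit_ball. \<forall>i\<in>I. 0 < t i x"
  shows "(LINT x|unit_ball. (weight x * (divergence x + (\<Sum>i\<in>I. a i * s i x))) * u x) =
    - (LINT x|unit_ball. weight x * (Z x \<bullet> g x))"
proof -
  define e where "e n = inverse (real (Suc n))" for n
  have e: "e n > 0" for n by (simp add: e_def)
  have lim_e: "filterlim e (at_right 0) sequentially"
    unfolding filterlim_at using e LIMSEQ_inverse_real_of_nat by (auto simp: e_def[abs_def])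
  have [measurable]: "s i \<in> borel_measurable borel" if "i \<in> I" for i
    by (intro borel_measurable_continuous_onI s(2) that)
  have [measurable]: "divergence \<in> borel_measurable borel"
    by (intro borel_measurable_continuous_onI continuous_divergence)
  have [measurable]: "(\<lambda>x. cut (e n) x) \<in> borel_measurable unit_ball" for n
    by (rule borel_measurable_unit_ball) (unfold cut_def cutoff_ratio_def, measurable)
  have [measurable]: "(\<lambda>x. cut_div (e n) x) \<in> borel_measurable unit_ball" for n
    by (rule borel_measurable_unit_ball) (unfold cut_div_def cut_def cutoff_ratio_def, measurable)
  have [measurable]: "(\<lambda>x. divergence x + (\<Sum>i\<in>I. a i * s i x)) \<in> borel_measurable unit_ball"
    by (rule borel_measurable_unit_ball) measurable
  have contZ: "continuous_on UNIV Z"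
    using continuous_on_vec_lambda[of UNIV "\<lambda>j x. Z x $ j"] continuous_Z by simp
  then have [measurable]: "Z \<in> borel_measurable unit_ball"
    by (intro borel_measurable_unit_ball borel_measurable_continuous_onI)
  obtain B where B: "\<And>\<epsilon> x. \<epsilon> > 0 \<Longrightarrow> x \<in> cball 0 1 \<Longrightarrow> \<bar>cut_div \<epsilon> x\<bar> \<le> B" using cut_div_bounded by blast
  have "bounded (Z ` cball 0 1)"
    by (intro compact_imp_bounded compact_continuous_image continuous_on_subset[OF contZ]) auto
  then obtain C where C: "\<And>x. x \<in> cball 0 1 \<Longrightarrow> norm (Z x) \<le> C"
    unfolding bounded_iff by blast
  have wpos: "weight x \<ge> 0" for x unfolding weight_def by (intro prod_nonneg) auto
  have "(\<lambda>n. LINT x|unit_ball. (weight x * cut_div (e n) x) * u x) \<longlonglongrightarrow>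
      (LINT x|unit_ball. (weight x * (divergence x + (\<Sum>i\<in>I. a i * s i x))) * u x)"
  proof (rule integral_dominated_convergence[where w = "\<lambda>x. B * \<bar>weight x * u x\<bar>"])
    show "AE x in unit_ball. (\<lambda>n. (weight x * cut_div (e n) x) * u x) \<longlonglongrightarrow> (weight x * (divergence x + (\<Sum>i\<in>I. a i * s i x))) * u x"
      using pos by eventually_elim (intro tendsto_intros cut_tendsto(2) lim_e, auto)
    show "AE x in unit_ball. norm ((weight x * cut_div (e n) x) * u x) \<le> B * \<bar>weight x * u x\<bar>" for n
    proof (rule AE_I2)
      fix x :: "real ^ 'd" assume "x \<in> space unit_ball"
      then have "\<bar>cut_div (e n) x\<bar> \<le> B" using B[OF e, of x n] by auto
      then show "norm ((weight x * cut_div (e n) x) * u x) \<le> B * \<bar>weight x * u x\<bar>"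
        using mult_right_mono[of "\<bar>cut_div (e n) x\<bar>" B "\<bar>weight x * u x\<bar>"] by (simp add: abs_mult ac_simps)
    qed
  qed (use u in auto)
  moreover have "(\<lambda>n. LINT x|unit_ball. (weight x * cut (e n) x) * (Z x \<bullet> g x)) \<longlonglongrightarrow>
      (LINT x|unit_ball. weight x * (Z x \<bullet> g x))"
  proof (rule integral_dominated_convergence[where w = "\<lambda>x. C * (weight x * norm (g x))"])
    show "AE x in unit_ball. (\<lambda>n. (weight x * cut (e n) x) * (Z x \<bullet> g x)) \<longlonglongrightarrow> weight x * (Z x \<bullet> g x)"
      using pos
    proof eventually_elim
      case (elim x)
      have "(\<lambda>n. (weight x * cut (e n) x) * (Z x \<bullet> g x)) \<longlonglongrightarrow> (weight x * 1) * (Z x \<bullet> g x)"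
        by (intro tendsto_intros cut_tendsto(1) lim_e) (use elim in auto)
      then show ?case by simp
    qed
    show "AE x in unit_ball. norm ((weight x * cut (e n) x) * (Z x \<bullet> g x)) \<le> C * (weight x * norm (g x))" for n
    proof (rule AE_I2)
      fix x :: "real ^ 'd" assume "x \<in> space unit_ball"
      then have x: "x \<in> cball 0 1" by simp
      have "\<bar>Z x \<bullet> g x\<bar> \<le> C * norm (g x)"
        using Cauchy_Schwarz_ineq2[of "Z x" "g x"] mult_right_mono[OF C[OF x] norm_ge_zero[of "g x"]] by linarith
      then have "\<bar>cut (e n) x * (Z x \<bullet> g x)\<bar> \<le> 1 * (C * norm (g x))"
        unfolding abs_mult using cut_bounds[OF e, of n x] by (intro mult_mono) auto
      from mult_left_mono[OF this wpos[of x]]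
      show "norm ((weight x * cut (e n) x) * (Z x \<bullet> g x)) \<le> C * (weight x * norm (g x))"
        using wpos[of x] by (simp add: abs_mult mult.commute mult.left_commute)
    qed
  qed (use g in auto)
  ultimately show ?thesis
    unfolding weak_gradient_cutoff[OF e w] using LIMSEQ_unique tendsto_minus by blast
qed

end

section \<open>Reflection groups and Lebesgue measure\<close>

text \<open>Both measures are translation invariant and agree on the unit ball, so they are equal by the
  usual Fubini argument for the uniqueness of the Haar measure.\<close>

lemma lborel_distr_orthogonal_transformation:
  fixes f :: "'a::euclidean_space \<Rightarrow> 'a"
  assumes f: "orthogonal_transformation f"
  shows "distr lborel borel f = lborel"
proof (rule measure_eqI)
  have lin: "linear f" using f by (rule orthogonal_transformation_linear)
  then have [measurable]: "f \<in> borel_measurable borel"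
    by (intro borel_measurable_continuous_onI linear_continuous_on) (simp add: linear_conv_bounded_linear)
  have nf: "norm (f x) = norm x" for x using f by (rule orthogonal_transformation_norm)
  define m where "m = distr lborel borel f"
  have sets_m [measurable_cong]: "sets m = sets borel" and [simp]: "space m = UNIV" by (simp_all add: m_def)
  have ball: "emeasure m (cball 0 r) = emeasure lborel (cball 0 r :: 'a set)" for r
  proof -
    have "f -` cball 0 r = (cball 0 r :: 'a set)" by (auto simp: nf)
    then show ?thesis by (simp add: m_def emeasure_distr)
  qed
  have trans: "distr m borel ((+) c) = m" for c
  proof -
    obtain c' where c': "f c' = c" using orthogonal_transformation_surj[OF f] by (metis surjD)
    have "distr m borel ((+) c) = distr lborel borel ((+) c \<circ> f)"
      unfolding m_def by (rule distr_distr) auto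
    also have "(+) c \<circ> f = f \<circ> (+) c'" by (auto simp: linear_add[OF lin] c' fun_eq_iff)
    also have "distr lborel borel (f \<circ> (+) c') = distr (distr lborel borel ((+) c')) borel f"
      by (rule distr_distr[symmetric]) auto
    finally show ?thesis by (simp add: lborel_distr_plus m_def)
  qed
  have transl: "(\<integral>\<^sup>+x. h (c + x) \<partial>M) = (\<integral>\<^sup>+x. h x \<partial>M)"
    if "distr M borel ((+) c) = M" "sets M = sets borel" and [measurable]: "h \<in> borel_measurable borel"
    for M :: "'a measure" and h c
  proof -
    have "(\<integral>\<^sup>+x. h x \<partial>M) = (\<integral>\<^sup>+x. h x \<partial>distr M borel ((+) c))" by (simp add: that)
    also have "\<dots> = (\<integral>\<^sup>+x. h (c + x) \<partial>M)"
      by (rule nn_integral_distr) (auto simp: measurable_cong_sets[OF that(2) refl])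
    finally show ?thesis ..
  qed
  have "sigma_finite_measure m"
  proof
    have "emeasure m (cball 0 (real n)) \<noteq> \<infinity>" for n
      using emeasure_lborel_cball_finite[of "0::'a" "real n"] by (simp add: ball)
    moreover have "(\<Union>n. cball 0 (real n)) = (UNIV :: 'a set)"
      by (auto simp: real_arch_simple)
    ultimately show "\<exists>A. countable A \<and> A \<subseteq> sets m \<and> \<Union>A = space m \<and> (\<forall>a\<in>A. emeasure m a \<noteq> \<infinity>)"
      by (intro exI[of _ "range (\<lambda>n. cball 0 (real n))"]) (auto simp: sets_m)
  qed
  then interpret pair_sigma_finite lborel m
    unfolding pair_sigma_finite_def using lborel.sigma_finite_measure_axioms by blast
  show "sets (distr lborel borel f) = sets lborel" by simp
  fix A assume "A \<in> sets (distr lborel borel f)"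
  then have A[measurable]: "A \<in> sets borel" by simp
  define B where "B = (cball 0 1 :: 'a set)"
  have B[measurable]: "B \<in> sets borel" by (simp add: B_def)
  \<comment> \<open>The indicator of \<open>y \<in> B\<close> and \<open>y + x \<in> A\<close> is
    integrated in two ways: translating in \<open>x\<close> gives
    \<open>emeasure m B * emeasure lborel A\<close>, translating in \<open>y\<close> exchanges the
    roles of the two measures.\<close>
  have "emeasure m B * emeasure lborel A = (\<integral>\<^sup>+y. indicator B y * (\<integral>\<^sup>+x. indicator A x \<partial>lborel) \<partial>m)"
    by (subst nn_integral_multc) (auto simp: sets_m)
  also have "\<dots> = (\<integral>\<^sup>+y. indicator B y * (\<integral>\<^sup>+x. indicator A (y + x) \<partial>lborel) \<partial>m)"
    by (subst transl[OF lborel_distr_plus]) auto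
  also have "\<dots> = (\<integral>\<^sup>+y. \<integral>\<^sup>+x. indicator B y * indicator A (y + x) \<partial>lborel \<partial>m)"
    by (subst nn_integral_cmult) auto
  also have "\<dots> = (\<integral>\<^sup>+x. \<integral>\<^sup>+y. indicator B y * indicator A (y + x) \<partial>m \<partial>lborel)"
    by (rule Fubini') measurable
  also have "\<dots> = (\<integral>\<^sup>+x. \<integral>\<^sup>+y. indicator B (- x + y) * indicator A y \<partial>m \<partial>lborel)"
  proof (rule nn_integral_cong)
    fix x :: 'a
    show "(\<integral>\<^sup>+y. indicator B y * indicator A (y + x) \<partial>m) = (\<integral>\<^sup>+y. indicator B (- x + y) * indicator A y \<partial>m)"
      using transl[OF trans[of "- x"] sets_m, of "\<lambda>y. indicator B y * indicator A (y + x)"] by simp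
  qed
  also have "\<dots> = (\<integral>\<^sup>+y. \<integral>\<^sup>+x. indicator B (- x + y) * indicator A y \<partial>lborel \<partial>m)"
    by (rule Fubini'[symmetric]) measurable
  also have "\<dots> = (\<integral>\<^sup>+y. (\<integral>\<^sup>+x. indicator B x \<partial>lborel) * indicator A y \<partial>m)"
  proof (rule nn_integral_cong)
    fix y :: 'a
    \<comment> \<open>The symmetry of the ball about the origin turns the reflected translate into
      an ordinary one.\<close>
    have "indicator B (- x + y) = (indicator B (- y + x) :: ennreal)" for x
      by (simp add: B_def indicator_def norm_minus_commute)
    then have "(\<integral>\<^sup>+x. indicator B (- x + y) * indicator A y \<partial>lborel) = (\<integral>\<^sup>+x. indicator B (- y + x) \<partial>lborel) * indicator A y"
      by (subst nn_integral_multc[symmetric]) auto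
    then show "(\<integral>\<^sup>+x. indicator B (- x + y) * indicator A y \<partial>lborel) = (\<integral>\<^sup>+x. indicator B x \<partial>lborel) * indicator A y"
      by (subst (asm) transl[OF lborel_distr_plus]) auto
  qed
  also have "\<dots> = emeasure lborel B * emeasure m A"
    by (subst nn_integral_cmult) (auto simp: sets_m)
  finally have "emeasure lborel B * emeasure lborel A = emeasure lborel B * emeasure m A"
    by (simp add: ball B_def)
  moreover have "emeasure lborel B \<noteq> 0"
  proof -
    have "measure lborel (ball (0::'a) 1) > 0" by (rule content_ball_pos) simp
    moreover have "emeasure lborel (ball (0::'a) 1) \<le> emeasure lborel B"
      unfolding B_def by (intro emeasure_mono) auto
    ultimately show ?thesis by (auto simp: measure_def)
  qed
  moreover have "emeasure lborel B \<noteq> top"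
    using emeasure_lborel_cball_finite[of "0::'a" 1] by (simp add: B_def)
  ultimately show "emeasure (distr lborel borel f) A = emeasure lborel A"
    by (simp add: ennreal_mult_cancel_left m_def)
qed

lemma lebesgue_orthogonal_transformation:
  fixes f :: "'a::euclidean_space \<Rightarrow> 'a"
  assumes f: "orthogonal_transformation f"
  shows "f \<in> lebesgue \<rightarrow>\<^sub>M lebesgue" and "distr lebesgue lebesgue f = lebesgue"
proof -
  have [measurable]: "f \<in> borel_measurable borel"
    using orthogonal_transformation_linear[OF f]
    by (intro borel_measurable_continuous_onI linear_continuous_on) (simp add: linear_conv_bounded_linear)
  have "distr lebesgue lborel f = distr lborel lborel f"
    by (rule distr_completion) simp
  also have "\<dots> = distr lborel borel f" by (rule distr_cong) auto
  also have "\<dots> = lborel" by (rule lborel_distr_orthogonal_transformation[OF f])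
  finally have eq: "distr lebesgue lborel f = lborel" .
  have m: "f \<in> lebesgue \<rightarrow>\<^sub>M lborel" by (rule measurable_completion) simp
  show "f \<in> lebesgue \<rightarrow>\<^sub>M lebesgue"
    by (rule completion.measurable_completion2[OF m]) (simp add: eq)
  show "distr lebesgue lebesgue f = lebesgue"
    using completion.completion_distr_eq[OF m] eq by simp
qed

lemma unit_ball_orthogonal_transformation:
  fixes f :: "real ^ 'd \<Rightarrow> real ^ 'd"
  assumes f: "orthogonal_transformation f"
  shows "f \<in> unit_ball \<rightarrow>\<^sub>M unit_ball" and "distr unit_ball unit_ball f = unit_ball"
proof -
  have nf: "norm (f x) = norm x" for x using f by (rule orthogonal_transformation_norm)
  note leb = lebesgue_orthogonal_transformation[OF f]
  show m: "f \<in> unit_ball \<rightarrow>\<^sub>M unit_ball"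
    by (rule measurable_restrict_space3[OF leb(1)]) (auto simp: nf)
  show "distr unit_ball unit_ball f = unit_ball"
  proof (rule measure_eqI)
    fix A assume "A \<in> sets (distr unit_ball unit_ball f)"
    then have A: "A \<in> sets unit_ball" by simp
    then have A': "A \<in> sets lebesgue" "A \<subseteq> cball 0 1"
      by (auto simp: sets_restrict_space_iff)
    have sub: "f -` A \<subseteq> cball 0 1" using A'(2) nf by fastforce
    have "emeasure (distr unit_ball unit_ball f) A = emeasure unit_ball (f -` A \<inter> cball 0 1)"
      using m A by (simp add: emeasure_distr)
    also have "f -` A \<inter> cball 0 1 = f -` A" using sub by blast
    also have "emeasure unit_ball (f -` A) = emeasure lebesgue (f -` A)"
      using sub by (subst emeasure_restrict_space) auto
    also have "\<dots> = emeasure (distr lebesgue lebesgue f) A"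
      using leb(1) A'(1) by (simp add: emeasure_distr)
    also have "\<dots> = emeasure unit_ball A"
      unfolding leb(2) using A' by (subst emeasure_restrict_space) auto
    finally show "emeasure (distr unit_ball unit_ball f) A = emeasure unit_ball A" .
  qed simp
qed

section \<open>Finiteness of the reflection group and invariance of the weight\<close>

lemma orthogonal_transformation_reflection: "orthogonal_transformation (reflection v)"
  by (simp add: orthogonal_transformation_def linear_reflection inner_reflection)

lemma orthogonal_transformation_reflection_group:
  "w \<in> reflection_group Rp \<Longrightarrow> orthogonal_transformation w"
proof (induction rule: reflection_group.induct)
  case one
  show ?case by (simp add: id_def orthogonal_transformation_id)
next
  case (step w v)
  then show ?case using orthogonal_transformation_compose orthogonal_transformation_reflection by blast
qed

lemma finite_reflection_group:
  assumes "positive_root_system Rp"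
  shows "finite (reflection_group Rp)"
proof -
  obtain R u0 where R: "root_system R" and Rp: "Rp = {v \<in> R. v \<bullet> u0 > 0}"
    using assms unfolding positive_root_system_def by blast
  have fin: "finite R" and refl: "\<And>u v. u \<in> R \<Longrightarrow> v \<in> R \<Longrightarrow> reflection v u \<in> R"
    using R unfolding root_system_def by auto
  have w: "(\<forall>x\<in>R. w x \<in> R) \<and> (\<forall>x. (\<forall>v\<in>Rp. x \<bullet> v = 0) \<longrightarrow> w x = x)" if "w \<in> reflection_group Rp" for w
    using that
  proof (induction rule: reflection_group.induct)
    case (step w v)
    then show ?case using refl Rp by (auto simp: reflection_def)
  qed auto
  \<comment> \<open>Group elements are linear and fix the orthogonal complement of \<open>Rp\<close>
    pointwise, so their values on \<open>Rp\<close>, which lie in the finite set \<open>R\<close>,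
    determine them.\<close>
  have "inj_on (\<lambda>w. restrict w Rp) (reflection_group Rp)"
  proof (rule inj_onI, rule ext)
    fix w1 w2 x assume A: "w1 \<in> reflection_group Rp" "w2 \<in> reflection_group Rp" "restrict w1 Rp = restrict w2 Rp"
    note lin = A(1,2)[THEN orthogonal_transformation_reflection_group, THEN orthogonal_transformation_linear]
    have eq: "w1 v = w2 v" if "v \<in> Rp" for v using A(3) that by (metis restrict_apply')
    obtain y z where yz: "y \<in> span Rp" "\<And>v. v \<in> span Rp \<Longrightarrow> orthogonal z v" "x = y + z"
      using orthogonal_subspace_decomp_exists by metis
    have "w1 y = w2 y" using linear_eq_on_span[OF lin eq yz(1)] .
    moreover have "w1 z = z" "w2 z = z"
      using w[OF A(1)] w[OF A(2)] yz(2) span_base by (metis orthogonal_def)+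
    ultimately show "w1 x = w2 x" by (simp add: yz(3) linear_add[OF lin(1)] linear_add[OF lin(2)])
  qed
  moreover have "(\<lambda>w. restrict w Rp) ` reflection_group Rp \<subseteq> (\<Pi>\<^sub>E v\<in>Rp. R)"
    using w Rp by auto
  moreover have "finite (\<Pi>\<^sub>E v\<in>Rp. R)"
    using fin Rp by (intro finite_PiE) auto
  ultimately show ?thesis using inj_on_finite by blast
qed

lemma reflection_in_group: "v \<in> Rp \<Longrightarrow> reflection v \<in> reflection_group Rp"
  using reflection_group.step[OF reflection_group.one] by simp

lemma inv_reflection: "inv (reflection v) = reflection v"
  by (rule inv_unique_comp) (auto simp: fun_eq_iff)

lemma reflection_conj: "reflection (reflection v u) = reflection v \<circ> reflection u \<circ> reflection v"
proof
  fix x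
  show "reflection (reflection v u) x = (reflection v \<circ> reflection u \<circ> reflection v) x"
    unfolding reflection_def[of "reflection v u"] comp_apply reflection_def[of u]
    by (simp add: linear_diff[OF linear_reflection] linear_cmul[OF linear_reflection] inner_reflection_left)
qed

lemma reflection_minus: "reflection (- u) = reflection u"
  by (simp add: reflection_def fun_eq_iff)

lemma h_weight_reflection:
  assumes "positive_root_system Rp" and \<kappa>: "multiplicity_function Rp \<kappa>" and v: "v \<in> Rp"
  shows "h_weight Rp \<kappa> (reflection v x) = h_weight Rp \<kappa> x"
proof -
  obtain R u0 where R: "root_system R" and u0: "\<And>v. v \<in> R \<Longrightarrow> v \<bullet> u0 \<noteq> 0"
    and Rp: "Rp = {v \<in> R. v \<bullet> u0 > 0}"
    using assms(1) unfolding positive_root_system_def by blast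
  have refl: "\<And>u v. u \<in> R \<Longrightarrow> v \<in> R \<Longrightarrow> reflection v u \<in> R" using R unfolding root_system_def by auto
  have neg: "- u \<in> R" if "u \<in> R" for u
  proof -
    have "u \<noteq> 0" using that R by (auto simp: root_system_def)
    then have "reflection u u = - u" by (simp add: reflection_def dot_square_norm scaleR_2)
    then show ?thesis using refl[OF that that] by simp
  qed
  \<comment> \<open>The reflected root may be negative. Correcting its sign changes neither the
    absolute value of the linear form nor the reflection, and gives an involution of
    \<open>Rp\<close> that reindexes the product; \<open>\<kappa>\<close> is preserved because the
    two reflections are conjugate.\<close>
  define \<tau> where "\<tau> u = (if reflection v u \<in> Rp then reflection v u else - reflection v u)" for u
  have \<tau>1: "\<tau> u \<in> Rp" if "u \<in> Rp" for u
  proof -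
    have "reflection v u \<in> R" using refl that v Rp by auto
    then show ?thesis using u0[of "reflection v u"] neg Rp by (auto simp: \<tau>_def)
  qed
  have \<tau>2: "\<tau> (\<tau> u) = u" if "u \<in> Rp" for u
    using that Rp by (auto simp: \<tau>_def linear_neg[OF linear_reflection])
  have \<tau>3: "\<kappa> (\<tau> u) = \<kappa> u" if "u \<in> Rp" for u
  proof -
    have "reflection (\<tau> u) = reflection v \<circ> reflection u \<circ> inv (reflection v)"
      by (simp add: \<tau>_def reflection_conj reflection_minus inv_reflection)
    then show ?thesis
      using \<kappa> \<tau>1 that reflection_in_group[OF v] unfolding multiplicity_function_def by blast
  qed
  have \<tau>4: "\<bar>x \<bullet> \<tau> u\<bar> = \<bar>reflection v x \<bullet> u\<bar>" for u
    by (simp add: \<tau>_def inner_reflection_left)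
  show ?thesis unfolding h_weight_def
    by (rule prod.reindex_bij_witness[of _ \<tau> \<tau>]) (simp_all add: \<tau>1 \<tau>2 \<tau>3 \<tau>4)
qed

lemma W_weight_reflection_group:
  assumes "positive_root_system Rp" "multiplicity_function Rp \<kappa>" "w \<in> reflection_group Rp"
  shows "W_weight Rp \<kappa> \<mu> (w x) = W_weight Rp \<kappa> \<mu> x"
  using assms(3)
proof (induction arbitrary: x rule: reflection_group.induct)
  case (step w v)
  then show ?case using h_weight_reflection[OF assms(1,2)] by (simp add: W_weight_def)
qed simp

section \<open>The weighted measure on the ball\<close>

lemma W_weight_nonneg: "0 \<le> W_weight Rp \<kappa> \<mu> x"
  by (simp add: W_weight_def)

lemma h_weight_measurable [measurable]:
  fixes Rp :: "(real ^ 'd) set" shows "h_weight Rp \<kappa> \<in> borel_measurable borel"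
  unfolding h_weight_def by measurable

lemma W_weight_measurable [measurable]:
  fixes Rp :: "(real ^ 'd) set" shows "W_weight Rp \<kappa> \<mu> \<in> borel_measurable borel"
  unfolding W_weight_def by measurable

text \<open>Integrability of the weight is assumed here; the theorem extracts it from the
  normalisation of \<open>f\<close>.\<close>

locale dunkl_ball =
  fixes Rp :: "(real ^ 'd) set" and \<kappa> :: "real ^ 'd \<Rightarrow> real" and \<mu> :: real
  assumes prs: "positive_root_system Rp" and mult: "multiplicity_function Rp \<kappa>" and mu: "0 \<le> \<mu>"
    and integrable_W: "integrable unit_ball (W_weight Rp \<kappa> \<mu>)"
begin

abbreviation W where "W \<equiv> W_weight Rp \<kappa> \<mu>"
abbreviation G where "G \<equiv> reflection_group Rp"

text \<open>Left unnormalised: the factor \<open>b\<close> enters only when the scalar results are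
  assembled into those for \<open>f\<close>.\<close>

definition \<nu> where "\<nu> = density unit_ball (\<lambda>x. ennreal (W x))"

lemma sets_\<nu> [measurable_cong, simp]: "sets \<nu> = sets unit_ball" and space_\<nu> [simp]: "space \<nu> = cball 0 1"
  by (simp_all add: \<nu>_def)

lemma W_measurable [measurable]: "W \<in> borel_measurable unit_ball"
  by (rule borel_measurable_unit_ball) measurable

lemma measurable_\<nu> [simp]: "borel_measurable \<nu> = borel_measurable unit_ball"
  by (rule measurable_cong_sets) auto

lemma borel_imp_\<nu>: "f \<in> borel_measurable borel \<Longrightarrow> f \<in> borel_measurable \<nu>"
  by (simp add: borel_measurable_unit_ball)

lemma continuous_imp_\<nu>: "continuous_on UNIV f \<Longrightarrow> f \<in> borel_measurable \<nu>"
  by (intro borel_imp_\<nu> borel_measurable_continuous_onI)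

lemma integrable_\<nu>_iff:
  fixes f :: "real ^ 'd \<Rightarrow> 'e::{banach, second_countable_topology}"
  shows "f \<in> borel_measurable unit_ball \<Longrightarrow> integrable \<nu> f \<longleftrightarrow> integrable unit_ball (\<lambda>x. W x *\<^sub>R f x)"
  unfolding \<nu>_def by (rule integrable_density) (auto simp: W_weight_nonneg)

lemma integral_\<nu>:
  fixes f :: "real ^ 'd \<Rightarrow> 'e::{banach, second_countable_topology}"
  shows "f \<in> borel_measurable unit_ball \<Longrightarrow> integral\<^sup>L \<nu> f = (LINT x|unit_ball. W x *\<^sub>R f x)"
  unfolding \<nu>_def by (rule integral_density) (auto simp: W_weight_nonneg)

lemma AE_\<nu>: "AE x in unit_ball. P x \<Longrightarrow> AE x in \<nu>. P x"
  unfolding \<nu>_def by (subst AE_density) (auto elim: eventually_mono)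

sublocale finite_measure \<nu>
proof
  have "emeasure \<nu> (space \<nu>) = (\<integral>\<^sup>+x. ennreal (W x) \<partial>unit_ball)"
    by (simp add: \<nu>_def emeasure_density cong: nn_integral_cong)
       (metis (no_types, lifting) indicator_simps(1) mult.right_neutral nn_integral_cong space_lebesgue_on)
  also have "\<dots> < \<infinity>" using integrable_W by (simp add: integrable_iff_bounded W_weight_nonneg)
  finally show "emeasure \<nu> (space \<nu>) \<noteq> \<infinity>" by simp
qed

lemma integrable_bounded:
  fixes f :: "real ^ 'd \<Rightarrow> real"
  assumes "f \<in> borel_measurable \<nu>" "\<And>x. x \<in> cball 0 1 \<Longrightarrow> \<bar>f x\<bar> \<le> B"
  shows "integrable \<nu> f"
  by (rule integrable_const_bound[where B = B]) (use assms in auto)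

lemma integrable_continuous_mult:
  fixes h F :: "real ^ 'd \<Rightarrow> real"
  assumes h: "continuous_on UNIV h" and F: "integrable \<nu> F"
  shows "integrable \<nu> (\<lambda>x. h x * F x)"
proof -
  obtain B where B: "B > 0" "\<And>x. x \<in> cball 0 1 \<Longrightarrow> \<bar>h x\<bar> \<le> B" using continuous_bounded_cball[OF h] by blast
  show ?thesis
  proof (rule Bochner_Integration.integrable_bound[where f = "\<lambda>x. B * F x"])
    show "(\<lambda>x. h x * F x) \<in> borel_measurable \<nu>"
      using continuous_imp_\<nu>[OF h] borel_measurable_integrable[OF F] by (rule borel_measurable_times)
    show "AE x in \<nu>. norm (h x * F x) \<le> norm (B * F x)"
      using B by (intro AE_I2) (auto simp: abs_mult intro!: mult_right_mono)
  qed (use F in simp)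
qed

lemma integrable_continuous:
  fixes f :: "real ^ 'd \<Rightarrow> real"
  assumes "continuous_on UNIV f" shows "integrable \<nu> f"
  using integrable_continuous_mult[OF assms integrable_const[of 1]] by simp

definition square_integrable :: "(real ^ 'd \<Rightarrow> real) \<Rightarrow> bool" where
  "square_integrable u \<longleftrightarrow> u \<in> borel_measurable \<nu> \<and> integrable \<nu> (\<lambda>x. (u x)\<^sup>2)"

lemma square_integrable_continuous: "continuous_on UNIV f \<Longrightarrow> square_integrable f"
  unfolding square_integrable_def
  by (intro conjI continuous_imp_\<nu> integrable_continuous continuous_intros)

lemma square_integrable_mult:
  assumes "square_integrable u" "square_integrable v"
  shows "integrable \<nu> (\<lambda>x. u x * v x)"
proof (rule Bochner_Integration.integrable_bound[where f = "\<lambda>x. (u x)\<^sup>2 + (v x)\<^sup>2"])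
  have "\<bar>p * q\<bar> \<le> p\<^sup>2 + q\<^sup>2" for p q :: real
  proof -
    have "2 * (\<bar>p\<bar> * \<bar>q\<bar>) \<le> p\<^sup>2 + q\<^sup>2" using sum_squares_bound[of "\<bar>p\<bar>" "\<bar>q\<bar>"] by simp
    moreover have "0 \<le> \<bar>p\<bar> * \<bar>q\<bar>" by simp
    ultimately show ?thesis unfolding abs_mult by linarith
  qed
  then show "AE x in \<nu>. norm (u x * v x) \<le> norm ((u x)\<^sup>2 + (v x)\<^sup>2)" by simp
qed (use assms in \<open>auto simp: square_integrable_def\<close>)

lemma square_integrable_cmult: "square_integrable u \<Longrightarrow> square_integrable (\<lambda>x. c * u x)"
  unfolding square_integrable_def by (auto simp: power_mult_distrib)

lemma square_integrable_add:
  assumes "square_integrable u" "square_integrable v" shows "square_integrable (\<lambda>x. u x + v x)"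
  using assms square_integrable_mult[OF assms] unfolding square_integrable_def
  by (auto simp: power2_sum mult.assoc)

lemma square_integrable_diff:
  assumes "square_integrable u" "square_integrable v" shows "square_integrable (\<lambda>x. u x - v x)"
  using square_integrable_add[OF assms(1) square_integrable_cmult[OF assms(2), of "-1"]] by simp

lemma square_integrable_imp_integrable: "square_integrable u \<Longrightarrow> integrable \<nu> u"
  using square_integrable_mult[of u "\<lambda>x. 1"] square_integrable_continuous[of "\<lambda>x. 1"] by simp

lemma poly_below_square_integrable: "poly_below n p \<Longrightarrow> square_integrable p"
  by (intro square_integrable_continuous poly_below_continuous)

section \<open>Invariance of the weighted measure and averaging over the group\<close>

lemma group_measurable: "w \<in> G \<Longrightarrow> w \<in> \<nu> \<rightarrow>\<^sub>M \<nu>"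
  using unit_ball_orthogonal_transformation(1)[OF orthogonal_transformation_reflection_group]
  by (simp cong: measurable_cong_sets)

lemma distr_group: assumes w: "w \<in> G" shows "distr \<nu> \<nu> w = \<nu>"
proof (rule measure_eqI)
  note ub = unit_ball_orthogonal_transformation[OF orthogonal_transformation_reflection_group[OF w]]
  note [measurable] = ub(1)
  fix A assume "A \<in> sets (distr \<nu> \<nu> w)"
  then have A [measurable]: "A \<in> sets unit_ball" by simp
  have m: "w -` A \<inter> cball 0 1 \<in> sets unit_ball"
    using measurable_sets[OF ub(1) A] by simp
  have "emeasure (distr \<nu> \<nu> w) A = emeasure \<nu> (w -` A \<inter> cball 0 1)"
    using group_measurable[OF w] A by (simp add: emeasure_distr)
  also have "\<dots> = (\<integral>\<^sup>+x. ennreal (W x) * indicator (w -` A \<inter> cball 0 1) x \<partial>unit_ball)"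
    unfolding \<nu>_def by (rule emeasure_density) (use m in auto)
  also have "\<dots> = (\<integral>\<^sup>+x. ennreal (W (w x)) * indicator A (w x) \<partial>unit_ball)"
    by (rule nn_integral_cong) (auto simp: indicator_def W_weight_reflection_group[OF prs mult w])
  also have "\<dots> = (\<integral>\<^sup>+x. ennreal (W x) * indicator A x \<partial>distr unit_ball unit_ball w)"
    by (rule nn_integral_distr[symmetric]) (use ub(1) in auto)
  also have "\<dots> = emeasure \<nu> A"
    unfolding ub(2) \<nu>_def by (rule emeasure_density[symmetric]) auto
  finally show "emeasure (distr \<nu> \<nu> w) A = emeasure \<nu> A" .
qed simp

lemma integral_group:
  fixes f :: "real ^ 'd \<Rightarrow> real"
  assumes "w \<in> G" "f \<in> borel_measurable \<nu>"
  shows "(LINT x|\<nu>. f (w x)) = (LINT x|\<nu>. f x)"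
  using integral_distr[OF group_measurable[OF assms(1)] assms(2)] distr_group[OF assms(1)] by simp

lemma integrable_group:
  fixes f :: "real ^ 'd \<Rightarrow> real"
  assumes "w \<in> G" "integrable \<nu> f"
  shows "integrable \<nu> (\<lambda>x. f (w x))"
  using integrable_distr[OF group_measurable[OF assms(1)], of f] distr_group[OF assms(1)] assms(2) by simp

lemma AE_group:
  assumes "w \<in> G" "AE x in \<nu>. P x" shows "AE x in \<nu>. P (w x)"
proof -
  from assms(2) obtain N where N: "N \<in> null_sets \<nu>" "{x \<in> space \<nu>. \<not> P x} \<subseteq> N"
    by (auto elim!: AE_E simp: null_sets_def)
  have "w -` N \<inter> space \<nu> \<in> null_sets \<nu>"
    using N(1) group_measurable[OF assms(1)] distr_group[OF assms(1)] emeasure_distr[OF group_measurable[OF assms(1)], of N]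
    by (auto simp: null_sets_def simp del: sets_\<nu> space_\<nu>)
  moreover have "w x \<in> space \<nu>" if "x \<in> space \<nu>" for x
    using group_measurable[OF assms(1)] that by (auto simp: measurable_def)
  ultimately show ?thesis using N(2) by (intro AE_I') auto
qed

definition invariant :: "(real ^ 'd \<Rightarrow> real) \<Rightarrow> bool" where
  "invariant u \<longleftrightarrow> (\<forall>v\<in>Rp. AE x in \<nu>. u (reflection v x) = u x)"

lemma invariant_group:
  assumes "invariant u" "w \<in> G" shows "AE x in \<nu>. u (w x) = u x"
  using assms(2)
proof (induction rule: reflection_group.induct)
  case (step w v)
  have "AE x in \<nu>. u (w (reflection v x)) = u (reflection v x)"
    by (rule AE_group[OF reflection_in_group[OF step.hyps(2)] step.IH])
  moreover have "AE x in \<nu>. u (reflection v x) = u x" using assms(1) step.hyps(2) by (auto simp: invariant_def)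
  ultimately show ?case by eventually_elim simp
qed simp

lemma finite_G: "finite G" and card_G: "card G > 0"
  using finite_reflection_group[OF prs] reflection_group.one[of Rp] by (auto simp: card_gt_0_iff)

text \<open>The Reynolds operator, the projection onto invariant functions; finiteness of the group
  makes the division meaningful.\<close>

definition average :: "(real ^ 'd \<Rightarrow> real) \<Rightarrow> real ^ 'd \<Rightarrow> real" where
  "average p x = (\<Sum>w\<in>G. p (w x)) / card G"

lemma average_reflection:
  assumes "v \<in> Rp" shows "average p (reflection v x) = average p x"
proof -
  have "(\<Sum>w\<in>G. p (w (reflection v x))) = (\<Sum>w\<in>G. p (w x))"
    by (rule sum.reindex_bij_witness[of _ "\<lambda>w. w \<circ> reflection v" "\<lambda>w. w \<circ> reflection v"])
       (auto simp: fun_eq_iff intro: reflection_group.step assms)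
  then show ?thesis by (simp add: average_def)
qed

lemma poly_below_group: "w \<in> G \<Longrightarrow> poly_below n p \<Longrightarrow> poly_below n (\<lambda>x. p (w x))"
proof (induction arbitrary: p rule: reflection_group.induct)
  case (step w v)
  from poly_below_reflection[OF step.IH[OF step.prems]] show ?case by simp
qed simp

lemma poly_below_average: "poly_below n p \<Longrightarrow> poly_below n (average p)"
  using poly_below_cmult[OF poly_below_sum[of G n "\<lambda>w x. p (w x)"], of "inverse (real (card G))"]
  by (simp add: average_def[abs_def] poly_below_group divide_inverse mult.commute)

text \<open>For invariant \<open>u\<close> the error of the average is the average of the
  transformed errors, so convexity of the square and invariance of the measure give the
  bound.\<close>

lemma integral_square_average_le:
  assumes u: "square_integrable u" "invariant u" and p: "square_integrable p"
  shows "(LINT x|\<nu>. (u x - average p x)\<^sup>2) \<le> (LINT x|\<nu>. (u x - p x)\<^sup>2)"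
proof -
  let ?c = "real (card G)"
  have d: "square_integrable (\<lambda>x. u x - p x)" using square_integrable_diff[OF u(1) p] .
  have di: "integrable \<nu> (\<lambda>x. (u (w x) - p (w x))\<^sup>2)" if "w \<in> G" for w
    using integrable_group[OF that, of "\<lambda>x. (u x - p x)\<^sup>2"] d by (simp add: square_integrable_def)
  have i: "integrable \<nu> (\<lambda>x. (\<Sum>w\<in>G. (u (w x) - p (w x))\<^sup>2) / ?c)"
    by (intro integrable_divide Bochner_Integration.integrable_sum di)
  have "AE x in \<nu>. \<forall>w\<in>G. u (w x) = u x"
    using invariant_group[OF u(2)] finite_G by (intro AE_finite_allI) auto
  then have ae: "AE x in \<nu>. (u x - average p x)\<^sup>2 \<le> (\<Sum>w\<in>G. (u (w x) - p (w x))\<^sup>2) / ?c"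
  proof eventually_elim
    case (elim x)
    have "u x - average p x = (\<Sum>w\<in>G. u (w x) - p (w x)) / ?c"
      using card_G elim by (simp add: average_def sum_subtractf diff_divide_distrib)
    then have "(u x - average p x)\<^sup>2 = (\<Sum>w\<in>G. u (w x) - p (w x))\<^sup>2 / ?c\<^sup>2"
      by (simp add: power_divide)
    also have "\<dots> \<le> ((\<Sum>w\<in>G. (u (w x) - p (w x))\<^sup>2) * ?c) / ?c\<^sup>2"
      by (intro divide_right_mono sum_squared_le_sum_of_squares) simp
    also have "\<dots> = (\<Sum>w\<in>G. (u (w x) - p (w x))\<^sup>2) / ?c" by (simp add: power2_eq_square)
    finally show ?case .
  qed
  have "(LINT x|\<nu>. (u x - average p x)\<^sup>2) \<le> (LINT x|\<nu>. (\<Sum>w\<in>G. (u (w x) - p (w x))\<^sup>2) / ?c)"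
  proof (rule integral_mono_AE'[OF i ae])
    show "AE x in \<nu>. 0 \<le> (\<Sum>w\<in>G. (u (w x) - p (w x))\<^sup>2) / ?c"
      by (intro AE_I2 divide_nonneg_nonneg sum_nonneg) auto
  qed
  also have "\<dots> = (\<Sum>w\<in>G. LINT x|\<nu>. (u (w x) - p (w x))\<^sup>2) / ?c"
    by (simp add: Bochner_Integration.integral_sum di)
  also have "\<dots> = (\<Sum>w\<in>G. LINT x|\<nu>. (u x - p x)\<^sup>2) / ?c"
    using integral_group[of _ "\<lambda>x. (u x - p x)\<^sup>2"] d
    by (intro arg_cong2[where f = "(/)"] sum.cong) (auto simp: square_integrable_def)
  also have "\<dots> = (LINT x|\<nu>. (u x - p x)\<^sup>2)" using card_G by simp
  finally show ?thesis .
qed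

section \<open>Density of invariant polynomials\<close>

lemma clamp_approx:
  assumes u: "square_integrable u" and "e > 0"
  shows "\<exists>m>0. (LINT x|\<nu>. (u x - max (- m) (min m (u x)))\<^sup>2) < e"
proof -
  have [measurable]: "u \<in> borel_measurable \<nu>" using u by (simp add: square_integrable_def)
  have "(\<lambda>n. LINT x|\<nu>. (u x - max (- real n) (min (real n) (u x)))\<^sup>2) \<longlonglongrightarrow> (LINT x|\<nu>. 0)"
  proof (rule integral_dominated_convergence[where w = "\<lambda>x. (u x)\<^sup>2"])
    show "integrable \<nu> (\<lambda>x. (u x)\<^sup>2)" using u by (simp add: square_integrable_def)
    show "AE x in \<nu>. (\<lambda>n. (u x - max (- real n) (min (real n) (u x)))\<^sup>2) \<longlonglongrightarrow> 0"
    proof (rule AE_I2)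
      fix x
      obtain N :: nat where "\<bar>u x\<bar> \<le> real N" using real_arch_simple by blast
      then have "\<forall>\<^sub>F n in sequentially. (u x - max (- real n) (min (real n) (u x)))\<^sup>2 = 0"
        by (intro eventually_sequentiallyI[of N]) auto
      then show "(\<lambda>n. (u x - max (- real n) (min (real n) (u x)))\<^sup>2) \<longlonglongrightarrow> 0" by (rule tendsto_eventually)
    qed
    show "AE x in \<nu>. norm ((u x - max (- real n) (min (real n) (u x)))\<^sup>2) \<le> (u x)\<^sup>2" for n
      by (rule AE_I2) (auto simp: power2_le_iff_abs_le abs_le_square_iff[symmetric])
  qed auto
  then have "\<forall>\<^sub>F n in sequentially. (LINT x|\<nu>. (u x - max (- real n) (min (real n) (u x)))\<^sup>2) < e"
    using \<open>e > 0\<close> by (intro order_tendstoD(2)) auto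
  moreover have "\<forall>\<^sub>F n in sequentially. 0 < n" by (rule eventually_gt_at_top)
  ultimately have "\<forall>\<^sub>F n in sequentially. 0 < n \<and> (LINT x|\<nu>. (u x - max (- real n) (min (real n) (u x)))\<^sup>2) < e"
    by eventually_elim simp
  then obtain n where "0 < n" "(LINT x|\<nu>. (u x - max (- real n) (min (real n) (u x)))\<^sup>2) < e"
    using eventually_happens'[OF sequentially_bot] by blast
  then show ?thesis by (intro exI[of _ "real n"]) auto
qed

text \<open>Measurability in the form \<open>measurable_on\<close> supplies continuous functions
  converging almost everywhere; clamping them at the bound of \<open>v\<close> yields a constant
  dominating function.\<close>

lemma bounded_continuous_approx:
  fixes v :: "real ^ 'd \<Rightarrow> real"
  assumes v: "v \<in> borel_measurable unit_ball" and m: "m > 0" "\<And>x. \<bar>v x\<bar> \<le> m" and "e > 0"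
  shows "\<exists>h. continuous_on UNIV h \<and> (LINT x|\<nu>. (v x - h x)\<^sup>2) < e"
proof -
  have "v measurable_on cball 0 1" using v by (subst measurable_on_iff_borel_measurable) auto
  then obtain N g where N: "negligible N" and g: "\<And>n. continuous_on UNIV (g n)"
    "\<And>x. x \<notin> N \<Longrightarrow> (\<lambda>n. g n x) \<longlonglongrightarrow> (if x \<in> cball 0 1 then v x else 0)"
    unfolding measurable_on_def by blast
  define h where "h n x = max (- m) (min m (g n x))" for n x
  have h: "continuous_on UNIV (h n)" for n unfolding h_def by (intro continuous_intros g)
  have hm: "\<bar>h n x\<bar> \<le> m" for n x using m(1) by (auto simp: h_def)
  have [measurable]: "v \<in> borel_measurable \<nu>" "\<And>n. h n \<in> borel_measurable \<nu>"
    using v continuous_imp_\<nu>[OF h] by auto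
  have "(\<lambda>n. LINT x|\<nu>. (v x - h n x)\<^sup>2) \<longlonglongrightarrow> (LINT x|\<nu>. 0)"
  proof (rule integral_dominated_convergence[where w = "\<lambda>x. (2 * m)\<^sup>2"])
    have "AE x in lebesgue. x \<notin> N" using N by (intro AE_not_in) (simp add: negligible_iff_null_sets)
    then have "AE x in unit_ball. x \<notin> N" by (subst AE_restrict_space_iff) (auto elim: eventually_mono)
    moreover have "AE x in unit_ball. x \<in> cball 0 1" using AE_space[of "unit_ball"] by simp
    ultimately have "AE x in unit_ball. (\<lambda>n. (v x - h n x)\<^sup>2) \<longlonglongrightarrow> 0"
    proof eventually_elim
      case (elim x)
      have "(\<lambda>n. g n x) \<longlonglongrightarrow> v x" using g(2)[OF elim(1)] elim(2) by simp
      then have "(\<lambda>n. (v x - h n x)\<^sup>2) \<longlonglongrightarrow> (v x - max (- m) (min m (v x)))\<^sup>2"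
        unfolding h_def by (intro tendsto_intros)
      moreover have "max (- m) (min m (v x)) = v x" using m(2)[of x] by auto
      ultimately show ?case by simp
    qed
    then show "AE x in \<nu>. (\<lambda>n. (v x - h n x)\<^sup>2) \<longlonglongrightarrow> 0" by (rule AE_\<nu>)
    show "AE x in \<nu>. norm ((v x - h n x)\<^sup>2) \<le> (2 * m)\<^sup>2" for n
    proof (rule AE_I2)
      fix x
      have "\<bar>v x - h n x\<bar> \<le> \<bar>2 * m\<bar>" using m(1) m(2)[of x] hm[of n x] by linarith
      then show "norm ((v x - h n x)\<^sup>2) \<le> (2 * m)\<^sup>2" by (simp add: abs_le_square_iff)
    qed
  qed auto
  then have "\<forall>\<^sub>F n in sequentially. (LINT x|\<nu>. (v x - h n x)\<^sup>2) < e"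
    using \<open>e > 0\<close> by (intro order_tendstoD(2)) auto
  then show ?thesis using h eventually_happens'[OF sequentially_bot] by blast
qed

lemma continuous_polynomial_approx:
  assumes h: "continuous_on UNIV h" and "e > 0"
  shows "\<exists>n p. poly_below n p \<and> (LINT x|\<nu>. (h x - p x)\<^sup>2) < e"
proof -
  \<comment> \<open>The summand 1 keeps \<open>M\<close> positive; \<open>d\<close> is such that a
    uniform error of \<open>d\<close> costs at most \<open>e / 2\<close> in the integral.\<close>
  define M where "M = measure \<nu> (space \<nu>) + 1"
  have M: "M > 0" by (simp add: M_def add_nonneg_pos)
  define d where "d = sqrt (e / (2 * M))"
  have d: "d > 0" "d\<^sup>2 = e / (2 * M)" using M \<open>e > 0\<close> by (simp_all add: d_def)
  obtain p where p: "real_polynomial_function p" "\<And>x. x \<in> cball 0 1 \<Longrightarrow> \<bar>h x - p x\<bar> < d"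
    using Stone_Weierstrass_real_polynomial_function[OF compact_cball continuous_on_subset[OF h] d(1)] by blast
  obtain n where n: "poly_below n p" using poly_below_real_polynomial_function[OF p(1)] ..
  have "square_integrable (\<lambda>x. h x - p x)"
    by (intro square_integrable_diff square_integrable_continuous h poly_below_continuous[OF n])
  then have "(LINT x|\<nu>. (h x - p x)\<^sup>2) \<le> (LINT x|\<nu>. d\<^sup>2)"
  proof (intro integral_mono_AE AE_I2)
    fix x assume "x \<in> space \<nu>"
    then have "\<bar>h x - p x\<bar> \<le> \<bar>d\<bar>" using p(2)[of x] d(1) by simp
    then show "(h x - p x)\<^sup>2 \<le> d\<^sup>2" by (simp add: abs_le_square_iff)
  qed (auto simp: square_integrable_def)
  also have "\<dots> = measure \<nu> (space \<nu>) * (e / (2 * M))" by (simp add: d)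
  also have "\<dots> \<le> M * (e / (2 * M))"
    using M \<open>e > 0\<close> by (intro mult_right_mono) (auto simp: M_def)
  also have "\<dots> < e" using M \<open>e > 0\<close> by simp
  finally show ?thesis using n by blast
qed

lemma integral_square_triangle:
  assumes "square_integrable a" "square_integrable b" "square_integrable c"
  shows "(LINT x|\<nu>. (a x - c x)\<^sup>2) \<le> 2 * (LINT x|\<nu>. (a x - b x)\<^sup>2) + 2 * (LINT x|\<nu>. (b x - c x)\<^sup>2)"
proof -
  have *: "(p - r)\<^sup>2 \<le> 2 * (p - q)\<^sup>2 + 2 * (q - r)\<^sup>2" for p q r :: real
    using zero_le_power2[of "p - 2 * q + r"] by (simp add: power2_eq_square algebra_simps)
  have i: "integrable \<nu> (\<lambda>x. (a x - c x)\<^sup>2)" "integrable \<nu> (\<lambda>x. (a x - b x)\<^sup>2)" "integrable \<nu> (\<lambda>x. (b x - c x)\<^sup>2)"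
    using square_integrable_diff assms unfolding square_integrable_def by blast+
  have "(LINT x|\<nu>. (a x - c x)\<^sup>2) \<le> (LINT x|\<nu>. 2 * (a x - b x)\<^sup>2 + 2 * (b x - c x)\<^sup>2)"
    by (intro integral_mono Bochner_Integration.integrable_add integrable_mult_right i *)
  also have "\<dots> = 2 * (LINT x|\<nu>. (a x - b x)\<^sup>2) + 2 * (LINT x|\<nu>. (b x - c x)\<^sup>2)"
    using i by simp
  finally show ?thesis .
qed

definition invariant_poly :: "nat \<Rightarrow> (real ^ 'd \<Rightarrow> real) \<Rightarrow> bool" where
  "invariant_poly n p \<longleftrightarrow> poly_below n p \<and> (\<forall>v\<in>Rp. \<forall>x. p (reflection v x) = p x)"

lemma invariant_poly_dense:
  assumes u: "square_integrable u" "invariant u" and e: "e > 0"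
  shows "\<exists>n p. invariant_poly n p \<and> (LINT x|\<nu>. (u x - p x)\<^sup>2) < e"
proof -
  \<comment> \<open>Truncation, continuous and polynomial approximation each err by less than
    \<open>e'\<close>; two uses of \<open>integral_square_triangle\<close> weight them by 2, 4 and
    4, in total 10.\<close>
  define e' where "e' = e / 10"
  have e': "e' > 0" using e by (simp add: e'_def)
  have [measurable]: "u \<in> borel_measurable \<nu>" using u by (simp add: square_integrable_def)
  obtain m where m: "m > 0" "(LINT x|\<nu>. (u x - max (- m) (min m (u x)))\<^sup>2) < e'"
    using clamp_approx[OF u(1) e'] by blast
  define v where "v x = max (- m) (min m (u x))" for x
  have vm: "v \<in> borel_measurable \<nu>" "\<And>x. \<bar>v x\<bar> \<le> m"
    using m(1) unfolding v_def[abs_def] by (measurable, auto)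
  have vs: "square_integrable v"
    unfolding square_integrable_def
  proof
    show "integrable \<nu> (\<lambda>x. (v x)\<^sup>2)"
      by (rule integrable_bounded[where B = "m\<^sup>2"]) (use vm m(1) in \<open>auto simp: abs_le_square_iff[symmetric]\<close>)
  qed (rule vm)
  obtain h where h: "continuous_on UNIV h" "(LINT x|\<nu>. (v x - h x)\<^sup>2) < e'"
    using bounded_continuous_approx[OF _ m(1) _ e', of v] vm by auto
  obtain n p where p: "poly_below n p" "(LINT x|\<nu>. (h x - p x)\<^sup>2) < e'"
    using continuous_polynomial_approx[OF h(1) e'] by blast
  note hs = square_integrable_continuous[OF h(1)] and ps = poly_below_square_integrable[OF p(1)]
  have "(LINT x|\<nu>. (u x - average p x)\<^sup>2) \<le> (LINT x|\<nu>. (u x - p x)\<^sup>2)"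
    by (rule integral_square_average_le[OF u ps])
  also have "\<dots> \<le> 2 * (LINT x|\<nu>. (u x - v x)\<^sup>2) + 2 * (LINT x|\<nu>. (v x - p x)\<^sup>2)"
    by (rule integral_square_triangle[OF u(1) vs ps])
  also have "\<dots> \<le> 2 * (LINT x|\<nu>. (u x - v x)\<^sup>2) + 2 * (2 * (LINT x|\<nu>. (v x - h x)\<^sup>2) + 2 * (LINT x|\<nu>. (h x - p x)\<^sup>2))"
    using integral_square_triangle[OF vs hs ps] by simp
  also have "\<dots> < 10 * e'" using m(2) h(2) p(2) by (simp add: v_def)
  finally have "(LINT x|\<nu>. (u x - average p x)\<^sup>2) < 10 * e'" .
  moreover have "invariant_poly n (average p)"
    using poly_below_average[OF p(1)] average_reflection by (auto simp: invariant_poly_def)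
  ultimately show ?thesis unfolding e'_def by auto
qed

end

section \<open>The Dunkl operator\<close>

text \<open>The carre du champ \<open>\<langle>a, b\<rangle> - \<langle>x, a\<rangle>\<langle>x, b\<rangle>\<close> is \<open>(1 - |x|\<^sup>2)\<langle>a, b\<rangle>\<close> plus the sum over \<open>i < j\<close> of the
  products of \<open>x\<^sub>i a\<^sub>j - x\<^sub>j a\<^sub>i\<close> and \<open>x\<^sub>i b\<^sub>j - x\<^sub>j b\<^sub>i\<close>.\<close>

definition \<Gamma> :: "'a::real_inner \<Rightarrow> 'a \<Rightarrow> 'a \<Rightarrow> real" where
  "\<Gamma> x a b = a \<bullet> b - (x \<bullet> a) * (x \<bullet> b)"

lemma \<Gamma>_commute: "\<Gamma> x a b = \<Gamma> x b a"
  by (simp add: \<Gamma>_def inner_commute)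

lemma \<Gamma>_diff_left: "\<Gamma> x (a - b) c = \<Gamma> x a c - \<Gamma> x b c"
  and \<Gamma>_diff_right: "\<Gamma> x c (a - b) = \<Gamma> x c a - \<Gamma> x c b"
  and \<Gamma>_scaleR_left: "\<Gamma> x (r *\<^sub>R a) c = r * \<Gamma> x a c"
  and \<Gamma>_scaleR_right: "\<Gamma> x c (r *\<^sub>R a) = r * \<Gamma> x c a"
  by (simp_all add: \<Gamma>_def inner_add_left inner_add_right inner_diff_left inner_diff_right algebra_simps)

lemma \<Gamma>_nonneg: "norm x \<le> 1 \<Longrightarrow> 0 \<le> \<Gamma> x a a"
proof -
  assume "norm x \<le> 1"
  then have "\<bar>x \<bullet> a\<bar> \<le> \<bar>norm a\<bar>"
    using Cauchy_Schwarz_ineq2[of x a] mult_right_mono[of "norm x" 1 "norm a"] by simp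
  then have "(x \<bullet> a)\<^sup>2 \<le> (norm a)\<^sup>2" by (simp only: abs_le_square_iff)
  then show ?thesis by (simp add: \<Gamma>_def power2_eq_square flip: power2_norm_eq_inner)
qed

lemma \<Gamma>_abs_le: "norm x \<le> 1 \<Longrightarrow> \<bar>\<Gamma> x a b\<bar> \<le> 2 * (norm a * norm b)"
proof -
  assume x: "norm x \<le> 1"
  have "\<bar>x \<bullet> c\<bar> \<le> norm c" for c
    using Cauchy_Schwarz_ineq2[of x c] mult_right_mono[OF x, of "norm c"] by simp
  then have "\<bar>(x \<bullet> a) * (x \<bullet> b)\<bar> \<le> norm a * norm b" unfolding abs_mult by (intro mult_mono) auto
  moreover have "\<bar>a \<bullet> b\<bar> \<le> norm a * norm b" by (rule Cauchy_Schwarz_ineq2)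
  ultimately show ?thesis unfolding \<Gamma>_def by linarith
qed

section \<open>Integration by parts against the weight\<close>

context dunkl_ball
begin

abbreviation lam where "lam \<equiv> lambda_const Rp \<kappa> \<mu>"

lemma lam_nonneg: "0 \<le> lam"
proof -
  have "0 \<le> sum \<kappa> Rp" using mult by (intro sum_nonneg) (auto simp: multiplicity_function_def)
  moreover have "real CARD('d) \<ge> 1" by (simp add: Suc_leI)
  ultimately show ?thesis using mu by (simp add: lambda_const_def)
qed

text \<open>The open chambers inside the ball. Here the weight is continuous and positive, so
  \<open>U\<close> lies in the regular set and has full measure in the ball.\<close>

definition U :: "(real ^ 'd) set" where
  "U = {x. norm x < 1 \<and> (\<forall>v\<in>Rp. x \<bullet> v \<noteq> 0)}"

text \<open>Derivatives are tested only inside the chambers, so nothing is said about the behaviour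
  of \<open>u\<close> across a hyperplane.\<close>

definition sobolev :: "(real ^ 'd \<Rightarrow> real) \<Rightarrow> (real ^ 'd \<Rightarrow> real ^ 'd) \<Rightarrow> bool" where
  "sobolev u g \<longleftrightarrow> square_integrable u \<and> g \<in> borel_measurable \<nu> \<and> square_integrable (\<lambda>x. norm (g x)) \<and>
     weak_gradient U u g"

lemma finite_Rp: "finite Rp" and nonzero_Rp: "v \<in> Rp \<Longrightarrow> v \<noteq> 0"
  using prs by (auto simp: positive_root_system_def root_system_def)

lemma AE_U: "AE x in unit_ball. x \<in> U"
proof -
  have "AE x in lebesgue. x \<notin> sphere 0 1"
    by (intro AE_not_in) (simp flip: negligible_iff_null_sets add: negligible_sphere)
  moreover have "AE x in lebesgue. \<forall>v\<in>Rp. x \<notin> {x. v \<bullet> x = 0}"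
    by (intro AE_finite_allI finite_Rp AE_not_in)
       (simp flip: negligible_iff_null_sets add: negligible_hyperplane nonzero_Rp)
  ultimately have "AE x in lebesgue. x \<in> cball 0 1 \<longrightarrow> x \<in> U"
    by eventually_elim (auto simp: U_def inner_commute)
  then show ?thesis by (subst AE_restrict_space_iff) auto
qed

text \<open>\<open>None\<close> stands for the sphere and \<open>Some v\<close> for the hyperplane
  orthogonal to \<open>v\<close>. Squaring the linear form makes every wall function positive
  exactly on its good side and accounts for the square of \<open>h_weight\<close>, so the exponent
  is \<open>\<kappa> v\<close> itself.\<close>

fun wall :: "(real ^ 'd) option \<Rightarrow> real ^ 'd \<Rightarrow> real" where
  "wall None x = 1 - x \<bullet> x"
| "wall (Some v) x = (x \<bullet> v)\<^sup>2"

fun wall_grad :: "(real ^ 'd) option \<Rightarrow> real ^ 'd \<Rightarrow> real ^ 'd" where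
  "wall_grad None x = (- 2) *\<^sub>R x"
| "wall_grad (Some v) x = (2 * (x \<bullet> v)) *\<^sub>R v"

fun wall_exponent :: "(real ^ 'd) option \<Rightarrow> real" where
  "wall_exponent None = \<mu> - 1 / 2"
| "wall_exponent (Some v) = \<kappa> v"

lemma wall_abs: "wall None = (\<lambda>x. 1 - x \<bullet> x)" "wall (Some v) = (\<lambda>x. (x \<bullet> v)\<^sup>2)"
  "wall_grad None = (\<lambda>x. (- 2) *\<^sub>R x)" "wall_grad (Some v) = (\<lambda>x. (2 * (x \<bullet> v)) *\<^sub>R v)"
  by (simp_all add: fun_eq_iff)

abbreviation walls where "walls \<equiv> insert None (Some ` Rp)"

lemma wall_pos: "{x. \<forall>i\<in>walls. 0 < wall i x} = U"
  by (auto simp: U_def abs_square_less_1 power2_norm_eq_inner[symmetric])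

lemma wall_weight: "(\<Prod>i\<in>walls. wall i x powr wall_exponent i) = W x"
proof -
  have "(y\<^sup>2) powr k = (\<bar>y\<bar> powr k)\<^sup>2" for y k :: real
    using powr_mult[of "\<bar>y\<bar>" "\<bar>y\<bar>" k] by (simp add: power2_eq_square)
  then have "(\<Prod>i\<in>Some ` Rp. wall i x powr wall_exponent i) = (\<Prod>v\<in>Rp. (\<bar>x \<bullet> v\<bar> powr \<kappa> v)\<^sup>2)"
    by (simp add: prod.reindex)
  then show ?thesis
    using finite_Rp by (simp add: W_weight_def h_weight_def prod_power_distrib power2_norm_eq_inner)
qed

text \<open>The field \<open>Z\<close> below has
  \<open>Z x \<bullet> g x = \<Gamma> x (P x) (g x)\<close> and is adapted to all walls: to the
  sphere since \<open>Z x \<bullet> x = (1 - x \<bullet> x) * (x \<bullet> P x)\<close>, to the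
  hyperplanes by the divisibility expressed through \<open>q\<close>. When \<open>P\<close> is the
  gradient of an invariant polynomial, the bracket on the left is the operator \<open>L\<close>
  applied to it.\<close>

lemma weak_dunkl_laplacian:
  fixes p :: "real ^ 'd \<Rightarrow> real"
  assumes sob: "sobolev u g"
    and P: "\<And>j x. GDERIV (\<lambda>x. P x $ j) x :> H j x" "\<And>j. continuous_on UNIV (H j)"
    and E: "\<And>x. GDERIV (\<lambda>x. x \<bullet> P x) x :> E x" "continuous_on UNIV E"
    and q: "\<And>v x. v \<in> Rp \<Longrightarrow> P x \<bullet> v = (x \<bullet> v) * q v x" "\<And>v. v \<in> Rp \<Longrightarrow> continuous_on UNIV (q v)"
  shows "(LINT x|\<nu>. ((\<Sum>j\<in>UNIV. H j x $ j) + 2 * (\<Sum>v\<in>Rp. \<kappa> v * q v x) - x \<bullet> E x - 2 * lam * (x \<bullet> P x)) * u x) =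
    - (LINT x|\<nu>. \<Gamma> x (P x) (g x))"
proof -
  define Z where "Z x = P x - (x \<bullet> P x) *\<^sub>R x" for x
  define dZ where "dZ j x = H j x - ((x \<bullet> P x) *\<^sub>R axis j 1 + (x $ j) *\<^sub>R E x)" for j x
  define s where "s i x = (case i of None \<Rightarrow> - 2 * (x \<bullet> P x) | Some v \<Rightarrow> 2 * (q v x - x \<bullet> P x))" for i x
  have contxP: "continuous_on UNIV (\<lambda>x. x \<bullet> P x)" by (rule GDERIV_continuous_on[OF E(1)])
  have grad: "GDERIV (\<lambda>x. x \<bullet> v) x :> v" for x v :: "real ^ 'd"
    unfolding gderiv_def by (auto intro!: derivative_eq_intros)
  interpret adapted_field walls wall wall_grad wall_exponent s Z dZ
  proof
    show "finite walls" using finite_Rp by simp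
    show "GDERIV (wall i) x :> wall_grad i x" for i x
    proof (cases i)
      case None
      have "((\<lambda>x. 1 - x \<bullet> x) has_derivative (\<lambda>h. h \<bullet> (- 2) *\<^sub>R x)) (at x)"
        by (auto intro!: derivative_eq_intros simp: inner_commute)
      then show ?thesis using None by (simp add: gderiv_def wall_abs)
    next
      case (Some v)
      have "((\<lambda>x. (x \<bullet> v)\<^sup>2) has_derivative (\<lambda>h. h \<bullet> (2 * (x \<bullet> v)) *\<^sub>R v)) (at x)"
        by (auto intro!: derivative_eq_intros)
      then show ?thesis using Some by (simp add: gderiv_def wall_abs)
    qed
    show "continuous_on UNIV (wall_grad i)" for i
      by (cases i) (auto simp: wall_abs intro!: continuous_intros)
    show "GDERIV (\<lambda>x. Z x $ j) x :> dZ j x" for j x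
    proof -
      have "GDERIV (\<lambda>x. x $ j) x :> axis j 1"
        using grad[of "axis j 1" x] by (simp add: inner_axis)
      from GDERIV_diff[OF P(1) GDERIV_mult[OF E(1) this]]
      show ?thesis by (simp add: Z_def dZ_def)
    qed
    show "continuous_on UNIV (dZ j)" for j
      unfolding dZ_def by (intro continuous_intros P(2) E(2) contxP)
    show "Z x \<bullet> wall_grad i x = wall i x * s i x" if "i \<in> walls" for i x
    proof (cases i)
      case None
      then show ?thesis by (simp add: Z_def s_def inner_commute algebra_simps)
    next
      case (Some v)
      then have "v \<in> Rp" using that by auto
      then show ?thesis using q(1)[of v x] Some
        by (simp add: Z_def s_def inner_diff_left power2_eq_square algebra_simps)
    qed
    show "continuous_on UNIV (s i)" if "i \<in> walls" for i
      using that by (cases i) (auto simp: s_def intro!: continuous_intros contxP q(2))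
    show "{x. \<forall>i\<in>walls. 0 < wall i x} \<subseteq> cball 0 1" unfolding wall_pos by (auto simp: U_def)
  qed
  have weight: "weight x = W x" for x unfolding weight_def by (rule wall_weight)
  have su: "square_integrable u" and gm: "g \<in> borel_measurable unit_ball" and sg: "square_integrable (\<lambda>x. norm (g x))"
    and w: "weak_gradient U u g" using sob by (simp_all add: sobolev_def)
  have um: "u \<in> borel_measurable unit_ball" using su by (simp add: square_integrable_def)
  \<comment> \<open>To the coefficient of \<open>x \<bullet> P x\<close> the radial part of
    \<open>Z\<close> contributes \<open>- CARD('d)\<close>, the sphere
    \<open>- (2 * \<mu> - 1)\<close> and the hyperplanes \<open>- 2 * sum \<kappa> Rp\<close>,
    altogether \<open>- 2 * lam\<close>.\<close>
  have div: "divergence x + (\<Sum>i\<in>walls. wall_exponent i * s i x) =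
     (\<Sum>j\<in>UNIV. H j x $ j) + 2 * (\<Sum>v\<in>Rp. \<kappa> v * q v x) - x \<bullet> E x - 2 * lam * (x \<bullet> P x)" (is "_ = ?L x") for x
  proof -
    have "divergence x = (\<Sum>j\<in>UNIV. H j x $ j) - real CARD('d) * (x \<bullet> P x) - x \<bullet> E x"
      by (simp add: divergence_def dZ_def sum_subtractf sum.distrib inner_vec_def)
    moreover have "(\<Sum>i\<in>walls. wall_exponent i * s i x) =
        - (2 * \<mu> - 1) * (x \<bullet> P x) + (2 * (\<Sum>v\<in>Rp. \<kappa> v * q v x) - 2 * (\<Sum>v\<in>Rp. \<kappa> v) * (x \<bullet> P x))"
      using finite_Rp
      by (simp add: s_def sum.reindex right_diff_distrib sum_subtractf sum_distrib_left sum_distrib_right algebra_simps)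
    moreover have "2 * lam = 2 * sum \<kappa> Rp + 2 * \<mu> + real CARD('d) - 1"
      by (simp add: lambda_const_def field_simps)
    then have "2 * lam * (x \<bullet> P x) = (2 * sum \<kappa> Rp + 2 * \<mu> + real CARD('d) - 1) * (x \<bullet> P x)" by simp
    ultimately show ?thesis by (simp add: algebra_simps)
  qed
  have "(LINT x|unit_ball. (weight x * (divergence x + (\<Sum>i\<in>walls. wall_exponent i * s i x))) * u x) =
    - (LINT x|unit_ball. weight x * (Z x \<bullet> g x))"
  proof (rule weak_gradient_divergence)
    show "weak_gradient {x. \<forall>i\<in>walls. 0 < wall i x} u g" using w unfolding wall_pos .
    show "integrable unit_ball (\<lambda>x. weight x * u x)"
      using square_integrable_imp_integrable[OF su] um by (simp add: integrable_\<nu>_iff weight)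
    show "integrable unit_ball (\<lambda>x. weight x * norm (g x))"
      using square_integrable_imp_integrable[OF sg] gm by (simp add: integrable_\<nu>_iff weight)
    show "AE x in unit_ball. \<forall>i\<in>walls. 0 < wall i x"
      using AE_U wall_pos by (auto elim!: eventually_mono)
  qed (use um gm in auto)
  then have "(LINT x|unit_ball. W x * (?L x * u x)) = - (LINT x|unit_ball. W x * \<Gamma> x (P x) (g x))"
    unfolding div weight
    by (simp add: Z_def \<Gamma>_def inner_diff_left mult.assoc)
  moreover have "(\<lambda>x. ?L x * u x) \<in> borel_measurable unit_ball"
  proof -
    have "continuous_on UNIV ?L"
      by (intro continuous_intros P(2) q(2) E(2) contxP) auto
    then have "?L \<in> borel_measurable unit_ball" using continuous_imp_\<nu> by simp
    then show ?thesis using um by measurable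
  qed
  moreover have "(\<lambda>x. \<Gamma> x (P x) (g x)) \<in> borel_measurable unit_ball"
  proof -
    have "continuous_on UNIV P"
      using continuous_on_vec_lambda[of UNIV "\<lambda>j x. P x $ j"] GDERIV_continuous_on[OF P(1)] by simp
    then have "P \<in> borel_measurable unit_ball" using continuous_imp_\<nu> by simp
    moreover have "(\<lambda>x. x) \<in> borel_measurable (unit_ball :: (real ^ 'd) measure)" by (rule borel_measurable_unit_ball) simp
    ultimately show ?thesis using gm unfolding \<Gamma>_def by measurable
  qed
  ultimately show ?thesis by (simp add: integral_\<nu>)
qed

lemma sobolev_continuous:
  assumes "\<And>x. GDERIV q x :> Q x" "continuous_on UNIV Q"
  shows "sobolev q Q"
  unfolding sobolev_def
proof (intro conjI square_integrable_continuous continuous_imp_\<nu> continuous_intros assms(2))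
  show "continuous_on UNIV q" by (rule GDERIV_continuous_on[OF assms(1)])
  show "weak_gradient U q Q"
    by (rule weak_gradient_classical[OF assms]) (auto simp: U_def)
qed

text \<open>On polynomials of degree \<open>n\<close> the Dunkl operator acts as \<open>- n (n + 2 \<lambda>)\<close> up to terms of lower degree.\<close>

lemma dunkl_operator_poly:
  assumes p: "invariant_poly (Suc n) p" and P: "\<And>x. GDERIV p x :> P x"
  shows "\<exists>\<l>. poly_below n (\<lambda>x. \<l> x + real n * (real n + 2 * lam) * p x) \<and>
    (\<forall>u g. sobolev u g \<longrightarrow> (LINT x|\<nu>. \<l> x * u x) = - (LINT x|\<nu>. \<Gamma> x (P x) (g x)))"
proof -
  have pp: "poly_below (Suc n) p" and inv: "\<And>v x. v \<in> Rp \<Longrightarrow> p (reflection v x) = p x"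
    using p by (auto simp: invariant_poly_def)
  have Pn: "poly_below n (\<lambda>x. P x $ j)" for j using poly_below_gradient_nth[OF pp P, of j] by simp
  have Eu: "poly_below n (\<lambda>x. x \<bullet> P x - real n * p x)" using poly_below_euler[OF pp P] by simp
  have "\<forall>j. \<exists>H. \<forall>x. GDERIV (\<lambda>x. P x $ j) x :> H x" using poly_below_gradient[OF Pn] by blast
  then obtain H where H: "\<And>j x. GDERIV (\<lambda>x. P x $ j) x :> H j x" by metis
  have Hn: "poly_below n (\<lambda>x. H j x $ i)" for i j
    by (rule poly_below_mono[OF _ poly_below_gradient_nth[OF Pn H]]) simp
  have En: "poly_below (Suc n) (\<lambda>x. x \<bullet> P x)"
  proof -
    have "poly_below (Suc n) (\<lambda>x. (x \<bullet> P x - real n * p x) + real n * p x)"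
      by (intro poly_below.add poly_below_cmult pp poly_below_Suc[OF Eu])
    then show ?thesis by simp
  qed
  obtain E where E: "\<And>x. GDERIV (\<lambda>x. x \<bullet> P x) x :> E x" using poly_below_gradient[OF En] by blast
  have EE: "poly_below n (\<lambda>x. x \<bullet> E x - real n * (x \<bullet> P x))" using poly_below_euler[OF En E] by simp
  have "\<forall>v. \<exists>q. v \<in> Rp \<longrightarrow> poly_below (Suc n - 2) q \<and> (\<forall>x. P x \<bullet> v = (x \<bullet> v) * q x)"
    using poly_below_normal_derivative[OF pp P inv] by blast
  then obtain q where q: "\<And>v. v \<in> Rp \<Longrightarrow> poly_below (Suc n - 2) (q v)" "\<And>v x. v \<in> Rp \<Longrightarrow> P x \<bullet> v = (x \<bullet> v) * q v x"
    by metis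
  have qn: "poly_below n (q v)" if "v \<in> Rp" for v
    by (rule poly_below_mono[OF _ q(1)[OF that]]) simp
  define \<l> where "\<l> x = (\<Sum>j\<in>UNIV. H j x $ j) + 2 * (\<Sum>v\<in>Rp. \<kappa> v * q v x) - x \<bullet> E x - 2 * lam * (x \<bullet> P x)" for x
  \<comment> \<open>Second derivatives and the quotients \<open>q v\<close> lose two degrees.
    Euler's identity, first for \<open>x \<bullet> P x\<close> and then for \<open>p\<close>,
    reduces the other terms to \<open>- (real n + 2 * lam) * real n\<close> times \<open>p\<close>
    up to lower degree.\<close>
  have "poly_below n (\<lambda>x. ((\<Sum>j\<in>UNIV. H j x $ j) + 2 * (\<Sum>v\<in>Rp. \<kappa> v * q v x)) -
      ((x \<bullet> E x - real n * (x \<bullet> P x)) + (real n + 2 * lam) * (x \<bullet> P x - real n * p x)))"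
    by (intro poly_below.add poly_below_diff poly_below_cmult poly_below_sum Hn qn EE Eu)
  then have "poly_below n (\<lambda>x. \<l> x + real n * (real n + 2 * lam) * p x)"
    by (rule back_subst[of "poly_below n"]) (auto simp: \<l>_def fun_eq_iff algebra_simps)
  moreover have "(LINT x|\<nu>. \<l> x * u x) = - (LINT x|\<nu>. \<Gamma> x (P x) (g x))" if "sobolev u g" for u g
    unfolding \<l>_def
  proof (rule weak_dunkl_laplacian[OF that H _ E _ q(2)])
    show "continuous_on UNIV (H j)" for j
      using continuous_on_vec_lambda[of UNIV "\<lambda>i x. H j x $ i"] poly_below_continuous[OF Hn] by simp
    show "continuous_on UNIV E"
      using continuous_on_vec_lambda[of UNIV "\<lambda>i x. E x $ i"]
        poly_below_continuous[OF poly_below_gradient_nth[OF En E]] by simp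
    show "continuous_on UNIV (q v)" if "v \<in> Rp" for v using poly_below_continuous[OF qn[OF that]] .
  qed
  ultimately show ?thesis by blast
qed

end

section \<open>Poincare and uncertainty inequalities for Sobolev functions\<close>

inductive lin_span :: "('a \<Rightarrow> real) set \<Rightarrow> ('a \<Rightarrow> real) \<Rightarrow> bool" for B where
  zero: "lin_span B (\<lambda>x. 0)"
| step: "lin_span B p \<Longrightarrow> b \<in> B \<Longrightarrow> lin_span B (\<lambda>x. p x + c * b x)"

lemma lin_span_base: "b \<in> B \<Longrightarrow> lin_span B b"
  using lin_span.step[OF lin_span.zero, of b B 1] by simp

lemma lin_span_add: "lin_span B q \<Longrightarrow> lin_span B p \<Longrightarrow> lin_span B (\<lambda>x. p x + q x)"
proof (induction rule: lin_span.induct)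
  case (step q b c)
  from lin_span.step[OF step.IH[OF step.prems] step.hyps(2), of c] show ?case by (simp add: add.assoc)
qed simp

lemma lin_span_cmult: "lin_span B p \<Longrightarrow> lin_span B (\<lambda>x. c * p x)"
proof (induction rule: lin_span.induct)
  case (step q b d)
  from lin_span.step[OF step.IH step.hyps(2), of "c * d"] show ?case by (simp add: distrib_left mult.assoc)
qed (simp add: lin_span.zero)

lemma lin_span_mono: "lin_span B p \<Longrightarrow> B \<subseteq> C \<Longrightarrow> lin_span C p"
  by (induction rule: lin_span.induct) (auto intro: lin_span.intros)

lemma lin_span_image:
  assumes "lin_span B p" and T: "T (\<lambda>x. 0) = (\<lambda>x. 0)" "\<And>p q c. T (\<lambda>x. p x + c * q x) = (\<lambda>x. T p x + c * T q x)"
  shows "lin_span (T ` B) (T p)"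
  using assms(1)
proof (induction rule: lin_span.induct)
  case (step p b c)
  then show ?case unfolding T(2) by (intro lin_span.step) auto
qed (simp add: T lin_span.zero)

lemma poly_below_finite_span:
  "\<exists>B. finite B \<and> (\<forall>b\<in>B. poly_below n b) \<and> (\<forall>p :: real ^ 'd \<Rightarrow> real. poly_below n p \<longrightarrow> lin_span B p)"
proof (induction n)
  case 0
  have "lin_span {} p" if "poly_below 0 p" for p :: "real ^ 'd \<Rightarrow> real"
  proof -
    have "p = (\<lambda>x. 0)" using poly_below_0D[OF that] by blast
    then show ?thesis by (simp add: lin_span.zero)
  qed
  then show ?case by (intro exI[of _ "{}"]) auto
next
  case (Suc n)
  then obtain B :: "(real ^ 'd \<Rightarrow> real) set" where B: "finite B" "\<And>b. b \<in> B \<Longrightarrow> poly_below n b" "\<And>p. poly_below n p \<Longrightarrow> lin_span B p"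
    by blast
  define C where "C = insert (\<lambda>x. 1) (\<Union>i. (\<lambda>b x. x $ i * b x) ` B)"
  have "lin_span C p" if "poly_below m p" "m = Suc n" for p m
    using that
  proof (induction rule: poly_below.induct)
    case (const m c)
    show ?case using lin_span_cmult[OF lin_span_base[of "\<lambda>x. 1" C], of c] by (simp add: C_def)
  next
    case (coord m p i)
    then have "lin_span B p" using B(3) by simp
    then have "lin_span ((\<lambda>b x. x $ i * b x) ` B) (\<lambda>x. x $ i * p x)"
      by (rule lin_span_image[of B p "\<lambda>b x. x $ i * b x"]) (auto simp: algebra_simps)
    then show ?case by (rule lin_span_mono) (auto simp: C_def)
  qed (auto intro: lin_span.zero lin_span_add)
  moreover have "finite C" using B(1) by (simp add: C_def)
  moreover have "poly_below (Suc n) b" if "b \<in> C" for b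
    using that B(2) by (auto simp: C_def intro: poly_below.const poly_below.coord)
  ultimately show ?case by blast
qed

definition grad :: "('a::real_inner \<Rightarrow> real) \<Rightarrow> 'a \<Rightarrow> 'a" where
  "grad p x = (SOME D. GDERIV p x :> D)"

lemma GDERIV_grad: "GDERIV p x :> D \<Longrightarrow> GDERIV p x :> grad p x"
  unfolding grad_def by (rule someI)

lemma grad_eq: "GDERIV p x :> D \<Longrightarrow> grad p x = D"
  using GDERIV_grad GDERIV_unique by blast

lemma poly_below_GDERIV: "poly_below n p \<Longrightarrow> GDERIV p x :> grad p x"
  using poly_below_gradient GDERIV_grad by blast

lemma continuous_grad: assumes "poly_below n p" shows "continuous_on A (grad p)"
  using continuous_on_vec_lambda[of A "\<lambda>j x. grad p x $ j"]
    poly_below_continuous[OF poly_below_gradient_nth[OF assms poly_below_GDERIV[OF assms]]] by simp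

lemma poly_below_1_const: "poly_below n p \<Longrightarrow> n = Suc 0 \<Longrightarrow> \<exists>c. \<forall>x. p x = c"
proof (induction rule: poly_below.induct)
  case (coord n p i)
  then show ?case using poly_below_0D by fastforce
next
  case (add n p q)
  then obtain a b where "\<forall>x. p x = a" "\<forall>x. q x = b" by blast
  then show ?case by auto
qed auto

context dunkl_ball
begin

definition ip :: "(real ^ 'd \<Rightarrow> real) \<Rightarrow> (real ^ 'd \<Rightarrow> real) \<Rightarrow> real" where
  "ip u v = (LINT x|\<nu>. u x * v x)"

lemma ip_commute: "ip u v = ip v u"
  by (simp add: ip_def mult.commute)

lemma ip_add_left: "square_integrable u \<Longrightarrow> square_integrable v \<Longrightarrow> square_integrable w \<Longrightarrow>
    ip (\<lambda>x. u x + v x) w = ip u w + ip v w"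
  unfolding ip_def distrib_right by (intro Bochner_Integration.integral_add square_integrable_mult)

lemma ip_diff_left: "square_integrable u \<Longrightarrow> square_integrable v \<Longrightarrow> square_integrable w \<Longrightarrow>
    ip (\<lambda>x. u x - v x) w = ip u w - ip v w"
  unfolding ip_def left_diff_distrib by (intro Bochner_Integration.integral_diff square_integrable_mult)

lemma ip_cmult_left: "ip (\<lambda>x. c * u x) w = c * ip u w"
  unfolding ip_def mult.assoc by simp

lemma ip_nonneg: "0 \<le> ip u u"
  unfolding ip_def by (rule Bochner_Integration.integral_nonneg) auto

lemma ip_eq_0_imp:
  assumes "square_integrable u" "square_integrable v" "ip v v = 0"
  shows "ip u v = 0"
proof -
  have "AE x in \<nu>. v x * v x = 0"
    using assms(3) square_integrable_mult[OF assms(2,2)]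
    unfolding ip_def by (subst (asm) integral_nonneg_eq_0_iff_AE) auto
  then have "AE x in \<nu>. u x * v x = 0" by eventually_elim simp
  then show ?thesis unfolding ip_def using integral_cong_AE[of "\<lambda>x. u x * v x" \<nu> "\<lambda>x. 0"]
    assms(1,2) by (simp add: square_integrable_def integral_eq_zero_AE)
qed

lemma lin_span_square_integrable:
  "lin_span B p \<Longrightarrow> (\<And>b. b \<in> B \<Longrightarrow> square_integrable b) \<Longrightarrow> square_integrable p"
proof (induction rule: lin_span.induct)
  case zero
  show ?case by (rule square_integrable_continuous) simp
next
  case (step p b c)
  show ?case using step by (intro square_integrable_add[of p] square_integrable_cmult) auto
qed

lemma lin_span_orthogonal:
  assumes "lin_span B p" "\<And>b. b \<in> B \<Longrightarrow> square_integrable b" "square_integrable u" "\<And>b. b \<in> B \<Longrightarrow> ip b u = 0"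
  shows "ip p u = 0"
  using assms(1)
proof (induction rule: lin_span.induct)
  case (step p b c)
  then show ?case
    using lin_span_square_integrable[OF step.hyps(1)] assms(2-)
    by (simp add: ip_add_left ip_cmult_left square_integrable_cmult)
qed (simp add: ip_def)

text \<open>The bilinear form is only semidefinite on functions, so Gram-Schmidt has to skip null vectors.\<close>

lemma orthogonal_projection:
  assumes "finite B" "\<And>b. b \<in> B \<Longrightarrow> square_integrable b"
  shows "\<forall>u. square_integrable u \<longrightarrow> (\<exists>q. lin_span B q \<and> (\<forall>b\<in>B. ip b (\<lambda>x. u x - q x) = 0))"
  using assms
proof (induction rule: finite_induct)
  case empty
  then show ?case by (auto intro: lin_span.zero)
next
  case (insert b B)
  have sB: "\<And>b. b \<in> B \<Longrightarrow> square_integrable b" and sb: "square_integrable b" using insert.prems by auto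
  obtain qb where qb: "lin_span B qb" "\<And>a. a \<in> B \<Longrightarrow> ip a (\<lambda>x. b x - qb x) = 0"
    using insert.IH[OF sB] sb by blast
  define b' where "b' x = b x - qb x" for x
  have sqb: "square_integrable qb" using lin_span_square_integrable[OF qb(1) sB] .
  have sb': "square_integrable b'" unfolding b'_def using sb sqb by (rule square_integrable_diff)
  have b'B: "ip a b' = 0" if "a \<in> B" for a using qb(2)[OF that] by (simp add: b'_def[abs_def])
  show ?case
  proof (intro allI impI)
    fix u assume su: "square_integrable u"
    obtain q where q: "lin_span B q" "\<And>a. a \<in> B \<Longrightarrow> ip a (\<lambda>x. u x - q x) = 0"
      using insert.IH[OF sB] su by blast
    have sq: "square_integrable q" using lin_span_square_integrable[OF q(1) sB] .
    define r where "r x = u x - q x" for x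
    have sr: "square_integrable r" unfolding r_def using su sq by (rule square_integrable_diff)
    have rB: "ip a r = 0" if "a \<in> B" for a using q(2)[OF that] by (simp add: r_def[abs_def])
    \<comment> \<open>If \<open>b'\<close> is a null vector the quotient is 0 by convention, and
      \<open>ip b' r\<close> vanishes too by \<open>ip_eq_0_imp\<close>; the equation for
      \<open>c\<close> holds in both cases.\<close>
    define c where "c = ip b' r / ip b' b'"
    have c: "ip b' r = c * ip b' b'"
      using ip_eq_0_imp[OF sr sb'] by (cases "ip b' b' = 0") (auto simp: c_def ip_commute)
    define q2 where "q2 x = q x + c * b' x" for x
    have span: "lin_span (insert b B) q2"
    proof -
      have "lin_span (insert b B) (\<lambda>x. (q x + (- c) * qb x) + c * b x)"
        by (intro lin_span.step lin_span_add lin_span_cmult lin_span_mono[OF q(1)] lin_span_mono[OF qb(1)]) auto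
      then show ?thesis by (rule back_subst[of "lin_span _"]) (auto simp: q2_def b'_def algebra_simps)
    qed
    have r2: "(\<lambda>x. u x - q2 x) = (\<lambda>x. r x - c * b' x)" by (simp add: fun_eq_iff q2_def r_def)
    have ip2: "ip a (\<lambda>x. u x - q2 x) = ip a r - c * ip a b'" if "square_integrable a" for a
      unfolding r2 ip_commute[of a] using sr sb' that
      by (simp add: ip_diff_left ip_cmult_left square_integrable_cmult)
    have B0: "ip a (\<lambda>x. u x - q2 x) = 0" if "a \<in> B" for a
      using ip2[OF sB[OF that]] rB b'B that by simp
    have "ip b (\<lambda>x. u x - q2 x) = ip b' (\<lambda>x. u x - q2 x) + ip qb (\<lambda>x. u x - q2 x)"
    proof -
      have "square_integrable (\<lambda>x. u x - q2 x)"
        unfolding r2 by (intro square_integrable_diff square_integrable_cmult sr sb')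
      from ip_add_left[OF sb' sqb this] show ?thesis by (simp add: b'_def)
    qed
    also have "ip b' (\<lambda>x. u x - q2 x) = 0" using ip2[OF sb'] c by simp
    also have "ip qb (\<lambda>x. u x - q2 x) = 0"
      by (rule lin_span_orthogonal[OF qb(1) sB _ B0])
         (auto simp: r2 intro!: square_integrable_diff square_integrable_cmult sr sb')
    finally have "ip b (\<lambda>x. u x - q2 x) = 0" by simp
    then show "\<exists>q. lin_span (insert b B) q \<and> (\<forall>a\<in>insert b B. ip a (\<lambda>x. u x - q x) = 0)"
      using span B0 by blast
  qed
qed

lemma invariant_poly_group: "w \<in> G \<Longrightarrow> invariant_poly n p \<Longrightarrow> p (w x) = p x"
  by (induction arbitrary: x rule: reflection_group.induct) (auto simp: invariant_poly_def)

lemma average_invariant_poly: "invariant_poly n p \<Longrightarrow> average p = p"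
  using card_G by (simp add: average_def fun_eq_iff invariant_poly_group)

lemma invariant_poly_average: "poly_below n p \<Longrightarrow> invariant_poly n (average p)"
  using poly_below_average average_reflection by (auto simp: invariant_poly_def)

lemma invariant_poly_mono: "m \<le> n \<Longrightarrow> invariant_poly m p \<Longrightarrow> invariant_poly n p"
  using poly_below_mono by (auto simp: invariant_poly_def)

lemma invariant_poly_imp:
  assumes "invariant_poly n p"
  shows "poly_below n p" "square_integrable p" "invariant p"
  using assms poly_below_square_integrable by (auto simp: invariant_poly_def invariant_def)

lemma invariant_diff: "invariant u \<Longrightarrow> invariant v \<Longrightarrow> invariant (\<lambda>x. u x - v x)"
  unfolding invariant_def
proof
  fix w assume "\<forall>v\<in>Rp. AE x in \<nu>. u (reflection v x) = u x" "\<forall>w\<in>Rp. AE x in \<nu>. v (reflection w x) = v x" "w \<in> Rp"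
  then have "AE x in \<nu>. u (reflection w x) = u x" "AE x in \<nu>. v (reflection w x) = v x" by auto
  then show "AE x in \<nu>. u (reflection w x) - v (reflection w x) = u x - v x" by eventually_elim simp
qed

text \<open>Averaging is linear and fixes invariant polynomials, so the averages of finitely many
  generators span the invariant polynomials, and the projection onto their span is again
  invariant.\<close>

lemma invariant_projection:
  assumes u: "square_integrable u"
  shows "\<exists>q. invariant_poly n q \<and> (\<forall>p. invariant_poly n p \<longrightarrow> ip p (\<lambda>x. u x - q x) = 0)"
proof -
  obtain B :: "(real ^ 'd \<Rightarrow> real) set" where
    "finite B \<and> (\<forall>b\<in>B. poly_below n b) \<and> (\<forall>p. poly_below n p \<longrightarrow> lin_span B p)"
    using poly_below_finite_span[of n] ..
  then have B: "finite B" "\<And>b. b \<in> B \<Longrightarrow> poly_below n b" "\<And>p. poly_below n p \<Longrightarrow> lin_span B p"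
    by blast+
  have avB: "invariant_poly n b" if "b \<in> average ` B" for b using that B(2) invariant_poly_average by auto
  have sB: "square_integrable b" if "b \<in> average ` B" for b using invariant_poly_imp(2)[OF avB[OF that]] .
  have span: "lin_span (average ` B) p" if "invariant_poly n p" for p
  proof -
    have "lin_span (average ` B) (average p)"
      by (rule lin_span_image[OF B(3)])
         (use that in \<open>auto simp: invariant_poly_def average_def fun_eq_iff sum.distrib sum_distrib_left add_divide_distrib\<close>)
    then show ?thesis using average_invariant_poly[OF that] by simp
  qed
  obtain q where q: "lin_span (average ` B) q" "\<And>b. b \<in> average ` B \<Longrightarrow> ip b (\<lambda>x. u x - q x) = 0"
    using orthogonal_projection[OF finite_imageI[OF B(1)] sB] u by blast
  have "invariant_poly n q" using q(1)
  proof (induction rule: lin_span.induct)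
    case (step p b c)
    have "poly_below n (\<lambda>x. p x + c * b x)"
      using step.IH avB[OF step.hyps(2)] by (intro poly_below.add poly_below_cmult) (auto simp: invariant_poly_def)
    then show ?case using step.IH avB[OF step.hyps(2)] by (auto simp: invariant_poly_def)
  qed (auto simp: invariant_poly_def intro: poly_below.zero)
  moreover have "ip p (\<lambda>x. u x - q x) = 0" if "invariant_poly n p" for p
    by (rule lin_span_orthogonal[OF span[OF that] sB _ q(2)])
       (use u lin_span_square_integrable[OF q(1) sB] square_integrable_diff in auto)
  ultimately show ?thesis by blast
qed

text \<open>Pairing with an invariant function does not distinguish \<open>p\<close> from its
  average. The lemma is applied to images under the Dunkl operator, whose invariance then need not
  be established.\<close>

lemma orthogonal_poly_below:
  assumes r: "square_integrable r" "invariant r" and orth: "\<And>p. invariant_poly n p \<Longrightarrow> ip p r = 0"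
    and p: "poly_below n p"
  shows "ip p r = 0"
proof -
  have sp: "square_integrable p" using poly_below_square_integrable[OF p] .
  have pr: "integrable \<nu> (\<lambda>x. p x * r x)" by (rule square_integrable_mult[OF sp r(1)])
  have m: "r \<in> borel_measurable \<nu>" "p \<in> borel_measurable \<nu>" using r(1) sp by (auto simp: square_integrable_def)
  have AE: "AE x in \<nu>. p (w x) * r x = p (w x) * r (w x)" if "w \<in> G" for w
    using invariant_group[OF r(2) that] by eventually_elim simp
  have m2: "(\<lambda>x. p (w x) * r x) \<in> borel_measurable \<nu>" "(\<lambda>x. p (w x) * r (w x)) \<in> borel_measurable \<nu>" if "w \<in> G" for w
    using measurable_compose[OF group_measurable[OF that] m(1)] measurable_compose[OF group_measurable[OF that] m(2)] m
    by (auto intro!: borel_measurable_times)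
  have i1: "integrable \<nu> (\<lambda>x. p (w x) * r x)" if "w \<in> G" for w
    using integrable_group[OF that pr] integrable_cong_AE[OF m2[OF that] AE[OF that]] by simp
  have i2: "(LINT x|\<nu>. p (w x) * r x) = ip p r" if "w \<in> G" for w
    using integral_cong_AE[OF m2[OF that] AE[OF that]] integral_group[OF that, of "\<lambda>x. p x * r x"] pr
    by (simp add: ip_def)
  have "0 = ip (average p) r" using orth[OF invariant_poly_average[OF p]] by simp
  also have "\<dots> = (LINT x|\<nu>. (\<Sum>w\<in>G. p (w x) * r x)) / card G"
    unfolding ip_def average_def by (simp add: sum_distrib_right)
  also have "(LINT x|\<nu>. (\<Sum>w\<in>G. p (w x) * r x)) = (\<Sum>w\<in>G. LINT x|\<nu>. p (w x) * r x)"
    by (rule Bochner_Integration.integral_sum) (rule i1)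
  also have "\<dots> = card G * ip p r" by (simp add: i2)
  finally show ?thesis using card_G by simp
qed

section \<open>The energy form and the Poincare inequality\<close>

definition field :: "(real ^ 'd \<Rightarrow> real ^ 'd) \<Rightarrow> bool" where
  "field g \<longleftrightarrow> g \<in> borel_measurable \<nu> \<and> square_integrable (\<lambda>x. norm (g x))"

definition En :: "(real ^ 'd \<Rightarrow> real ^ 'd) \<Rightarrow> (real ^ 'd \<Rightarrow> real ^ 'd) \<Rightarrow> real" where
  "En g h = (LINT x|\<nu>. \<Gamma> x (g x) (h x))"

lemma \<Gamma>_integrable:
  assumes "field g" "field h" shows "integrable \<nu> (\<lambda>x. \<Gamma> x (g x) (h x))"
proof (rule Bochner_Integration.integrable_bound[where f = "\<lambda>x. 2 * (norm (g x) * norm (h x))"])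
  show "integrable \<nu> (\<lambda>x. 2 * (norm (g x) * norm (h x)))"
    using assms by (intro integrable_mult_right square_integrable_mult) (auto simp: field_def)
  have "(\<lambda>x. x) \<in> borel_measurable \<nu>" by (rule borel_imp_\<nu>) simp
  moreover have "g \<in> borel_measurable \<nu>" "h \<in> borel_measurable \<nu>" using assms by (simp_all add: field_def)
  ultimately show "(\<lambda>x. \<Gamma> x (g x) (h x)) \<in> borel_measurable \<nu>"
    unfolding \<Gamma>_def by (intro borel_measurable_diff borel_measurable_times borel_measurable_inner)
  show "AE x in \<nu>. norm (\<Gamma> x (g x) (h x)) \<le> norm (2 * (norm (g x) * norm (h x)))"
    by (rule AE_I2) (auto intro!: \<Gamma>_abs_le)
qed

lemma field_continuous: "continuous_on UNIV g \<Longrightarrow> field g"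
  unfolding field_def by (intro conjI continuous_imp_\<nu> square_integrable_continuous continuous_intros)

lemma field_grad: "poly_below n p \<Longrightarrow> field (grad p)"
  by (intro field_continuous continuous_grad)

lemma En_nonneg: "0 \<le> En g g"
  unfolding En_def by (intro integral_nonneg_AE AE_I2) (auto intro!: \<Gamma>_nonneg)

lemma sobolev_poly: "poly_below n p \<Longrightarrow> sobolev p (grad p)"
  by (intro sobolev_continuous poly_below_GDERIV continuous_grad)

lemma sobolev_imp: assumes "sobolev u g" shows "square_integrable u" "field g"
  using assms by (auto simp: sobolev_def field_def)

lemma dunkl_operator:
  assumes p: "invariant_poly (Suc n) p"
  shows "\<exists>\<l>. poly_below n (\<lambda>x. \<l> x + real n * (real n + 2 * lam) * p x) \<and> poly_below (Suc n) \<l> \<and>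
    (\<forall>u g. sobolev u g \<longrightarrow> ip \<l> u = - En (grad p) g)"
proof -
  have pp: "poly_below (Suc n) p" using p by (simp add: invariant_poly_def)
  obtain \<l> where \<l>: "poly_below n (\<lambda>x. \<l> x + real n * (real n + 2 * lam) * p x)"
    "\<And>u g. sobolev u g \<Longrightarrow> (LINT x|\<nu>. \<l> x * u x) = - (LINT x|\<nu>. \<Gamma> x (grad p x) (g x))"
    using dunkl_operator_poly[OF p poly_below_GDERIV[OF pp]] by blast
  have "poly_below (Suc n) (\<lambda>x. (\<l> x + real n * (real n + 2 * lam) * p x) - real n * (real n + 2 * lam) * p x)"
    by (intro poly_below_diff poly_below_cmult pp poly_below_Suc[OF \<l>(1)])
  then show ?thesis using \<l> by (auto simp: ip_def En_def)
qed

text \<open>The Dunkl operator does not raise the degree, so \<open>\<l>\<close> is among the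
  polynomials orthogonal to \<open>u - q\<close>, and the energy pairing with \<open>grad p\<close>
  cannot tell \<open>u\<close> from \<open>q\<close>.\<close>

lemma En_projection:
  assumes p: "invariant_poly n p" and u: "sobolev u g" "invariant u" and q: "invariant_poly m q"
    and orth: "\<And>a. invariant_poly n a \<Longrightarrow> ip a (\<lambda>x. u x - q x) = 0"
  shows "En (grad p) g = En (grad p) (grad q)"
proof -
  \<comment> \<open>The bound is weakened only to match the index of \<open>dunkl_operator\<close>;
    since \<open>p\<close> itself is below \<open>n\<close>, the polynomial \<open>\<l>\<close> is
    too.\<close>
  have p': "invariant_poly (Suc n) p" using invariant_poly_mono[OF _ p] by simp
  note qq = invariant_poly_imp[OF q]
  obtain \<l> where \<l>: "poly_below n (\<lambda>x. \<l> x + real n * (real n + 2 * lam) * p x)"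
    "\<And>u g. sobolev u g \<Longrightarrow> ip \<l> u = - En (grad p) g" using dunkl_operator[OF p'] by blast
  have "poly_below n (\<lambda>x. (\<l> x + real n * (real n + 2 * lam) * p x) - real n * (real n + 2 * lam) * p x)"
    by (intro poly_below_diff \<l>(1) poly_below_cmult invariant_poly_imp(1)[OF p])
  then have \<l>n: "poly_below n \<l>" by simp
  have "ip \<l> (\<lambda>x. u x - q x) = 0"
    by (rule orthogonal_poly_below[OF _ _ orth \<l>n])
       (intro square_integrable_diff invariant_diff sobolev_imp(1)[OF u(1)] u(2) qq)+
  moreover have "ip \<l> (\<lambda>x. u x - q x) = ip \<l> u - ip \<l> q"
    unfolding ip_commute[of \<l>]
    by (intro ip_diff_left sobolev_imp(1)[OF u(1)] qq poly_below_square_integrable[OF \<l>n])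
  ultimately show ?thesis using \<l>(2)[OF u(1)] \<l>(2)[OF sobolev_poly[OF qq(1)]] by simp
qed

lemma En_diff:
  assumes "field a" "field b"
  shows "En (\<lambda>x. a x - b x) (\<lambda>x. a x - b x) = En a a - 2 * En b a + En b b"
proof -
  have "\<Gamma> x (a x - b x) (a x - b x) = \<Gamma> x (a x) (a x) - 2 * \<Gamma> x (b x) (a x) + \<Gamma> x (b x) (b x)" for x
    using \<Gamma>_commute[of x "a x" "b x"] by (simp add: \<Gamma>_diff_left \<Gamma>_diff_right)
  then show ?thesis unfolding En_def using assms by (simp add: \<Gamma>_integrable)
qed

text \<open>Bessel's inequality for the energy: by \<open>En_projection\<close> with
  \<open>p = q\<close>, the L2 projection is also orthogonal for the energy form.\<close>

lemma En_projection_le: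
  assumes u: "sobolev u g" "invariant u" and q: "invariant_poly n q"
    and orth: "\<And>a. invariant_poly n a \<Longrightarrow> ip a (\<lambda>x. u x - q x) = 0"
  shows "En (grad q) (grad q) \<le> En g g"
  using En_projection[OF q u q orth] En_diff[OF sobolev_imp(2)[OF u(1)] field_grad[OF invariant_poly_imp(1)[OF q]]]
    En_nonneg[of "\<lambda>x. g x - grad q x"] by simp

lemma ip_pythagoras:
  assumes "square_integrable u" "square_integrable q" "ip q (\<lambda>x. u x - q x) = 0"
  shows "ip u u = ip q q + ip (\<lambda>x. u x - q x) (\<lambda>x. u x - q x)"
proof -
  have d: "square_integrable (\<lambda>x. u x - q x)" using assms(1,2) by (rule square_integrable_diff)
  have "ip (\<lambda>x. u x - q x) (\<lambda>x. u x - q x) = ip u (\<lambda>x. u x - q x)"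
    using ip_diff_left[OF assms(1,2) d] assms(3) by simp
  also have "\<dots> = ip u u - ip q u" using ip_diff_left[OF assms(1,2,1)] by (simp add: ip_commute)
  finally have 1: "ip (\<lambda>x. u x - q x) (\<lambda>x. u x - q x) = ip u u - ip q u" .
  have "ip u q - ip q q = 0" using ip_diff_left[OF assms(1,2,2)] assms(3) by (simp add: ip_commute)
  then show ?thesis using 1 by (simp add: ip_commute)
qed

lemma invariant_poly_const: "invariant_poly (Suc n) (\<lambda>x. c)"
  by (simp add: invariant_poly_def poly_below.const)

text \<open>Induction on the degree. The part \<open>r\<close> of \<open>q\<close> orthogonal to all
  invariant polynomials of lower degree is orthogonal to the rest in the energy as well, and behaves
  like an eigenfunction with eigenvalue \<open>n * (n + 2 * lam)\<close>. Mean zero excludes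
  \<open>n = 0\<close>, and \<open>n = 1\<close> gives the constant.\<close>

lemma poincare_poly:
  assumes "invariant_poly n q" "ip (\<lambda>x. 1) q = 0"
  shows "(1 + 2 * lam) * ip q q \<le> En (grad q) (grad q)"
  using assms
proof (induction n arbitrary: q)
  case 0
  then have "q x = 0" for x using poly_below_0D by (auto simp: invariant_poly_def)
  then show ?case using En_nonneg by (simp add: ip_def)
next
  case (Suc n)
  note q = invariant_poly_imp[OF Suc.prems(1)]
  show ?case
  proof (cases "n = 0")
    case True
    then obtain c where c: "\<And>x. q x = c" using poly_below_1_const[OF q(1)] by blast
    have "ip q q = c * ip (\<lambda>x. 1) q" by (simp add: ip_def c)
    then show ?thesis using Suc.prems(2) En_nonneg by simp
  next
    case False
    obtain q' where q': "invariant_poly n q'" "\<And>p. invariant_poly n p \<Longrightarrow> ip p (\<lambda>x. q x - q' x) = 0"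
      using invariant_projection[OF q(2)] by blast
    note qq' = invariant_poly_imp[OF q'(1)]
    define r where "r x = q x - q' x" for x
    have rn: "invariant_poly (Suc n) r"
      using Suc.prems(1) invariant_poly_mono[OF _ q'(1), of "Suc n"]
      by (auto simp: r_def[abs_def] invariant_poly_def intro: poly_below_diff)
    note r = invariant_poly_imp[OF rn]
    have orth: "ip p r = 0" if "invariant_poly n p" for p using q'(2)[OF that] by (simp add: r_def[abs_def])
    have gr: "grad r = (\<lambda>x. grad q x - grad q' x)"
    proof
      fix x
      have "GDERIV r x :> grad q x - grad q' x"
        unfolding r_def[abs_def] by (intro GDERIV_diff poly_below_GDERIV[OF q(1)] poly_below_GDERIV[OF qq'(1)])
      then show "grad r x = grad q x - grad q' x" by (rule grad_eq)
    qed
    have En: "En (grad q) (grad q) = En (grad q') (grad q') + En (grad r) (grad r)"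
      using En_projection[OF q'(1) sobolev_poly[OF q(1)] q(3) q'(1) q'(2)]
        En_diff[OF field_grad[OF q(1)] field_grad[OF qq'(1)]] unfolding gr by simp
    have ip: "ip q q = ip q' q' + ip r r"
      using ip_pythagoras[OF q(2) qq'(2) q'(2)[OF q'(1)]] by (simp add: r_def[abs_def])
    have "ip (\<lambda>x. 1) q' = 0"
    proof -
      have "invariant_poly n (\<lambda>x. 1)" using invariant_poly_const[of "n - 1" 1] False by simp
      then have "ip (\<lambda>x. q x - q' x) (\<lambda>x. 1) = 0" using q'(2) by (simp add: ip_commute)
      then show ?thesis using ip_diff_left[OF q(2) qq'(2), of "\<lambda>x. 1"] Suc.prems(2)
        by (simp add: ip_commute[of _ "\<lambda>x. 1"] square_integrable_continuous)
    qed
    then have 1: "(1 + 2 * lam) * ip q' q' \<le> En (grad q') (grad q')" by (rule Suc.IH[OF q'(1)])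
    obtain \<l> where \<l>: "poly_below n (\<lambda>x. \<l> x + real n * (real n + 2 * lam) * r x)" "poly_below (Suc n) \<l>"
      "ip \<l> r = - En (grad r) (grad r)" using dunkl_operator[OF rn] sobolev_poly[OF r(1)] by blast
    \<comment> \<open>Applying \<open>L\<close> to \<open>r\<close> gives
      \<open>- n * (n + 2 * lam) * r\<close> up to lower degree, that is, up to terms orthogonal to
      \<open>r\<close>; this determines the energy of \<open>r\<close> exactly.\<close>
    have "0 = ip (\<lambda>x. \<l> x + real n * (real n + 2 * lam) * r x) r"
      using orthogonal_poly_below[OF r(2,3) orth \<l>(1)] by simp
    also have "\<dots> = ip \<l> r + real n * (real n + 2 * lam) * ip r r"
      using r(2) poly_below_square_integrable[OF \<l>(2)] by (simp add: ip_add_left square_integrable_cmult ip_cmult_left)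
    finally have "En (grad r) (grad r) = real n * (real n + 2 * lam) * ip r r" using \<l>(3) by simp
    moreover have "1 + 2 * lam \<le> real n * (real n + 2 * lam)"
    proof -
      have "1 \<le> real n" using False by simp
      then have "1 * (1 + 2 * lam) \<le> real n * (real n + 2 * lam)" using lam_nonneg by (intro mult_mono) auto
      then show ?thesis by simp
    qed
    ultimately have "(1 + 2 * lam) * ip r r \<le> En (grad r) (grad r)" using ip_nonneg by (simp add: mult_right_mono)
    then show ?thesis unfolding En ip using 1 by (simp add: distrib_left)
  qed
qed

text \<open>Best approximations of \<open>u\<close> have smaller energy and converge to \<open>u\<close>, so the inequalities pass
  from polynomials to Sobolev functions.\<close>

lemma sobolev_approx:
  assumes u: "sobolev u g" "invariant u" and "e > 0"
  shows "\<exists>n q. invariant_poly (Suc n) q \<and> ip (\<lambda>x. 1) q = ip (\<lambda>x. 1) u \<and>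
    ip (\<lambda>x. u x - q x) (\<lambda>x. u x - q x) < e \<and> ip u u = ip q q + ip (\<lambda>x. u x - q x) (\<lambda>x. u x - q x) \<and>
    En (grad q) (grad q) \<le> En g g"
proof -
  note su = sobolev_imp(1)[OF u(1)]
  obtain n p where "invariant_poly n p" and pe: "(LINT x|\<nu>. (u x - p x)\<^sup>2) < e"
    using invariant_poly_dense[OF su u(2) \<open>e > 0\<close>] by blast
  \<comment> \<open>The bound \<open>Suc n\<close> ensures that constants belong to the
    approximating space, so the projection keeps the mean of \<open>u\<close>.\<close>
  then have p: "invariant_poly (Suc n) p" using invariant_poly_mono[of n "Suc n"] by simp
  obtain q where q: "invariant_poly (Suc n) q" "\<And>a. invariant_poly (Suc n) a \<Longrightarrow> ip a (\<lambda>x. u x - q x) = 0"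
    using invariant_projection[OF su] by blast
  note pp = invariant_poly_imp[OF p] and qq = invariant_poly_imp[OF q(1)]
  have d: "square_integrable (\<lambda>x. u x - p x)" "square_integrable (\<lambda>x. q x - p x)"
    by (intro square_integrable_diff su pp qq)+
  have "invariant_poly (Suc n) (\<lambda>x. q x - p x)"
    using p q(1) by (auto simp: invariant_poly_def intro: poly_below_diff)
  then have "ip (\<lambda>x. q x - p x) (\<lambda>x. u x - q x) = 0" by (rule q(2))
  then have "ip (\<lambda>x. u x - q x) (\<lambda>x. u x - q x) \<le> ip (\<lambda>x. u x - p x) (\<lambda>x. u x - p x)"
    using ip_pythagoras[OF d] ip_nonneg[of "\<lambda>x. q x - p x"] by simp
  also have "\<dots> < e" using pe by (simp add: ip_def power2_eq_square)
  finally have 2: "ip (\<lambda>x. u x - q x) (\<lambda>x. u x - q x) < e" .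
  have "ip (\<lambda>x. u x - q x) (\<lambda>x. 1) = 0" using q(2)[OF invariant_poly_const] by (simp add: ip_commute)
  then have "ip (\<lambda>x. 1) q = ip (\<lambda>x. 1) u"
    using ip_diff_left[OF su qq(2) square_integrable_continuous[of "\<lambda>x. 1"]] by (simp add: ip_commute)
  then show ?thesis
    using q(1) 2 ip_pythagoras[OF su qq(2) q(2)[OF q(1)]] En_projection_le[OF u q(1) q(2)] by blast
qed

lemma poincare:
  assumes u: "sobolev u g" "invariant u" and "ip (\<lambda>x. 1) u = 0"
  shows "(1 + 2 * lam) * ip u u \<le> En g g"
proof (rule field_le_epsilon)
  fix e :: real assume "e > 0"
  then have "e / (1 + 2 * lam) > 0" using lam_nonneg by simp
  from sobolev_approx[OF u this] obtain n q where q: "invariant_poly (Suc n) q" "ip (\<lambda>x. 1) q = 0"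
    "ip u u < ip q q + e / (1 + 2 * lam)" "En (grad q) (grad q) \<le> En g g" using assms(3) by fastforce
  have "(1 + 2 * lam) * ip u u \<le> (1 + 2 * lam) * (ip q q + e / (1 + 2 * lam))"
    using q(3) lam_nonneg by (intro mult_left_mono) auto
  also have "\<dots> = (1 + 2 * lam) * ip q q + e" using lam_nonneg by (simp add: distrib_left)
  also have "\<dots> \<le> En g g + e" using poincare_poly[OF q(1,2)] q(4) by simp
  finally show "(1 + 2 * lam) * ip u u \<le> En g g + e" .
qed

text \<open>Integration by parts of the square of \<open>q\<close> against the constant field
  \<open>w\<close>, followed by Young's inequality with parameter \<open>c\<close> for the
  semidefinite form \<open>\<Gamma>\<close>.\<close>

lemma uncertainty_poly:
  assumes q: "poly_below n q" and w: "\<And>v. v \<in> Rp \<Longrightarrow> w \<bullet> v = 0" and c: "c > 0"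
  shows "(LINT x|\<nu>. ((1 + 2 * lam) * (x \<bullet> w) - c * \<Gamma> x w w) * (q x)\<^sup>2) \<le> En (grad q) (grad q) / c"
proof -
  have contq: "continuous_on UNIV q" using poly_below_continuous[OF q] .
  have contx: "continuous_on UNIV (\<lambda>x. (1 + 2 * lam) * (x \<bullet> w) - c * \<Gamma> x w w)"
    unfolding \<Gamma>_def by (intro continuous_intros)
  have sob: "sobolev (\<lambda>x. (q x)\<^sup>2) (\<lambda>x. (2 * q x) *\<^sub>R grad q x)"
  proof (rule sobolev_continuous)
    show "GDERIV (\<lambda>x. (q x)\<^sup>2) x :> (2 * q x) *\<^sub>R grad q x" for x
      using GDERIV_mult[OF poly_below_GDERIV[OF q] poly_below_GDERIV[OF q], of x]
      by (simp add: power2_eq_square flip: scaleR_left_distrib)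
    show "continuous_on UNIV (\<lambda>x. (2 * q x) *\<^sub>R grad q x)"
      by (intro continuous_intros contq continuous_grad[OF q])
  qed
  \<comment> \<open>For constant \<open>P\<close> equal to \<open>w\<close> and orthogonal to the
    roots, the terms \<open>H\<close> and \<open>q\<close> vanish and \<open>E\<close> is
    \<open>w\<close>; the summand 1 in \<open>1 + 2 * lam\<close> is the contribution of
    \<open>x \<bullet> E x\<close>.\<close>
  have "GDERIV (\<lambda>x. x \<bullet> w) x :> w" for x unfolding gderiv_def by (auto intro!: derivative_eq_intros)
  from weak_dunkl_laplacian[OF sob, of "\<lambda>x. w" "\<lambda>j x. 0" "\<lambda>x. w" "\<lambda>v x. 0", OF GDERIV_const _ this]
  have "(LINT x|\<nu>. (- (x \<bullet> w) - 2 * lam * (x \<bullet> w)) * (q x)\<^sup>2) = - (LINT x|\<nu>. \<Gamma> x w ((2 * q x) *\<^sub>R grad q x))"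
    using w by simp
  moreover have "(\<lambda>x. (- (x \<bullet> w) - 2 * lam * (x \<bullet> w)) * (q x)\<^sup>2) = (\<lambda>x. - (((1 + 2 * lam) * (x \<bullet> w)) * (q x)\<^sup>2))"
    by (simp add: fun_eq_iff algebra_simps)
  ultimately have 1: "(LINT x|\<nu>. ((1 + 2 * lam) * (x \<bullet> w)) * (q x)\<^sup>2) = (LINT x|\<nu>. \<Gamma> x w ((2 * q x) *\<^sub>R grad q x))"
    by simp
  have pw: "\<Gamma> x w ((2 * q x) *\<^sub>R grad q x) \<le> (c * \<Gamma> x w w) * (q x)\<^sup>2 + \<Gamma> x (grad q x) (grad q x) / c"
    if "x \<in> cball 0 1" for x
  proof -
    \<comment> \<open>Young's inequality as a completed square.\<close>
    have "0 \<le> \<Gamma> x ((c * q x) *\<^sub>R w - grad q x) ((c * q x) *\<^sub>R w - grad q x) / c"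
      using that c by (intro divide_nonneg_pos \<Gamma>_nonneg) auto
    also have "\<dots> = (c * \<Gamma> x w w) * (q x)\<^sup>2 + \<Gamma> x (grad q x) (grad q x) / c - 2 * q x * \<Gamma> x w (grad q x)"
      using c \<Gamma>_commute[of x w "grad q x"]
      by (simp add: \<Gamma>_diff_left \<Gamma>_diff_right \<Gamma>_scaleR_left \<Gamma>_scaleR_right field_simps power2_eq_square)
    finally show ?thesis by (simp add: \<Gamma>_scaleR_right)
  qed
  have i1: "integrable \<nu> (\<lambda>x. \<Gamma> x w ((2 * q x) *\<^sub>R grad q x))"
    by (intro \<Gamma>_integrable field_continuous continuous_intros contq continuous_grad[OF q])
  have i2: "integrable \<nu> (\<lambda>x. (c * \<Gamma> x w w) * (q x)\<^sup>2)"
    unfolding \<Gamma>_def by (intro integrable_continuous continuous_intros contq)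
  have i3: "integrable \<nu> (\<lambda>x. \<Gamma> x (grad q x) (grad q x) / c)"
    by (intro integrable_divide \<Gamma>_integrable field_grad[OF q])
  have i4: "integrable \<nu> (\<lambda>x. ((1 + 2 * lam) * (x \<bullet> w)) * (q x)\<^sup>2)"
    by (intro integrable_continuous continuous_intros contq)
  have "(LINT x|\<nu>. \<Gamma> x w ((2 * q x) *\<^sub>R grad q x)) \<le>
      (LINT x|\<nu>. (c * \<Gamma> x w w) * (q x)\<^sup>2 + \<Gamma> x (grad q x) (grad q x) / c)"
    by (rule integral_mono[OF i1 Bochner_Integration.integrable_add[OF i2 i3]]) (use pw in auto)
  also have "\<dots> = (LINT x|\<nu>. (c * \<Gamma> x w w) * (q x)\<^sup>2) + En (grad q) (grad q) / c"
    using i2 i3 by (simp add: En_def)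
  finally show ?thesis unfolding left_diff_distrib using i2 i4 1 by simp
qed

text \<open>The square of \<open>u\<close> need not be a Sobolev function, so integration by parts
  is not applied to it directly. The polynomial case passes to the limit because the factor
  \<open>b\<close> is bounded on the ball and the energies of the approximants do not exceed that of
  \<open>u\<close>.\<close>

lemma uncertainty:
  assumes u: "sobolev u g" "invariant u" and w: "\<And>v. v \<in> Rp \<Longrightarrow> w \<bullet> v = 0" and c: "c > 0"
  shows "(LINT x|\<nu>. ((1 + 2 * lam) * (x \<bullet> w) - c * \<Gamma> x w w) * (u x)\<^sup>2) \<le> En g g / c"
proof -
  define b where "b x = (1 + 2 * lam) * (x \<bullet> w) - c * \<Gamma> x w w" for x
  have contb: "continuous_on UNIV b" unfolding b_def \<Gamma>_def by (intro continuous_intros)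
  obtain B where "B > 0" and B: "\<And>x. x \<in> cball 0 1 \<Longrightarrow> \<bar>b x\<bar> \<le> B" using continuous_bounded_cball[OF contb] by blast
  note su = sobolev_imp(1)[OF u(1)] and bint = integrable_continuous_mult[OF contb]
  have "(LINT x|\<nu>. b x * (u x)\<^sup>2) \<le> En g g / c + h * (B * (ip u u + 2))" if h: "0 < h" "h \<le> 1" for h
  proof -
    \<comment> \<open>The squared error \<open>h\<^sup>2\<close> is small enough that the factor
      \<open>1 + 1 / h\<close> produced by the splitting below still leaves a term of order
      \<open>h\<close>.\<close>
    obtain n q where q: "invariant_poly (Suc n) q" "ip (\<lambda>x. u x - q x) (\<lambda>x. u x - q x) < h\<^sup>2"
      "En (grad q) (grad q) \<le> En g g" using sobolev_approx[OF u, of "h\<^sup>2"] h by auto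
    note qq = invariant_poly_imp[OF q(1)]
    have sd: "square_integrable (\<lambda>x. u x - q x)" using su qq(2) by (rule square_integrable_diff)
    have i: "integrable \<nu> (\<lambda>x. (u x)\<^sup>2)" "integrable \<nu> (\<lambda>x. (q x)\<^sup>2)" "integrable \<nu> (\<lambda>x. (u x - q x)\<^sup>2)"
      using su qq(2) sd by (auto simp: square_integrable_def)
    have pw: "b x * (u x)\<^sup>2 \<le> b x * (q x)\<^sup>2 + B * (h * (u x)\<^sup>2 + (1 + 1 / h) * (u x - q x)\<^sup>2)"
      if x: "x \<in> cball 0 1" for x
    proof -
      define d where "d = u x - q x"
      have e: "(u x)\<^sup>2 - (q x)\<^sup>2 = 2 * u x * d - d\<^sup>2" by (simp add: d_def power2_eq_square algebra_simps)
      \<comment> \<open>Both signs of the square bound the cross term \<open>2 * u x * d\<close> in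
        absolute value.\<close>
      have "0 \<le> (h * u x - d)\<^sup>2 / h" "0 \<le> (h * u x + d)\<^sup>2 / h" using h by auto
      then have "\<bar>2 * u x * d\<bar> \<le> h * (u x)\<^sup>2 + d\<^sup>2 / h"
        using h by (auto simp: abs_le_iff power2_eq_square field_simps)
      then have "\<bar>(u x)\<^sup>2 - (q x)\<^sup>2\<bar> \<le> h * (u x)\<^sup>2 + d\<^sup>2 / h + d\<^sup>2" unfolding e using zero_le_power2[of d] by linarith
      then have "\<bar>b x\<bar> * \<bar>(u x)\<^sup>2 - (q x)\<^sup>2\<bar> \<le> B * (h * (u x)\<^sup>2 + d\<^sup>2 / h + d\<^sup>2)"
        using B[OF x] by (intro mult_mono) auto
      then have "b x * ((u x)\<^sup>2 - (q x)\<^sup>2) \<le> B * (h * (u x)\<^sup>2 + d\<^sup>2 / h + d\<^sup>2)"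
        using abs_ge_self[of "b x * ((u x)\<^sup>2 - (q x)\<^sup>2)"] by (simp only: abs_mult)
      then show ?thesis by (simp add: d_def algebra_simps)
    qed
    have "(LINT x|\<nu>. b x * (u x)\<^sup>2) \<le> (LINT x|\<nu>. b x * (q x)\<^sup>2 + B * (h * (u x)\<^sup>2 + (1 + 1 / h) * (u x - q x)\<^sup>2))"
      by (rule integral_mono) (use pw in \<open>auto intro!: bint i Bochner_Integration.integrable_add integrable_mult_right\<close>)
    also have "\<dots> = (LINT x|\<nu>. b x * (q x)\<^sup>2) + B * (h * ip u u + (1 + 1 / h) * ip (\<lambda>x. u x - q x) (\<lambda>x. u x - q x))"
      using i bint[OF i(2)] by (simp add: ip_def power2_eq_square)
    also have "\<dots> \<le> En (grad q) (grad q) / c + B * (h * ip u u + (1 + 1 / h) * h\<^sup>2)"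
      using uncertainty_poly[OF qq(1) w c] q(2) h \<open>B > 0\<close>
      by (intro add_mono mult_left_mono) (auto simp: b_def)
    also have "\<dots> \<le> En g g / c + B * (h * ip u u + h * 2)"
    proof -
      have "(1 + 1 / h) * h\<^sup>2 = h * (1 + h)" using h by (simp add: power2_eq_square field_simps)
      also have "\<dots> \<le> h * 2" using h by (intro mult_left_mono) auto
      finally show ?thesis using q(3) c h \<open>B > 0\<close> by (intro add_mono mult_left_mono divide_right_mono) auto
    qed
    finally show ?thesis by (simp add: algebra_simps)
  qed
  note key = this
  have K: "B * (ip u u + 2) > 0" using \<open>B > 0\<close> ip_nonneg[of u] by (intro mult_pos_pos) auto
  have "(LINT x|\<nu>. b x * (u x)\<^sup>2) \<le> En g g / c"
  proof (rule field_le_epsilon)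
    fix e :: real assume "e > 0"
    define h where "h = min 1 (e / (B * (ip u u + 2)))"
    have h: "0 < h" "h \<le> 1" "h \<le> e / (B * (ip u u + 2))" using \<open>e > 0\<close> K by (auto simp: h_def)
    have "h * (B * (ip u u + 2)) \<le> e" using h(3) K by (simp add: pos_le_divide_eq)
    then show "(LINT x|\<nu>. b x * (u x)\<^sup>2) \<le> En g g / c + e" using key[OF h(1,2)] by simp
  qed
  then show ?thesis unfolding b_def .
qed

end

section \<open>The uncertainty principle on the ball\<close>

text \<open>The number \<open>t\<close> is where the bounds \<open>2 * L\<close> and
  \<open>(L + 1/2)\<^sup>2 * M\<^sup>2 / (1 - M\<^sup>2)\<close> for \<open>E\<close> coincide. For
  \<open>M \<le> t\<close> the first bound suffices. For \<open>M > t\<close> the second bounds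
  \<open>(1 - M) * E\<close> below by \<open>(L + 1/2)\<^sup>2 * M\<^sup>2 / (1 + M)\<close>, which
  increases with \<open>M\<close> and equals the constant at \<open>M = t\<close>.\<close>

lemma uncertainty_constant:
  fixes L M E :: real
  assumes L: "0 \<le> L" and M: "M\<^sup>2 \<le> 1" and E: "1 + 2 * L \<le> E"
    and unc: "\<And>c. c > 0 \<Longrightarrow> (1 + 2 * L) * M \<le> c * (1 - M\<^sup>2) + E / c"
  shows "2 * L * (1 - sqrt (2 * L) / sqrt ((L + 1/2)\<^sup>2 + 2 * L)) \<le> (1 - M) * E"
proof -
  define S where "S = (L + 1/2)\<^sup>2 + 2 * L"
  have S: "S > 0" using L by (simp add: S_def add_pos_nonneg)
  define t where "t = sqrt (2 * L) / sqrt S"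
  have t: "0 \<le> t" using L S by (simp add: t_def)
  have t2: "t\<^sup>2 = 2 * L / S" using L S by (simp add: t_def power_divide)
  have tC: "(L + 1/2)\<^sup>2 * t\<^sup>2 = 2 * L * (1 - t) * (1 + t)"
  proof -
    have "(L + 1/2)\<^sup>2 * t\<^sup>2 + 2 * L * t\<^sup>2 = S * t\<^sup>2" by (simp add: S_def distrib_right)
    also have "\<dots> = 2 * L" using S by (simp add: t2)
    finally show ?thesis by (simp add: power2_eq_square algebra_simps)
  qed
  have M1: "M \<le> 1" using M abs_square_le_1[of M] by auto
  have "2 * L * (1 - t) \<le> (1 - M) * E"
  proof (cases "M \<le> t")
    case True
    show ?thesis
    proof (cases "t \<le> 1")
      case True
      have "2 * L * (1 - t) \<le> E * (1 - M)" using \<open>M \<le> t\<close> True L E by (intro mult_mono) auto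
      then show ?thesis by (simp add: mult.commute)
    next
      case False
      then have "2 * L * (1 - t) \<le> 0" using L by (intro mult_nonneg_nonpos) auto
      also have "0 \<le> (1 - M) * E" using M1 L E by (intro mult_nonneg_nonneg) auto
      finally show ?thesis .
    qed
  next
    case False
    then have M0: "M > 0" and tM: "t \<le> M" using t by auto
    have sq: "((L + 1/2) * M)\<^sup>2 \<le> E * (1 - M\<^sup>2)" and M2: "M < 1"
    proof -
      show M2: "M < 1"
      proof (rule ccontr)
        assume "\<not> M < 1"
        then have "M = 1" using M1 by simp
        \<comment> \<open>At \<open>M = 1\<close> the term with \<open>c\<close> vanishes, and
          \<open>c = 2 * E\<close> makes the right-hand side \<open>1/2\<close>.\<close>
        then have "1 + 2 * L \<le> E / (2 * E)" using unc[of "2 * E"] L E by simp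
        then show False using L E by simp
      qed
      then have a: "1 - M\<^sup>2 > 0" using M0 by (simp add: power_less_one_iff abs_square_less_1)
      \<comment> \<open>With this \<open>c\<close> the term \<open>c * (1 - M\<^sup>2)\<close> is
        exactly half of the left-hand side of \<open>unc\<close>; the other half yields the squared
        Cauchy-Schwarz form.\<close>
      define c where "c = (L + 1/2) * M / (1 - M\<^sup>2)"
      have c: "c > 0" using a M0 L by (simp add: c_def)
      have "c * (1 - M\<^sup>2) = (L + 1/2) * M" using a by (simp add: c_def)
      then have "(L + 1/2) * M \<le> E / c" using unc[OF c] by (simp add: algebra_simps)
      then have "(L + 1/2) * M * c \<le> E" using c by (simp add: pos_le_divide_eq)
      then have "(L + 1/2) * M * ((L + 1/2) * M) \<le> E * (1 - M\<^sup>2)"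
        unfolding c_def using a by (simp add: pos_divide_le_eq mult.assoc)
      then show "((L + 1/2) * M)\<^sup>2 \<le> E * (1 - M\<^sup>2)" by (simp add: power2_eq_square)
    qed
    have "(2 * L * (1 - t)) * (1 + M) * (1 + t) = (L + 1/2)\<^sup>2 * t\<^sup>2 * (1 + M)" unfolding tC by (simp add: mult_ac)
    also have "\<dots> \<le> (L + 1/2)\<^sup>2 * (M\<^sup>2 * (1 + t))"
    proof -
      \<comment> \<open>Monotonicity of \<open>M\<^sup>2 / (1 + M)\<close>, with denominators
        cleared.\<close>
      have "t * t * M \<le> M * M * t" using mult_right_mono[OF tM, of "t * M"] t M0 by (simp add: mult_ac)
      moreover have "t * t \<le> M * M" using tM t M0 by (intro mult_mono) auto
      ultimately have "t\<^sup>2 * (1 + M) \<le> M\<^sup>2 * (1 + t)" by (simp add: power2_eq_square algebra_simps)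
      then show ?thesis unfolding mult.assoc by (intro mult_left_mono) auto
    qed
    also have "\<dots> = ((L + 1/2) * M)\<^sup>2 * (1 + t)" by (simp add: power_mult_distrib mult.assoc)
    also have "\<dots> \<le> E * (1 - M\<^sup>2) * (1 + t)" using sq t by (intro mult_right_mono) auto
    also have "\<dots> = ((1 - M) * E) * (1 + M) * (1 + t)" by (simp add: power2_eq_square algebra_simps)
    finally have "(2 * L * (1 - t)) * ((1 + M) * (1 + t)) \<le> ((1 - M) * E) * ((1 + M) * (1 + t))"
      by (simp only: mult.assoc)
    then show ?thesis using M0 t by (simp add: mult_le_cancel_right_pos)
  qed
  then show ?thesis by (simp add: t_def S_def)
qed

text \<open>The summand is symmetric in \<open>i\<close> and \<open>j\<close> and vanishes on the
  diagonal, so the sum over \<open>i < j\<close> is half of the full double sum, which expands into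
  products of single sums.\<close>

lemma lagrange_identity:
  fixes x :: "real ^ 'd::{finite,linorder}" and a :: "'d \<Rightarrow> 'b::euclidean_space"
  shows "(\<Sum>i\<in>UNIV. \<Sum>j\<in>UNIV. if i < j then (norm (x $ i *\<^sub>R a j - x $ j *\<^sub>R a i))\<^sup>2 else 0) =
    x \<bullet> x * (\<Sum>j\<in>UNIV. (norm (a j))\<^sup>2) - (norm (\<Sum>i\<in>UNIV. x $ i *\<^sub>R a i))\<^sup>2"
proof -
  define T where "T i j = (norm (x $ i *\<^sub>R a j - x $ j *\<^sub>R a i))\<^sup>2" for i j
  let ?S = "\<Sum>i\<in>UNIV. \<Sum>j\<in>UNIV. if i < j then T i j else 0"
  have sym: "T i j = T j i" for i j unfolding T_def by (subst norm_minus_commute) simp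
  have "(\<Sum>i\<in>UNIV. \<Sum>j\<in>UNIV. T i j) = (\<Sum>i\<in>UNIV. \<Sum>j\<in>UNIV. (if i < j then T i j else 0) + (if j < i then T j i else 0))"
    by (intro sum.cong refl) (auto simp: sym T_def not_less_iff_gr_or_eq)
  also have "\<dots> = ?S + (\<Sum>i\<in>UNIV. \<Sum>j\<in>UNIV. if j < i then T j i else 0)" by (simp add: sum.distrib)
  also have "(\<Sum>i\<in>UNIV. \<Sum>j\<in>UNIV. if j < i then T j i else 0) = ?S" by (rule sum.swap)
  finally have 1: "(\<Sum>i\<in>UNIV. \<Sum>j\<in>UNIV. T i j) = 2 * ?S" by simp
  have T: "T i j = (x $ i * x $ i) * (norm (a j))\<^sup>2 + (x $ j * x $ j) * (norm (a i))\<^sup>2 - 2 * ((x $ i *\<^sub>R a i) \<bullet> (x $ j *\<^sub>R a j))" for i j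
    unfolding T_def power2_norm_eq_inner by (simp add: inner_diff_left inner_diff_right inner_commute algebra_simps)
  have "(\<Sum>i\<in>UNIV. \<Sum>j\<in>UNIV. T i j) = 2 * (x \<bullet> x * (\<Sum>j\<in>UNIV. (norm (a j))\<^sup>2)) - 2 * (norm (\<Sum>i\<in>UNIV. x $ i *\<^sub>R a i))\<^sup>2"
  proof -
    have "(\<Sum>i\<in>UNIV. \<Sum>j\<in>UNIV. (x $ i * x $ i) * (norm (a j))\<^sup>2) = x \<bullet> x * (\<Sum>j\<in>UNIV. (norm (a j))\<^sup>2)"
      by (simp add: inner_vec_def sum_product)
    moreover have "(\<Sum>i\<in>UNIV. \<Sum>j\<in>UNIV. (x $ j * x $ j) * (norm (a i))\<^sup>2) = x \<bullet> x * (\<Sum>j\<in>UNIV. (norm (a j))\<^sup>2)"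
      by (subst sum.swap) (simp add: inner_vec_def sum_product)
    moreover have "(\<Sum>i\<in>UNIV. \<Sum>j\<in>UNIV. (x $ i *\<^sub>R a i) \<bullet> (x $ j *\<^sub>R a j)) = (norm (\<Sum>i\<in>UNIV. x $ i *\<^sub>R a i))\<^sup>2"
      unfolding power2_norm_eq_inner inner_sum_left inner_sum_right by (rule sum.swap)
    ultimately show ?thesis unfolding T sum_subtractf sum.distrib by (simp flip: sum_distrib_left)
  qed
  then have "?S = x \<bullet> x * (\<Sum>j\<in>UNIV. (norm (a j))\<^sup>2) - (norm (\<Sum>i\<in>UNIV. x $ i *\<^sub>R a i))\<^sup>2" using 1 by linarith
  then show ?thesis unfolding T_def .
qed

text \<open>Taking the inner product with \<open>k\<close> commutes with the integrals, and a test
  function supported in \<open>V\<close> is also one for the larger set \<open>\<Omega>\<close>.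
  This passes from the regular set to \<open>U\<close> and from vector values to scalars at
  once.\<close>

lemma weak_gradient_component:
  fixes f :: "real ^ 'd \<Rightarrow> 'b::euclidean_space"
  assumes wg: "has_weak_gradient_on \<Omega> f N" and V: "V \<subseteq> \<Omega>" "V \<subseteq> cball 0 1" and \<Omega>: "open \<Omega>"
  shows "weak_gradient V (\<lambda>x. f x \<bullet> k) (\<lambda>x. \<chi> j. N x $ j \<bullet> k)"
  unfolding weak_gradient_def
proof (intro conjI allI impI)
  have loc: "integrable (lebesgue_on K) f" "integrable (lebesgue_on K) N" if "compact K" "K \<subseteq> \<Omega>" for K
    using wg that by (auto simp: has_weak_gradient_on_def locally_integrable_on_def)
  have Nj: "N x $ j \<bullet> c = N x \<bullet> axis j c" for x j c by (simp add: inner_axis)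
  have bl: "bounded_linear (\<lambda>v :: 'b ^ 'd. v $ j)" for j by (rule bounded_linear_vec_nth)
  fix K :: "(real ^ 'd) set"
  { assume K: "compact K \<and> K \<subseteq> V"
    then have l: "integrable (lebesgue_on K) f" "integrable (lebesgue_on K) N" using loc V(1) by auto
    show "integrable (lebesgue_on K) (\<lambda>x. f x \<bullet> k)" using l(1) by simp
    show "integrable (lebesgue_on K) (\<lambda>x. (\<chi> j. N x $ j \<bullet> k) $ j)" for j using l(2) by (simp add: Nj) }
  fix \<phi> \<phi>' j
  assume A: "compact K \<and> K \<subseteq> V \<and> (\<forall>x. x \<notin> K \<longrightarrow> \<phi> x = 0) \<and>
        (\<forall>x. GDERIV \<phi> x :> \<phi>' x) \<and> continuous_on UNIV \<phi>'"
  then have K: "compact K" "K \<subseteq> \<Omega>" "K \<subseteq> cball 0 1" and \<phi>: "\<And>x. x \<notin> K \<Longrightarrow> \<phi> x = 0"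
    "\<And>x. GDERIV \<phi> x :> \<phi>' x" "continuous_on UNIV \<phi>'" using V by auto
  have \<phi>'0: "\<phi>' x = 0" if "x \<notin> K" for x
    using GDERIV_zero_outside[OF \<phi>(2) compact_imp_closed[OF K(1)] \<phi>(1) that] .
  have Kl: "K \<in> sets lebesgue" and \<Omega>l: "\<Omega> \<in> sets lebesgue"
    using K(1) \<Omega> by (simp_all add: compact_imp_closed)
  have Njint: "integrable (lebesgue_on K) (\<lambda>x. N x $ j)"
    by (rule integrable_bounded_linear[OF bl loc(2)[OF K(1,2)]])
  have i1: "integrable (lebesgue_on \<Omega>) (\<lambda>x. (\<phi>' x $ j) *\<^sub>R f x)"
    by (rule integrable_compact_support_scaleR[OF K(1,2) \<Omega>l loc(1)[OF K(1,2)]])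
       (auto intro!: continuous_intros \<phi>(3) simp: \<phi>'0)
  have i2: "integrable (lebesgue_on \<Omega>) (\<lambda>x. \<phi> x *\<^sub>R N x $ j)"
    by (rule integrable_compact_support_scaleR[OF K(1,2) \<Omega>l Njint GDERIV_continuous_on[OF \<phi>(2)] \<phi>(1)])
  have eq: "(LINT x|lebesgue_on \<Omega>. (\<phi>' x $ j) *\<^sub>R f x) = - (LINT x|lebesgue_on \<Omega>. \<phi> x *\<^sub>R (N x $ j))"
    using wg A V(1) unfolding has_weak_gradient_on_def by blast
  have to_\<Omega>: "(LINT x|unit_ball. h x) = (LINT x|lebesgue_on \<Omega>. h x)" if "\<And>x. x \<notin> K \<Longrightarrow> h x = 0" for h :: "real ^ 'd \<Rightarrow> real"
    using lebesgue_on_zero_outside(2)[OF _ Kl that K(3)] lebesgue_on_zero_outside(2)[OF \<Omega>l Kl that K(2)] by simp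
  have "(LINT x|unit_ball. \<phi>' x $ j * (f x \<bullet> k)) = (LINT x|lebesgue_on \<Omega>. ((\<phi>' x $ j) *\<^sub>R f x) \<bullet> k)"
    by (subst to_\<Omega>) (auto simp: \<phi>'0)
  also have "\<dots> = (LINT x|lebesgue_on \<Omega>. (\<phi>' x $ j) *\<^sub>R f x) \<bullet> k"
    by (rule integral_inner_left) (rule i1)
  also have "\<dots> = - ((LINT x|lebesgue_on \<Omega>. \<phi> x *\<^sub>R N x $ j) \<bullet> k)" unfolding eq by simp
  also have "(LINT x|lebesgue_on \<Omega>. \<phi> x *\<^sub>R N x $ j) \<bullet> k = (LINT x|lebesgue_on \<Omega>. (\<phi> x *\<^sub>R N x $ j) \<bullet> k)"
    by (rule integral_inner_left[symmetric]) (rule i2)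
  also have "\<dots> = (LINT x|unit_ball. \<phi> x * (\<chi> j. N x $ j \<bullet> k) $ j)"
    by (subst to_\<Omega>) (auto simp: \<phi>)
  finally show "(LINT x|unit_ball. \<phi>' x $ j * (f x \<bullet> k)) = - (LINT x|unit_ball. \<phi> x * (\<chi> j. N x $ j \<bullet> k) $ j)" .
qed

lemma integrable_lebesgue_on_subset:
  fixes f :: "'a::euclidean_space \<Rightarrow> real"
  assumes "integrable (lebesgue_on S) f" "T \<subseteq> S" "S \<in> sets lebesgue" "T \<in> sets lebesgue"
  shows "integrable (lebesgue_on T) f"
proof -
  have "set_integrable lebesgue S f"
    using assms by (simp add: integrable_restrict_space set_integrable_def)
  then have "set_integrable lebesgue T f" using assms by (rule_tac set_integrable_subset) auto
  then show ?thesis using assms by (simp add: integrable_restrict_space set_integrable_def)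
qed

text \<open>Openness supplies the measurability of the domain of integration in the weak
  gradient.\<close>

lemma open_regular_set: "open (regular_set Rp \<kappa> \<mu>)"
proof -
  have "regular_set Rp \<kappa> \<mu> = \<Union>{ball x \<epsilon> | x \<epsilon>. \<epsilon> > 0 \<and> ball x \<epsilon> \<subseteq> ball 0 1 \<and>
      integrable (lebesgue_on (ball x \<epsilon>)) (\<lambda>y. 1 / W_weight Rp \<kappa> \<mu> y)}" (is "_ = \<Union>?B")
  proof (intro equalityI subsetI)
    fix x assume "x \<in> regular_set Rp \<kappa> \<mu>"
    then obtain \<epsilon> where "\<epsilon> > 0" "ball x \<epsilon> \<in> ?B" unfolding regular_set_def by blast
    then show "x \<in> \<Union>?B" by (intro UnionI[of "ball x \<epsilon>"]) auto
  next
    fix y assume "y \<in> \<Union>?B"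
    then obtain x \<epsilon> where y: "y \<in> ball x \<epsilon>" and b: "ball x \<epsilon> \<subseteq> ball 0 1"
      and i: "integrable (lebesgue_on (ball x \<epsilon>)) (\<lambda>y. 1 / W_weight Rp \<kappa> \<mu> y)" by blast
    obtain d where d: "d > 0" "ball y d \<subseteq> ball x \<epsilon>" using y open_contains_ball open_ball by blast
    have "integrable (lebesgue_on (ball y d)) (\<lambda>y. 1 / W_weight Rp \<kappa> \<mu> y)"
      by (rule integrable_lebesgue_on_subset[OF i d(2)]) auto
    then show "y \<in> regular_set Rp \<kappa> \<mu>" unfolding regular_set_def using d b by blast
  qed
  then show ?thesis by (auto intro!: open_Union)
qed

context dunkl_ball
begin

lemma open_U: "open U"
proof -
  have "U = ball 0 1 \<inter> (\<Inter>v\<in>Rp. {x. x \<bullet> v \<noteq> 0})" by (auto simp: U_def)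
  then show ?thesis
    using finite_Rp by (auto intro!: open_Int open_INT open_Collect_neq continuous_intros)
qed

lemma W_pos: "x \<in> U \<Longrightarrow> 0 < W x"
  unfolding W_weight_def h_weight_def U_def
  by (auto intro!: mult_pos_pos zero_less_power prod_pos simp: power_less_one_iff abs_square_less_1 dest: nonzero_Rp)
    (metis abs_norm_cancel abs_square_less_1 less_irrefl)

lemma continuous_W: "continuous_on U W"
  unfolding W_weight_def[abs_def] h_weight_def
proof (intro continuous_intros ballI)
  fix x assume x: "x \<in> U"
  show "\<bar>x \<bullet> v\<bar> \<noteq> 0" if "v \<in> Rp" for v using x that by (auto simp: U_def)
  have "(norm x)\<^sup>2 < 1" using x by (auto simp: U_def abs_square_less_1)
  then show "1 - (norm x)\<^sup>2 \<noteq> 0" by simp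
qed

text \<open>On a closed ball inside \<open>U\<close> the weight is continuous and positive, so its
  reciprocal is continuous and integrable.\<close>

lemma U_subset_regular_set: "U \<subseteq> regular_set Rp \<kappa> \<mu>"
proof
  fix x assume "x \<in> U"
  then obtain e where e: "e > 0" "cball x e \<subseteq> U" using open_U open_contains_cball by blast
  have "continuous_on (cball x e) (\<lambda>y. 1 / W y)"
    using e(2) W_pos by (intro continuous_intros continuous_on_subset[OF continuous_W]) force+
  then have "integrable (lebesgue_on (cball x e)) (\<lambda>y. 1 / W y)"
    by (intro integrable_continuous_compact_lebesgue) auto
  then have "integrable (lebesgue_on (ball x e)) (\<lambda>y. 1 / W y)"
    by (rule integrable_lebesgue_on_subset) auto
  moreover have "ball x e \<subseteq> ball 0 1" using e(2) ball_subset_cball by (fastforce simp: U_def)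
  ultimately show "x \<in> regular_set Rp \<kappa> \<mu>" using e(1) by (auto simp: regular_set_def)
qed

text \<open>For a root \<open>v\<close> the reflection changes the sign of
  \<open>x \<bullet> v\<close> and preserves \<open>F\<close> and the measure, so the integral is
  its own negative; linearity extends this to the span.\<close>

lemma integral_inner_invariant:
  fixes F :: "real ^ 'd \<Rightarrow> real"
  assumes F: "integrable \<nu> F" "invariant F" and y: "y \<in> span Rp"
  shows "(LINT x|\<nu>. (x \<bullet> y) * F x) = 0"
proof -
  have int: "integrable \<nu> (\<lambda>x. (x \<bullet> w) * F x)" for w
    by (intro integrable_continuous_mult F continuous_intros)
  show ?thesis using y
  proof (induction rule: span_induct)
    case base
    show ?case by (auto simp: subspace_def inner_add_right distrib_right int mult.assoc)
  next
    case (step v)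
    note G = reflection_in_group[OF step]
    have m: "(\<lambda>x. (x \<bullet> v) * F x) \<in> borel_measurable \<nu>" using int by auto
    have m': "(\<lambda>x. (reflection v x \<bullet> v) * F (reflection v x)) \<in> borel_measurable \<nu>"
      using measurable_compose[OF group_measurable[OF G] m] .
    have "(LINT x|\<nu>. (x \<bullet> v) * F x) = (LINT x|\<nu>. (reflection v x \<bullet> v) * F (reflection v x))"
      using integral_group[OF G m] by simp
    also have "\<dots> = (LINT x|\<nu>. - ((x \<bullet> v) * F x))"
    proof (rule integral_cong_AE)
      have "AE x in \<nu>. F (reflection v x) = F x" using F(2) step by (auto simp: invariant_def)
      then show "AE x in \<nu>. (reflection v x \<bullet> v) * F (reflection v x) = - ((x \<bullet> v) * F x)"
        by eventually_elim (simp add: inner_reflection_self)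
    qed (use m m' in auto)
    finally show ?case by simp
  qed
qed

end

section \<open>From scalar components to the function \<open>f\<close>\<close>

lemma power2_norm_Basis: "(norm y)\<^sup>2 = (\<Sum>k\<in>Basis. (y \<bullet> k)\<^sup>2)"
  for y :: "'a::euclidean_space"
  unfolding power2_norm_eq_inner by (subst euclidean_inner) (simp add: power2_eq_square)

lemma power2_norm_vec: "(norm v)\<^sup>2 = (\<Sum>i\<in>UNIV. (norm (v $ i))\<^sup>2)"
  for v :: "'a::euclidean_space ^ 'n"
  by (simp add: power2_norm_eq_inner inner_vec_def)

definition component :: "('a \<Rightarrow> 'b::euclidean_space) \<Rightarrow> 'b \<Rightarrow> 'a \<Rightarrow> real" where
  "component f k x = f x \<bullet> k"

definition component_grad :: "('a \<Rightarrow> 'b::euclidean_space ^ 'd) \<Rightarrow> 'b \<Rightarrow> 'a \<Rightarrow> real ^ 'd" where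
  "component_grad N k x = (\<chi> j. N x $ j \<bullet> k)"

context dunkl_ball
begin

abbreviation b where "b \<equiv> b_const Rp \<kappa> \<mu>"

text \<open>The energy with both of its terms normalised by the constant for \<open>\<mu>\<close>;
  it is a sum of scalar energies, to which the preceding inequalities apply.\<close>

definition component_energy :: "(real ^ 'd \<Rightarrow> 'b::euclidean_space ^ 'd) \<Rightarrow> real" where
  "component_energy N = b * (\<Sum>k\<in>Basis. En (component_grad N k) (component_grad N k))"

context
  fixes f :: "real ^ 'd \<Rightarrow> 'b::euclidean_space" and N :: "real ^ 'd \<Rightarrow> 'b ^ 'd"
  assumes f: "f \<in> L2_space Rp \<kappa> \<mu>" and N: "N \<in> L2_space Rp \<kappa> \<mu>"
    and wg: "has_weak_gradient_on (regular_set Rp \<kappa> \<mu>) f N"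
    and inv: "group_invariant Rp f"
    and mean: "(LINT x|unit_ball. W x *\<^sub>R f x) = 0"
    and norm1: "L2_norm Rp \<kappa> \<mu> f = 1"
begin

lemma f_measurable: "f \<in> borel_measurable unit_ball" and N_measurable: "N \<in> borel_measurable unit_ball"
  using f N by (auto simp: L2_space_def)

lemma integrable_norm_f: "integrable \<nu> (\<lambda>x. (norm (f x))\<^sup>2)"
  and integrable_norm_N: "integrable \<nu> (\<lambda>x. (norm (N x))\<^sup>2)"
  using f N f_measurable N_measurable by (auto simp: L2_space_def integrable_\<nu>_iff mult.commute)

lemma integral_norm_f: "b * (LINT x|\<nu>. (norm (f x))\<^sup>2) = 1"
  using norm1 f_measurable by (simp add: L2_norm_def integral_\<nu> mult.commute)

lemma b_pos: "b > 0"
proof -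
  have "0 \<le> (LINT x|\<nu>. (norm (f x))\<^sup>2)" by (rule Bochner_Integration.integral_nonneg) auto
  then show ?thesis using integral_norm_f by (metis mult_nonpos_nonneg not_less not_one_le_zero)
qed

lemma b_measure: "b * measure \<nu> (space \<nu>) = 1"
proof -
  have "measure \<nu> (space \<nu>) = (LINT x|\<nu>. 1)" by simp
  also have "\<dots> = (LINT x|unit_ball. W x)" by (subst integral_\<nu>) auto
  finally show ?thesis using b_pos by (auto simp: b_const_def)
qed

lemma norm_f_comp: "(norm (f x))\<^sup>2 = (\<Sum>k\<in>Basis. (component f k x)\<^sup>2)"
  unfolding component_def by (rule power2_norm_Basis)

lemma norm_N_comp: "(norm (N x))\<^sup>2 = (\<Sum>k\<in>Basis. (norm (component_grad N k x))\<^sup>2)"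
proof -
  have "(norm (N x))\<^sup>2 = (\<Sum>j\<in>UNIV. \<Sum>k\<in>Basis. (N x $ j \<bullet> k) * (N x $ j \<bullet> k))"
    unfolding power2_norm_eq_inner inner_vec_def by (rule sum.cong[OF refl]) (rule euclidean_inner)
  also have "\<dots> = (\<Sum>k\<in>Basis. \<Sum>j\<in>UNIV. (N x $ j \<bullet> k) * (N x $ j \<bullet> k))" by (rule sum.swap)
  finally show ?thesis unfolding power2_norm_eq_inner by (simp add: inner_vec_def component_grad_def)
qed

lemma sobolev_comp: assumes k: "k \<in> Basis" shows "sobolev (component f k) (component_grad N k)"
proof -
  have fm: "component f k \<in> borel_measurable \<nu>" using f_measurable by (simp add: component_def[abs_def])
  have "component_grad N k = (\<lambda>x. \<chi> j. N x \<bullet> axis j k)" by (simp add: component_grad_def fun_eq_iff inner_axis)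
  moreover have "(\<lambda>x. \<chi> j. N x \<bullet> axis j k) \<in> borel_measurable unit_ball"
  proof (subst borel_measurable_euclidean_space, intro ballI)
    fix i :: "real ^ 'd" assume "i \<in> Basis"
    then obtain j where "i = axis j 1" by (auto simp: Basis_vec_def)
    moreover have "(\<lambda>x. N x \<bullet> axis j k) \<in> borel_measurable unit_ball"
      using N_measurable by (intro borel_measurable_inner borel_measurable_const)
    ultimately show "(\<lambda>x. (\<chi> j. N x \<bullet> axis j k) \<bullet> i) \<in> borel_measurable unit_ball"
      by (simp add: inner_axis)
  qed
  ultimately have gm: "component_grad N k \<in> borel_measurable \<nu>" by simp
  have "integrable \<nu> (\<lambda>x. (component f k x)\<^sup>2)"
    by (rule Bochner_Integration.integrable_bound[OF integrable_norm_f])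
       (use fm k in \<open>auto simp: norm_f_comp sum_nonneg intro!: member_le_sum AE_I2\<close>)
  moreover have "integrable \<nu> (\<lambda>x. (norm (component_grad N k x))\<^sup>2)"
    by (rule Bochner_Integration.integrable_bound[OF integrable_norm_N])
       (use gm k in \<open>auto simp: norm_N_comp sum_nonneg intro!: member_le_sum AE_I2\<close>)
  moreover have "weak_gradient U (component f k) (component_grad N k)"
    unfolding component_def[abs_def] component_grad_def[abs_def]
    by (rule weak_gradient_component[OF wg U_subset_regular_set _ open_regular_set]) (auto simp: U_def)
  ultimately show ?thesis using fm gm by (simp add: sobolev_def square_integrable_def)
qed

lemma invariant_f: "v \<in> Rp \<Longrightarrow> AE x in \<nu>. f (reflection v x) = f x"
  using inv AE_\<nu> by (auto simp: group_invariant_def)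

lemma invariant_compose: "invariant (\<lambda>x. h (f x))"
  unfolding invariant_def
proof
  fix v assume "v \<in> Rp"
  from invariant_f[OF this] show "AE x in \<nu>. h (f (reflection v x)) = h (f x)" by eventually_elim simp
qed

lemma invariant_comp: "invariant (component f k)"
  unfolding component_def[abs_def] by (rule invariant_compose)

lemma mean_comp: assumes k: "k \<in> Basis" shows "ip (\<lambda>x. 1) (component f k) = 0"
proof -
  have "integrable \<nu> (\<lambda>x. 1 + (norm (f x))\<^sup>2)" using integrable_norm_f by simp
  then have "integrable \<nu> f"
  proof (rule Bochner_Integration.integrable_bound)
    have "norm (f x) \<le> 1 + (norm (f x))\<^sup>2" for x
      using zero_le_power2[of "norm (f x) - 1/2"] by (simp add: power2_eq_square algebra_simps)
    then show "AE x in \<nu>. norm (f x) \<le> norm (1 + (norm (f x))\<^sup>2)" by simp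
  qed (use f_measurable in simp)
  then have "(LINT x|\<nu>. f x \<bullet> k) = (LINT x|\<nu>. f x) \<bullet> k" by (intro integral_inner_left) auto
  also have "(LINT x|\<nu>. f x) = 0" using mean f_measurable by (simp add: integral_\<nu>)
  finally show ?thesis by (simp add: ip_def component_def)
qed

text \<open>Every component inherits invariance and mean zero, so the Poincare inequality applies to
  each; the normalised squared norms add up to 1.\<close>

lemma component_energy_ge: "1 + 2 * lam \<le> component_energy N"
proof -
  have "(LINT x|\<nu>. (norm (f x))\<^sup>2) = (\<Sum>k\<in>Basis. ip (component f k) (component f k))"
    using sobolev_comp unfolding norm_f_comp ip_def
    by (subst Bochner_Integration.integral_sum) (auto simp: sobolev_def square_integrable_def power2_eq_square)
  then have "1 + 2 * lam = b * (\<Sum>k\<in>Basis. (1 + 2 * lam) * ip (component f k) (component f k))"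
    using integral_norm_f by (simp flip: sum_distrib_left add: mult.left_commute)
  also have "\<dots> \<le> component_energy N"
    unfolding component_energy_def using b_pos
    by (intro mult_left_mono sum_mono poincare sobolev_comp invariant_comp mean_comp) auto
  finally show ?thesis .
qed

text \<open>With \<open>F\<close> the squared norm of \<open>f\<close>, \<open>b * F\<close> is a
  probability density for \<open>\<nu>\<close>, and by invariance \<open>M i\<close> is the mean of
  \<open>x \<bullet> w\<close> under it. Both bounds on \<open>M i\<close> compare it with the
  second moment \<open>Q\<close>.\<close>

lemma coordinate_moment:
  defines "M i \<equiv> b * (LINT x|\<nu>. x $ i * (norm (f x))\<^sup>2)"
  shows "(M i)\<^sup>2 \<le> 1" and "c > 0 \<Longrightarrow> (1 + 2 * lam) * M i \<le> c * (1 - (M i)\<^sup>2) + component_energy N / c"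
    and "b * (LINT x|unit_ball. (1 - x $ i) * (norm (f x))\<^sup>2 * W x) = 1 - M i"
proof -
  define F where "F x = (norm (f x))\<^sup>2" for x
  have F: "integrable \<nu> F" using integrable_norm_f by (simp add: F_def[abs_def])
  have Fm: "F \<in> borel_measurable \<nu>" using F by auto
  have F1: "b * (LINT x|\<nu>. F x) = 1" using integral_norm_f by (simp add: F_def)
  have "invariant F" unfolding F_def[abs_def] by (rule invariant_compose)
  note int = integrable_continuous_mult[OF _ F]
  \<comment> \<open>By invariance only the component \<open>w\<close> orthogonal to all roots contributes to the moment, and for
    the invariant linear function \<open>\<langle>x, w\<rangle>\<close> the integration by parts has no singular terms.\<close>
  obtain y w where y: "y \<in> span Rp" and w: "\<And>v. v \<in> span Rp \<Longrightarrow> orthogonal w v" and yw: "axis i 1 = y + w"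
    using orthogonal_subspace_decomp_exists[of Rp "axis i (1::real)"] by metis
  have w0: "w \<bullet> v = 0" if "v \<in> Rp" for v using w[OF span_base[OF that]] by (simp add: orthogonal_def)
  have "(axis i 1 :: real ^ 'd) \<bullet> axis i 1 = y \<bullet> y + w \<bullet> w"
    unfolding yw using w[OF y] by (simp add: orthogonal_def inner_add_left inner_add_right inner_commute)
  then have ww: "w \<bullet> w \<le> 1" using inner_ge_zero[of y] by (simp add: inner_axis del: inner_ge_zero)
  have Mw: "M i = b * (LINT x|\<nu>. (x \<bullet> w) * F x)"
  proof -
    have "(LINT x|\<nu>. x $ i * F x) = (LINT x|\<nu>. (x \<bullet> y) * F x + (x \<bullet> w) * F x)"
    proof -
      have "x $ i = x \<bullet> axis i 1" for x :: "real ^ 'd" by (simp add: inner_axis)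
      then show ?thesis unfolding yw by (simp add: inner_add_right distrib_right)
    qed
    also have "\<dots> = (LINT x|\<nu>. (x \<bullet> y) * F x) + (LINT x|\<nu>. (x \<bullet> w) * F x)"
      by (intro Bochner_Integration.integral_add int continuous_intros)
    finally show ?thesis using integral_inner_invariant[OF F \<open>invariant F\<close> y] by (simp add: M_def F_def)
  qed
  define Q where "Q = b * (LINT x|\<nu>. (x \<bullet> w)\<^sup>2 * F x)"
  \<comment> \<open>Nonnegativity of the variance of \<open>x \<bullet> w\<close> under the density
    \<open>b * F\<close>.\<close>
  have MQ: "(M i)\<^sup>2 \<le> Q"
  proof -
    have "0 \<le> (LINT x|\<nu>. (x \<bullet> w - M i)\<^sup>2 * F x)"
      by (rule Bochner_Integration.integral_nonneg) (simp add: F_def)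
    also have "(\<lambda>x. (x \<bullet> w - M i)\<^sup>2 * F x) = (\<lambda>x. (x \<bullet> w)\<^sup>2 * F x - 2 * M i * ((x \<bullet> w) * F x) + (M i)\<^sup>2 * F x)"
      by (simp add: fun_eq_iff power2_eq_square algebra_simps)
    also have "(LINT x|\<nu>. (x \<bullet> w)\<^sup>2 * F x - 2 * M i * ((x \<bullet> w) * F x) + (M i)\<^sup>2 * F x) =
        (LINT x|\<nu>. (x \<bullet> w)\<^sup>2 * F x) - 2 * M i * (LINT x|\<nu>. (x \<bullet> w) * F x) + (M i)\<^sup>2 * (LINT x|\<nu>. F x)"
      using F by (simp add: int continuous_intros)
    finally have "0 \<le> b * ((LINT x|\<nu>. (x \<bullet> w)\<^sup>2 * F x) - 2 * M i * (LINT x|\<nu>. (x \<bullet> w) * F x) + (M i)\<^sup>2 * (LINT x|\<nu>. F x))"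
      using b_pos by simp
    also have "\<dots> = Q - 2 * M i * (b * (LINT x|\<nu>. (x \<bullet> w) * F x)) + (M i)\<^sup>2 * (b * (LINT x|\<nu>. F x))"
      by (simp add: Q_def algebra_simps)
    also have "\<dots> = Q - (M i)\<^sup>2" unfolding F1 Mw[symmetric] by (simp add: power2_eq_square)
    finally show ?thesis by simp
  qed
  have \<Gamma>w: "b * (LINT x|\<nu>. \<Gamma> x w w * F x) = w \<bullet> w - Q"
  proof -
    have "(LINT x|\<nu>. \<Gamma> x w w * F x) = (LINT x|\<nu>. (w \<bullet> w) * F x - (x \<bullet> w)\<^sup>2 * F x)"
      by (simp add: \<Gamma>_def power2_eq_square left_diff_distrib)
    also have "\<dots> = (w \<bullet> w) * (LINT x|\<nu>. F x) - (LINT x|\<nu>. (x \<bullet> w)\<^sup>2 * F x)"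
      using F by (simp add: int continuous_intros)
    finally have "b * (LINT x|\<nu>. \<Gamma> x w w * F x) = b * ((w \<bullet> w) * (LINT x|\<nu>. F x) - (LINT x|\<nu>. (x \<bullet> w)\<^sup>2 * F x))"
      by simp
    also have "\<dots> = (w \<bullet> w) * (b * (LINT x|\<nu>. F x)) - Q"
      unfolding Q_def right_diff_distrib by (simp only: mult.left_commute)
    finally show ?thesis by (simp add: F1)
  qed
  have "0 \<le> (LINT x|\<nu>. \<Gamma> x w w * F x)"
    by (intro integral_nonneg_AE AE_I2) (auto simp: F_def intro!: mult_nonneg_nonneg \<Gamma>_nonneg)
  then have "0 \<le> w \<bullet> w - Q" unfolding \<Gamma>w[symmetric] using b_pos by simp
  then show "(M i)\<^sup>2 \<le> 1" using MQ ww by linarith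
  show "(1 + 2 * lam) * M i \<le> c * (1 - (M i)\<^sup>2) + component_energy N / c" if c: "c > 0"
  proof -
    define a where "a x = (1 + 2 * lam) * (x \<bullet> w) - c * \<Gamma> x w w" for x
    have conta: "continuous_on UNIV a" unfolding a_def \<Gamma>_def by (intro continuous_intros)
    have inta: "integrable \<nu> (\<lambda>x. a x * (component f k x)\<^sup>2)" if "k \<in> Basis" for k
    proof (rule Bochner_Integration.integrable_bound[OF int[OF conta]])
      have "component f k \<in> borel_measurable \<nu>" using sobolev_comp[OF that] by (simp add: sobolev_def square_integrable_def)
      then show "(\<lambda>x. a x * (component f k x)\<^sup>2) \<in> borel_measurable \<nu>"
        using continuous_imp_\<nu>[OF conta] by (intro borel_measurable_times borel_measurable_power)
      show "AE x in \<nu>. norm (a x * (component f k x)\<^sup>2) \<le> norm (a x * F x)"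
        using that by (intro AE_I2) (auto simp: abs_mult F_def norm_f_comp sum_nonneg intro!: mult_left_mono member_le_sum)
    qed
    have "(LINT x|\<nu>. a x * F x) = (\<Sum>k\<in>Basis. LINT x|\<nu>. a x * (component f k x)\<^sup>2)"
      unfolding F_def norm_f_comp sum_distrib_left by (rule Bochner_Integration.integral_sum) (rule inta)
    also have "\<dots> \<le> (\<Sum>k\<in>Basis. En (component_grad N k) (component_grad N k) / c)"
      unfolding a_def by (intro sum_mono uncertainty sobolev_comp invariant_comp w0 c)
    finally have "b * (LINT x|\<nu>. a x * F x) \<le> component_energy N / c"
      using b_pos by (simp add: component_energy_def mult_left_mono flip: sum_divide_distrib times_divide_eq_right)
    moreover have "b * (LINT x|\<nu>. a x * F x) = (1 + 2 * lam) * M i - c * (w \<bullet> w - Q)"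
    proof -
      have cg: "continuous_on UNIV (\<lambda>x. \<Gamma> x w w)" unfolding \<Gamma>_def by (intro continuous_intros)
      have "(\<lambda>x. a x * F x) = (\<lambda>x. (1 + 2 * lam) * ((x \<bullet> w) * F x) - c * (\<Gamma> x w w * F x))"
        by (simp add: a_def fun_eq_iff algebra_simps)
      then have "(LINT x|\<nu>. a x * F x) = (1 + 2 * lam) * (LINT x|\<nu>. (x \<bullet> w) * F x) - c * (LINT x|\<nu>. \<Gamma> x w w * F x)"
        using int[OF cg] by (simp add: int continuous_intros)
      then show ?thesis
        unfolding Mw \<Gamma>w[symmetric] by (simp only: right_diff_distrib mult.left_commute)
    qed
    \<comment> \<open>The vector \<open>w\<close> is a projection of a unit vector, so its length is
      at most 1, and the second moment dominates the squared mean.\<close>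
    moreover have "c * (w \<bullet> w - Q) \<le> c * (1 - (M i)\<^sup>2)" using c ww MQ by (intro mult_left_mono) auto
    ultimately show ?thesis by linarith
  qed
  have "(\<lambda>x. (1 - x $ i) * F x) \<in> borel_measurable \<nu>" by (intro borel_measurable_integrable int continuous_intros)
  then have "(LINT x|unit_ball. (1 - x $ i) * F x * W x) = (LINT x|\<nu>. (1 - x $ i) * F x)"
    by (simp add: integral_\<nu> mult_ac)
  also have "\<dots> = (LINT x|\<nu>. F x - x $ i * F x)" by (simp add: left_diff_distrib)
  also have "\<dots> = (LINT x|\<nu>. F x) - (LINT x|\<nu>. x $ i * F x)"
    by (intro Bochner_Integration.integral_diff F int continuous_intros)
  finally show "b * (LINT x|unit_ball. (1 - x $ i) * (norm (f x))\<^sup>2 * W x) = 1 - M i"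
    using F1 by (simp add: M_def F_def right_diff_distrib)
qed

lemma W_weight_Suc: "x \<in> cball 0 1 \<Longrightarrow> W_weight Rp \<kappa> (\<mu> + 1) x = (1 - (norm x)\<^sup>2) * W x"
proof -
  assume "x \<in> cball 0 1"
  then have "0 \<le> 1 - (norm x)\<^sup>2" by (simp add: power_le_one_iff)
  then have "(1 - (norm x)\<^sup>2) powr (\<mu> + 1 - 1/2) = (1 - (norm x)\<^sup>2) * (1 - (norm x)\<^sup>2) powr (\<mu> - 1/2)"
    using powr_add[of "1 - (norm x)\<^sup>2" 1 "\<mu> - 1/2"] by (simp add: algebra_simps)
  then show ?thesis by (simp add: W_weight_def mult_ac)
qed

text \<open>Inside the ball the weight for \<open>\<mu> + 1\<close> carries the extra factor
  \<open>1 - (norm x)\<^sup>2\<close>, which is at most 1. Since \<open>inverse 0 = 0\<close>, the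
  comparison of reciprocals also needs the smaller integral to be strictly positive.\<close>

lemma b_const_mono: "b \<le> b_const Rp \<kappa> (\<mu> + 1)"
proof -
  have c: "continuous_on UNIV (\<lambda>x :: real ^ 'd. 1 - (norm x)\<^sup>2)" by (intro continuous_intros)
  have eq: "(LINT x|unit_ball. W_weight Rp \<kappa> (\<mu> + 1) x) = (LINT x|\<nu>. 1 - (norm x)\<^sup>2)"
    using continuous_imp_\<nu>[OF c] by (subst integral_\<nu>)
      (auto intro!: Bochner_Integration.integral_cong simp: W_weight_Suc mult.commute simp del: mem_cball)
  have eq1: "(LINT x|unit_ball. W x) = (LINT x|\<nu>. 1)" by (subst integral_\<nu>) auto
  have "(LINT x|\<nu>. 1 - (norm x)\<^sup>2) \<le> (LINT x|\<nu>. 1)"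
    by (intro integral_mono integrable_continuous[OF c]) auto
  moreover have "(LINT x|\<nu>. 1 - (norm x)\<^sup>2) > 0"
  proof (rule ccontr)
    assume "\<not> ?thesis"
    moreover have nn: "AE x in \<nu>. 0 \<le> 1 - (norm x)\<^sup>2" by (rule AE_I2) (simp add: power_le_one_iff)
    ultimately have "(LINT x|\<nu>. 1 - (norm x)\<^sup>2) = 0" using integral_nonneg_AE[OF nn] by simp
    then have "AE x in \<nu>. 1 - (norm x)\<^sup>2 = 0"
      using integral_nonneg_eq_0_iff_AE[OF integrable_continuous[OF c] nn] by simp
    moreover have "AE x in \<nu>. x \<in> U" using AE_\<nu>[OF AE_U] .
    ultimately have "AE x in \<nu>. False"
    proof eventually_elim
      case (elim x)
      then have "\<bar>norm x\<bar> < 1" by (simp add: U_def)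
      then have "(norm x)\<^sup>2 < 1" by (simp only: abs_square_less_1)
      then show ?case using elim by simp
    qed
    then have "emeasure \<nu> (space \<nu>) = 0" using emeasure_eq_0_AE[of "\<lambda>x. True" \<nu>] by (simp del: space_\<nu>)
    then have "measure \<nu> (space \<nu>) = 0" by (simp add: measure_def)
    then show False using b_measure by simp
  qed
  ultimately show ?thesis unfolding b_const_def eq eq1 by (simp add: le_imp_inverse_le)
qed

end

end

lemma power2_L2_norm:
  "(L2_norm Rp \<kappa> m g)\<^sup>2 = b_const Rp \<kappa> m * (LINT x|unit_ball. (norm (g x))\<^sup>2 * W_weight Rp \<kappa> m x)"
proof -
  have "0 \<le> (LINT x|unit_ball. (norm (g x))\<^sup>2 * W_weight Rp \<kappa> m x)"
    by (rule Bochner_Integration.integral_nonneg) (simp add: W_weight_nonneg)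
  moreover have "0 \<le> b_const Rp \<kappa> m"
    unfolding b_const_def inverse_nonnegative_iff_nonnegative
    by (rule Bochner_Integration.integral_nonneg) (simp add: W_weight_nonneg)
  ultimately show ?thesis by (simp add: L2_norm_def)
qed

text \<open>The last term of Lagrange's identity is expanded over an orthonormal basis of the value
  space, which matches the radial term of \<open>\<Gamma>\<close> for each component.\<close>

lemma power2_norm_nabla_D:
  fixes f :: "real ^ 'd::{finite,linorder} \<Rightarrow> 'b::euclidean_space"
  shows "(norm (nabla_D Rp \<kappa> \<mu> f x))\<^sup>2 =
    x \<bullet> x * (norm (nabla Rp \<kappa> \<mu> f x))\<^sup>2 - (\<Sum>k\<in>Basis. (x \<bullet> (\<chi> j. nabla Rp \<kappa> \<mu> f x $ j \<bullet> k))\<^sup>2)"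
proof -
  let ?N = "nabla Rp \<kappa> \<mu> f x"
  have "(norm (nabla_D Rp \<kappa> \<mu> f x))\<^sup>2 = (\<Sum>p\<in>UNIV \<times> UNIV. (norm (nabla_D Rp \<kappa> \<mu> f x $ p))\<^sup>2)"
    unfolding UNIV_Times_UNIV by (rule power2_norm_vec)
  also have "\<dots> = (\<Sum>i\<in>UNIV. \<Sum>j\<in>UNIV. (norm (nabla_D Rp \<kappa> \<mu> f x $ (i, j)))\<^sup>2)"
    by (simp only: sum.cartesian_product case_prod_unfold prod.collapse)
  also have "\<dots> = (\<Sum>i\<in>UNIV. \<Sum>j\<in>UNIV. if i < j then (norm (x $ i *\<^sub>R ?N $ j - x $ j *\<^sub>R ?N $ i))\<^sup>2 else 0)"
    by (intro sum.cong refl) (simp add: nabla_D_def)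
  also have "\<dots> = x \<bullet> x * (\<Sum>j\<in>UNIV. (norm (?N $ j))\<^sup>2) - (norm (\<Sum>i\<in>UNIV. x $ i *\<^sub>R ?N $ i))\<^sup>2"
    by (rule lagrange_identity)
  also have "(norm (\<Sum>i\<in>UNIV. x $ i *\<^sub>R ?N $ i))\<^sup>2 = (\<Sum>k\<in>Basis. (x \<bullet> (\<chi> j. ?N $ j \<bullet> k))\<^sup>2)"
    unfolding power2_norm_Basis[of "sum _ _"] by (simp add: inner_sum_left inner_vec_def)
  finally show ?thesis by (simp add: power2_norm_vec)
qed

theorem theorem5p1:
  fixes Rp :: "(real ^ 'd::{finite,linorder}) set"
    and \<kappa> :: "real ^ 'd::{finite,linorder} \<Rightarrow> real"
    and \<mu> :: real
    and f :: "real ^ 'd::{finite,linorder} \<Rightarrow> 'b::{real_normed_field,euclidean_space}"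
  assumes "positive_root_system Rp"
    and "multiplicity_function Rp \<kappa>"
    and "\<mu> \<ge> 0"
    and "f \<in> W21_space Rp \<kappa> \<mu>"
    and "group_invariant Rp f"
    and "(LINT x|unit_ball. W_weight Rp \<kappa> \<mu> x *\<^sub>R f x) = 0"
    and "L2_norm Rp \<kappa> \<mu> f = 1"
  shows "(MIN i. b_const Rp \<kappa> \<mu> *
            (LINT x|unit_ball. (1 - x $ i) * (norm (f x))\<^sup>2 * W_weight Rp \<kappa> \<mu> x))
          * energy Rp \<kappa> \<mu> f \<ge> C_const Rp \<kappa> \<mu>"
proof -
  \<comment> \<open>The integral of a nonintegrable weight would be 0 by convention, which would
    make \<open>b_const\<close> and with it the norm of \<open>f\<close> vanish.\<close>
  have "b_const Rp \<kappa> \<mu> \<noteq> 0" using assms(7) by (auto simp: L2_norm_def)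
  then have "integrable unit_ball (W_weight Rp \<kappa> \<mu>)"
    using not_integrable_integral_eq by (fastforce simp: b_const_def)
  then interpret dunkl_ball Rp \<kappa> \<mu>
    using assms by unfold_locales
  define N where "N = nabla Rp \<kappa> \<mu> f"
  have f: "f \<in> L2_space Rp \<kappa> \<mu>" and N: "N \<in> L2_space Rp \<kappa> \<mu>"
    and ex: "\<exists>g. has_weak_gradient_on (regular_set Rp \<kappa> \<mu>) f g"
    using assms(4) by (auto simp: W21_space_def N_def)
  have wg: "has_weak_gradient_on (regular_set Rp \<kappa> \<mu>) f N"
    unfolding N_def nabla_def by (rule someI_ex[OF ex])
  note A = f N wg assms(5-7)
  define E0 where "E0 = component_energy N"
  let ?b = "b_const Rp \<kappa> \<mu>" and ?b' = "b_const Rp \<kappa> (\<mu> + 1)"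
  define J where "J = (LINT x|\<nu>. (1 - x \<bullet> x) * (norm (N x))\<^sup>2)"
  have field: "field (component_grad N k)" if "k \<in> Basis" for k
    using sobolev_imp(2)[OF sobolev_comp[OF A that]] .
  have intN: "integrable \<nu> (\<lambda>x. (1 - x \<bullet> x) * (norm (N x))\<^sup>2)"
  proof (rule Bochner_Integration.integrable_bound[OF integrable_norm_N[OF A]])
    have "(\<lambda>x. 1 - x \<bullet> x) \<in> borel_measurable \<nu>" by (intro continuous_imp_\<nu> continuous_intros)
    then show "(\<lambda>x. (1 - x \<bullet> x) * (norm (N x))\<^sup>2) \<in> borel_measurable \<nu>"
      using integrable_norm_N[OF A] by (auto intro!: borel_measurable_times)
    show "AE x in \<nu>. norm ((1 - x \<bullet> x) * (norm (N x))\<^sup>2) \<le> norm ((norm (N x))\<^sup>2)"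
      by (rule AE_I2) (auto simp: abs_mult power_le_one_iff simp flip: power2_norm_eq_inner intro!: mult_left_le_one_le)
  qed
  have int\<Gamma>: "integrable \<nu> (\<lambda>x. \<Sum>k\<in>Basis. \<Gamma> x (component_grad N k x) (component_grad N k x))"
    by (intro Bochner_Integration.integrable_sum \<Gamma>_integrable field)
  have D: "(norm (nabla_D Rp \<kappa> \<mu> f x))\<^sup>2 =
      (\<Sum>k\<in>Basis. \<Gamma> x (component_grad N k x) (component_grad N k x)) - (1 - x \<bullet> x) * (norm (N x))\<^sup>2" for x
  proof -
    have "(norm (N x))\<^sup>2 = (\<Sum>k\<in>Basis. component_grad N k x \<bullet> component_grad N k x)"
      unfolding norm_N_comp[OF A] by (simp only: power2_norm_eq_inner)
    then show ?thesis
      unfolding power2_norm_nabla_D \<Gamma>_def sum_subtractf N_def[symmetric]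
      by (simp add: component_grad_def power2_eq_square algebra_simps)
  qed
  have "energy Rp \<kappa> \<mu> f = ?b' * J + ?b * (LINT x|\<nu>. (norm (nabla_D Rp \<kappa> \<mu> f x))\<^sup>2)"
  proof -
    have "(LINT x|unit_ball. (norm (N x))\<^sup>2 * W_weight Rp \<kappa> (\<mu> + 1) x) = J"
      unfolding J_def using borel_measurable_integrable[OF intN]
      by (subst integral_\<nu>)
         (auto intro!: Bochner_Integration.integral_cong simp: W_weight_Suc[OF A] power2_norm_eq_inner simp del: mem_cball)
    moreover have "(LINT x|unit_ball. (norm (nabla_D Rp \<kappa> \<mu> f x))\<^sup>2 * W_weight Rp \<kappa> \<mu> x) =
        (LINT x|\<nu>. (norm (nabla_D Rp \<kappa> \<mu> f x))\<^sup>2)"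
      using borel_measurable_integrable[OF Bochner_Integration.integrable_diff[OF int\<Gamma> intN]]
      unfolding D by (subst integral_\<nu>) (simp_all add: mult.commute)
    ultimately show ?thesis by (simp add: energy_def power2_L2_norm N_def)
  qed
  also have "(LINT x|\<nu>. (norm (nabla_D Rp \<kappa> \<mu> f x))\<^sup>2) =
      (\<Sum>k\<in>Basis. En (component_grad N k) (component_grad N k)) - J"
    unfolding D J_def En_def using int\<Gamma> intN field
    by (simp add: Bochner_Integration.integral_sum \<Gamma>_integrable)
  \<comment> \<open>The two energies differ only in the normalisation of the gradient term, and
    \<open>J\<close> is nonnegative.\<close>
  finally have energy: "energy Rp \<kappa> \<mu> f = E0 + (?b' - ?b) * J"
    by (simp add: E0_def component_energy_def algebra_simps)
  have "0 \<le> J" unfolding J_def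
    by (intro integral_nonneg_AE AE_I2) (auto simp: power_le_one_iff simp flip: power2_norm_eq_inner)
  then have E0: "E0 \<le> energy Rp \<kappa> \<mu> f"
    unfolding energy using b_const_mono[OF A] by simp
  define a where "a i = ?b * (LINT x|unit_ball. (1 - x $ i) * (norm (f x))\<^sup>2 * W x)" for i
  \<comment> \<open>The coordinate type is finite, so the minimum is attained at some
    \<open>i\<close>; the bound for that single coordinate is enough.\<close>
  have "Min (range a) \<in> range a" by (rule Min_in) auto
  then obtain i where i: "Min (range a) = a i" by blast
  define M where "M = ?b * (LINT x|\<nu>. x $ i * (norm (f x))\<^sup>2)"
  note moment = coordinate_moment[OF A, where i = i, folded M_def E0_def]
  have "C_const Rp \<kappa> \<mu> \<le> (1 - M) * E0"
    unfolding C_const_def Let_def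
    by (rule uncertainty_constant[OF lam_nonneg moment(1)])
       (use component_energy_ge[OF A] moment(2) in \<open>auto simp: E0_def\<close>)
  also have "\<dots> \<le> (1 - M) * energy Rp \<kappa> \<mu> f"
    using moment(1) E0 abs_square_le_1[of M] by (intro mult_left_mono) auto
  finally show ?thesis unfolding a_def[symmetric] i unfolding a_def moment(3) .
qed

end
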